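(* Let $\lambda=1+\sqrt2$. For each of the following three families of graphs, indexed by integers $m,n\ge1$: the grid graphs $P_m\square P_n$, the cylinder graphs $C_m\square P_n$, and the king graphs $P_m\boxtimes P_n$, there is an algorithm which, given $m$ and $n$, computes the domination polynomial of the corresponding graph in time $O(m^3n^2\lambda^m)$ and space $O(mn\lambda^m)$.
   Context: Dominating set: a subset $S\subseteq V$ of the vertices of a graph $G=(V,E)$ such that every vertex of $V$ is in $S$ or has a neighbor in $S$. Domination polynomial of $G$: $D_G(z)=\sum_S z^{|S|}$, the sum over all dominating sets $S$ of $G$; computing it means computing all its coefficients. $P_k$ is the path graph on $k$ vertices, $C_k$ the cycle graph on $k$ vertices ($C_1$, $C_2$ being a single vertex and a single edge); $\square$ is the Cartesian product and $\boxtimes$ the strong product of graphs. Complexity model: each polynomial coefficient is a fixed-width integer that takes one unit of storage, and copying, shifting or adding coefficients takes unit time per coefficient (concretely, the coefficients are computed modulo a fixed prime; the exact integer coefficients are recovered by the Chinese Remainder Theorem from separate runs for different primes, which are not counted in the bounds). A string of length $O(m)$ over a three-letter alphabet is encoded as one integer, which likewise takes one unit of storage and on which elementary operations take unit time; inserting, deleting or looking up an entry in an ordered associative container with $N$ entries takes time $O(\log N)$. The constants in $O(\cdot)$ do not depend on $m$ and $n$. *)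

theory Defs
  imports
    Complex_Main
    "HOL-Computational_Algebra.Polynomial"
    "HOL-Computational_Algebra.Primes"
    "HOL-Library.Discrete_Functions"
begin

section \<open>Graphs and domination polynomials\<close>

record 'a graph =
  verts :: "'a set"
  edges :: "'a set set"

definition path_graph :: "nat \<Rightarrow> nat graph" where
  "path_graph k = \<lparr>verts = {..<k}, edges = {{i, Suc i} | i. Suc i < k}\<rparr>"

text \<open>The condition \<open>Suc i mod k \<noteq> i\<close> only excludes the loop for \<open>k = 1\<close>; for \<open>k = 2\<close> the two
  values of \<open>i\<close> give the same edge.\<close>

definition cycle_graph :: "nat \<Rightarrow> nat graph" where
  "cycle_graph k =
     \<lparr>verts = {..<k}, edges = {{i, Suc i mod k} | i. i < k \<and> Suc i mod k \<noteq> i}\<rparr>"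

definition cartesian_product :: "'a graph \<Rightarrow> 'b graph \<Rightarrow> ('a \<times> 'b) graph" where
  "cartesian_product G H =
     \<lparr>verts = verts G \<times> verts H,
      edges = {{(u, x), (u, y)} | u x y. u \<in> verts G \<and> {x, y} \<in> edges H}
            \<union> {{(u, x), (v, x)} | u v x. {u, v} \<in> edges G \<and> x \<in> verts H}\<rparr>"

definition strong_product :: "'a graph \<Rightarrow> 'b graph \<Rightarrow> ('a \<times> 'b) graph" where
  "strong_product G H =
     \<lparr>verts = verts G \<times> verts H,
      edges = edges (cartesian_product G H)
            \<union> {{(u, x), (v, y)} | u v x y. {u, v} \<in> edges G \<and> {x, y} \<in> edges H}\<rparr>"

definition dominating_set :: "'a graph \<Rightarrow> 'a set \<Rightarrow> bool" where
  "dominating_set G S \<longleftrightarrow>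
     S \<subseteq> verts G \<and> (\<forall>v\<in>verts G. v \<in> S \<or> (\<exists>u\<in>S. {u, v} \<in> edges G))"

definition domination_poly :: "'a graph \<Rightarrow> int poly" where
  "domination_poly G = (\<Sum>S | dominating_set G S. monom 1 (card S))"

definition grid_graph :: "nat \<Rightarrow> nat \<Rightarrow> (nat \<times> nat) graph" where
  "grid_graph m n = cartesian_product (path_graph m) (path_graph n)"

definition cylinder_graph :: "nat \<Rightarrow> nat \<Rightarrow> (nat \<times> nat) graph" where
  "cylinder_graph m n = cartesian_product (cycle_graph m) (path_graph n)"

definition king_graph :: "nat \<Rightarrow> nat \<Rightarrow> (nat \<times> nat) graph" where
  "king_graph m n = strong_product (path_graph m) (path_graph n)"


section \<open>The model of computation\<close>

text \<open>
  A random access machine with two kinds of data. \<^emph>\<open>Words\<close> are natural numbers below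
  \<^term>\<open>word_bound\<close>: counters, addresses, and strings over a three-letter alphabet encoded as
  integers. \<^emph>\<open>Coefficients\<close> are residues modulo \<^term>\<open>modulus\<close>; the program can only set them to 0
  or 1, copy them and add them, and nothing ever flows from coefficients to words.
  Storage consists of finitely many word registers, an array of words, an array of coefficients
  and one associative container mapping words to words (several containers are obtained by
  tagging the keys).  The container offers no traversal of its entries.

  A machine comes with capacities for the arrays and the container. An access beyond a capacity
  or an expression whose value, or the value of a subexpression, is not below the word bound
  makes the execution get stuck.
\<close>

record machine =
  modulus :: int
  word_bound :: nat
  word_cap :: nat
  coef_cap :: nat
  entry_cap :: nat

record state =
  reg :: "nat \<Rightarrow> nat"
  words :: "nat \<Rightarrow> nat"
  coefs :: "nat \<Rightarrow> int"
  container :: "nat \<rightharpoonup> nat"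

text \<open>An entry of the container consists of two words. The registers are not counted: only those
  named in the program can be used, and their number does not depend on the input.\<close>

definition space :: "machine \<Rightarrow> nat" where
  "space M = word_cap M + coef_cap M + 2 * entry_cap M"

datatype binop = OpAdd | OpSub | OpMul | OpDiv | OpMod | OpLess | OpEq

text \<open>Subtraction is truncated at 0; comparisons return 1 for true and 0 for false.\<close>

fun apply_op :: "binop \<Rightarrow> nat \<Rightarrow> nat \<Rightarrow> nat" where
  "apply_op OpAdd a b = a + b"
| "apply_op OpSub a b = a - b"
| "apply_op OpMul a b = a * b"
| "apply_op OpDiv a b = a div b"
| "apply_op OpMod a b = a mod b"
| "apply_op OpLess a b = (if a < b then 1 else 0)"
| "apply_op OpEq a b = (if a = b then 1 else 0)"

datatype expr = Const nat | Reg nat | Word expr | Bin binop expr expr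

fun eval :: "state \<Rightarrow> expr \<Rightarrow> nat" where
  "eval s (Const c) = c"
| "eval s (Reg r) = reg s r"
| "eval s (Word e) = words s (eval s e)"
| "eval s (Bin f e1 e2) = apply_op f (eval s e1) (eval s e2)"

fun legal :: "machine \<Rightarrow> state \<Rightarrow> expr \<Rightarrow> bool" where
  "legal M s (Const c) \<longleftrightarrow> c < word_bound M"
| "legal M s (Reg r) \<longleftrightarrow> reg s r < word_bound M"
| "legal M s (Word e) \<longleftrightarrow>
     legal M s e \<and> eval s e < word_cap M \<and> words s (eval s e) < word_bound M"
| "legal M s (Bin f e1 e2) \<longleftrightarrow>
     legal M s e1 \<and> legal M s e2 \<and> apply_op f (eval s e1) (eval s e2) < word_bound M"

fun cost :: "expr \<Rightarrow> nat" where
  "cost (Const c) = 1"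
| "cost (Reg r) = 1"
| "cost (Word e) = 1 + cost e"
| "cost (Bin f e1 e2) = 1 + cost e1 + cost e2"

text \<open>The cost \<open>O(log N)\<close> is shifted so that operations on an empty container are not free.\<close>

definition container_cost :: "state \<Rightarrow> nat" where
  "container_cost s = 1 + floor_log (1 + card (dom (container s)))"

definition coef_address :: "machine \<Rightarrow> state \<Rightarrow> expr \<Rightarrow> bool" where
  "coef_address M s e \<longleftrightarrow> legal M s e \<and> eval s e < coef_cap M"

datatype com =
    Skip
  | Assign nat expr
  | Store expr expr
  | CoefZero expr
  | CoefOne expr
  | CoefCopy expr expr
  | CoefAdd expr expr expr
  | Insert expr expr
  | Delete expr
  | Lookup nat expr
  | Seq com com
  | If expr com com
  | While expr com

text \<open>
  \<open>exec M c s t s'\<close>: on machine \<open>M\<close>, command \<open>c\<close> started in state \<open>s\<close> terminates in state \<open>s'\<close>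
  after \<open>t\<close> units of time. The command \<open>Lookup r e\<close> puts 0 into register \<open>r\<close> if the key is absent and
  the successor of the value if it is present.
\<close>

inductive exec :: "machine \<Rightarrow> com \<Rightarrow> state \<Rightarrow> nat \<Rightarrow> state \<Rightarrow> bool" for M where
  exec_Skip: "exec M Skip s 1 s"
| exec_Assign:
    "legal M s e \<Longrightarrow>
     exec M (Assign r e) s (1 + cost e) (s\<lparr>reg := (reg s)(r := eval s e)\<rparr>)"
| exec_Store:
    "legal M s a \<Longrightarrow> eval s a < word_cap M \<Longrightarrow> legal M s e \<Longrightarrow>
     exec M (Store a e) s (1 + cost a + cost e) (s\<lparr>words := (words s)(eval s a := eval s e)\<rparr>)"
| exec_CoefZero:
    "coef_address M s a \<Longrightarrow>
     exec M (CoefZero a) s (1 + cost a) (s\<lparr>coefs := (coefs s)(eval s a := 0)\<rparr>)"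
| exec_CoefOne:
    "coef_address M s a \<Longrightarrow>
     exec M (CoefOne a) s (1 + cost a) (s\<lparr>coefs := (coefs s)(eval s a := 1 mod modulus M)\<rparr>)"
| exec_CoefCopy:
    "coef_address M s a \<Longrightarrow> coef_address M s b \<Longrightarrow>
     exec M (CoefCopy a b) s (1 + cost a + cost b)
       (s\<lparr>coefs := (coefs s)(eval s a := coefs s (eval s b))\<rparr>)"
| exec_CoefAdd:
    "coef_address M s a \<Longrightarrow> coef_address M s b \<Longrightarrow> coef_address M s c \<Longrightarrow>
     exec M (CoefAdd a b c) s (1 + cost a + cost b + cost c)
       (s\<lparr>coefs := (coefs s)
          (eval s a := (coefs s (eval s b) + coefs s (eval s c)) mod modulus M)\<rparr>)"
| exec_Insert:
    "legal M s k \<Longrightarrow> legal M s v \<Longrightarrow>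
     card (insert (eval s k) (dom (container s))) \<le> entry_cap M \<Longrightarrow>
     exec M (Insert k v) s (container_cost s + cost k + cost v)
       (s\<lparr>container := (container s)(eval s k \<mapsto> eval s v)\<rparr>)"
| exec_Delete:
    "legal M s k \<Longrightarrow>
     exec M (Delete k) s (container_cost s + cost k)
       (s\<lparr>container := (container s)(eval s k := None)\<rparr>)"
| exec_Lookup:
    "legal M s k \<Longrightarrow>
     w = (case container s (eval s k) of None \<Rightarrow> 0 | Some v \<Rightarrow> Suc v) \<Longrightarrow> w < word_bound M \<Longrightarrow>
     exec M (Lookup r k) s (container_cost s + cost k) (s\<lparr>reg := (reg s)(r := w)\<rparr>)"
| exec_Seq:
    "exec M c1 s t1 s1 \<Longrightarrow> exec M c2 s1 t2 s2 \<Longrightarrow> exec M (Seq c1 c2) s (t1 + t2) s2"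
| exec_If_true:
    "legal M s b \<Longrightarrow> eval s b \<noteq> 0 \<Longrightarrow> exec M c1 s t s1 \<Longrightarrow>
     exec M (If b c1 c2) s (1 + cost b + t) s1"
| exec_If_false:
    "legal M s b \<Longrightarrow> eval s b = 0 \<Longrightarrow> exec M c2 s t s1 \<Longrightarrow>
     exec M (If b c1 c2) s (1 + cost b + t) s1"
| exec_While_false:
    "legal M s b \<Longrightarrow> eval s b = 0 \<Longrightarrow> exec M (While b c) s (1 + cost b) s"
| exec_While_true:
    "legal M s b \<Longrightarrow> eval s b \<noteq> 0 \<Longrightarrow> exec M c s t1 s1 \<Longrightarrow> exec M (While b c) s1 t2 s2 \<Longrightarrow>
     exec M (While b c) s (1 + cost b + t1 + t2) s2"

inductive_cases Skip_cases: "exec M Skip s t s'"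
inductive_cases Assign_cases: "exec M (Assign r e) s t s'"
inductive_cases Store_cases: "exec M (Store a e) s t s'"
inductive_cases CoefZero_cases: "exec M (CoefZero a) s t s'"
inductive_cases CoefOne_cases: "exec M (CoefOne a) s t s'"
inductive_cases CoefCopy_cases: "exec M (CoefCopy a b) s t s'"
inductive_cases CoefAdd_cases: "exec M (CoefAdd a b c) s t s'"
inductive_cases Insert_cases: "exec M (Insert k v) s t s'"
inductive_cases Delete_cases: "exec M (Delete k) s t s'"
inductive_cases Lookup_cases: "exec M (Lookup r k) s t s'"
inductive_cases Seq_cases: "exec M (Seq c1 c2) s t s'"
inductive_cases If_cases: "exec M (If b c1 c2) s t s'"
inductive_cases While_cases: "exec M (While b c) s t s'"

lemma exec_deterministic:
  "exec M c s t s' \<Longrightarrow> exec M c s t' s'' \<Longrightarrow> t = t' \<and> s' = s''"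
proof (induction arbitrary: t' s'' rule: exec.induct)
  case (exec_Seq c1 s t1 s1 c2 t2 s2)
  from exec_Seq.prems obtain u1 r1 u2
    where r: "t' = u1 + u2" "exec M c1 s u1 r1" "exec M c2 r1 u2 s''"
    by (rule Seq_cases)
  from exec_Seq.IH(1)[OF r(2)] have "t1 = u1" "s1 = r1" by simp_all
  with exec_Seq.IH(2) r(3) have "t2 = u2 \<and> s2 = s''" by simp
  with \<open>t1 = u1\<close> r(1) show ?case by simp
next
  case (exec_If_true s b c1 t s1 c2)
  from exec_If_true.prems exec_If_true.hyps(2)
  obtain u where "t' = 1 + cost b + u" "exec M c1 s u s''"
    by (auto elim: If_cases)
  with exec_If_true.IH[OF this(2)] show ?case by simp
next
  case (exec_If_false s b c2 t s1 c1)
  from exec_If_false.prems exec_If_false.hyps(2)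
  obtain u where "t' = 1 + cost b + u" "exec M c2 s u s''"
    by (auto elim: If_cases)
  with exec_If_false.IH[OF this(2)] show ?case by simp
next
  case (exec_While_false s b c)
  from exec_While_false.prems show ?case
    by (rule While_cases) (use exec_While_false.hyps in simp_all)
next
  case (exec_While_true s b c t1 s1 t2 s2)
  from exec_While_true.prems obtain u1 r1 u2
    where r: "t' = 1 + cost b + u1 + u2" "exec M c s u1 r1" "exec M (While b c) r1 u2 s''"
    by (rule While_cases) (use exec_While_true.hyps(2) in simp_all)
  from exec_While_true.IH(1)[OF r(2)] have "t1 = u1" "s1 = r1" by simp_all
  with exec_While_true.IH(2) r(3) have "t2 = u2 \<and> s2 = s''" by simp
  with \<open>t1 = u1\<close> r(1) show ?case by simp
qed (auto elim: Skip_cases Assign_cases Store_cases CoefZero_cases CoefOne_cases CoefCopy_cases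
       CoefAdd_cases Insert_cases Delete_cases Lookup_cases)


section \<open>Computing domination polynomials\<close>

definition init_state :: "nat \<Rightarrow> nat \<Rightarrow> state" where
  "init_state m n =
     \<lparr>reg = (\<lambda>_. 0)(0 := m, 1 := n), words = (\<lambda>_. 0), coefs = (\<lambda>_. 0), container = Map.empty\<rparr>"

text \<open>Words of \<open>O(m + log n)\<close> bits: they hold strings of length \<open>O(m)\<close> over a three-letter
  alphabet, as well as the numbers \<open>m\<close>, \<open>n\<close> and the addresses.\<close>

definition word_size :: "nat \<Rightarrow> nat \<Rightarrow> nat \<Rightarrow> nat" where
  "word_size k m n = (3 ^ m * (n + 1)) ^ k"

text \<open>Since the residue class modulo \<open>p\<close> of every coefficient is computed by the same program
  for all primes \<open>p\<close>, the modulus is a parameter of the machine and not an input. The degree of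
  the polynomial is at most the number of vertices, so the cells \<open>0, \<dots>, card (verts G)\<close> hold all
  coefficients.\<close>

definition computes_domination_poly ::
  "com \<Rightarrow> machine \<Rightarrow> (nat \<Rightarrow> nat \<Rightarrow> 'a graph) \<Rightarrow> nat \<Rightarrow> nat \<Rightarrow> nat \<Rightarrow> bool" where
  "computes_domination_poly prog M G m n t \<longleftrightarrow>
     (\<exists>s. exec M prog (init_state m n) t s \<and>
          (\<forall>j \<le> card (verts (G m n)).
             coefs s j = coeff (domination_poly (G m n)) j mod modulus M))"

definition domination_poly_algorithm ::
  "(nat \<Rightarrow> nat \<Rightarrow> 'a graph) \<Rightarrow> (nat \<Rightarrow> nat \<Rightarrow> real) \<Rightarrow> (nat \<Rightarrow> nat \<Rightarrow> real) \<Rightarrow> bool" where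
  "domination_poly_algorithm G T S \<longleftrightarrow>
     (\<exists>prog k C. \<forall>m n p. m \<ge> 1 \<longrightarrow> n \<ge> 1 \<longrightarrow> prime p \<longrightarrow>
        (\<exists>M t. modulus M = p \<and> word_bound M = word_size k m n \<and>
               computes_domination_poly prog M G m n t \<and>
               real t \<le> C * T m n \<and> real (space M) \<le> C * S m n))"

end

theory Submission
  imports Defs
begin

text \<open>
  The algorithm is a dynamic program along a linear order of the vertices. Number the vertices
  column by column, so that \<open>(i, j)\<close> becomes \<open>j * m + i\<close>. In all three families the neighbours of
  a vertex that precede it in this order are among its \<open>m + 1\<close> immediate predecessors. So if the
  vertices are put in or left out one after the other, it suffices to remember a letter for each of
  the last \<open>m + 1\<close> vertices: 2 if it is selected, 1 if it is neither selected nor dominated so far,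
  0 if it is not selected but dominated. Such a window is a number below \<open>3 ^ (m + 1)\<close>, with the
  youngest vertex in the lowest digit. Deciding on the next vertex changes some digits from 1 to 0,
  shifts the number and drops the highest digit; since the vertex that leaves the window has met
  all its neighbours, the choice made so far is hopeless exactly if this digit is 1
  (\<open>run_invariant\<close>). Hence the number of dominating sets of each size results from counting, for
  every window and every size, the partial choices that lead to it (\<open>count_Suc\<close>, \<open>count_final\<close>).
  Digits for absent vertices are 0, and \<open>m + 1\<close> absent vertices are appended at the end: then
  there is just one window at the end as well as at the beginning, namely 0.

  The base \<open>1 + sqrt 2\<close> comes from the fact that consecutive vertices of a column are adjacent, so
  that the letters 1 and 2 never occur next to each other within a column. The number of strings
  that obey this rule satisfies the recurrence \<open>a (k + 2) = 2 * a (k + 1) + a k\<close>, whose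
  characteristic root is \<open>1 + sqrt 2\<close>. Only one of the \<open>m\<close> pairs of neighbouring letters of a window
  belongs to two different columns, which costs no more than a constant factor (\<open>card_reach\<close>).

  The program stores the reachable windows in a list, each with the coefficients of its counting
  polynomial; in each round it computes the list for the next vertex, using the container to find
  the entry of a given window. The graph only enters through the at most four places of the window
  that are neighbours of the next vertex, which are passed on as powers of three or as 0.
  There are \<open>m * n + m + 1\<close> rounds with at most \<open>(1 + sqrt 2) ^ (m + 3)\<close> windows, and a window
  takes \<open>O(m * n)\<close> additions of coefficients and a bounded number of container operations of
  cost \<open>O(m)\<close>. This gives the time \<open>O(m\<^sup>2 n\<^sup>2 (1 + sqrt 2) ^ m)\<close>, within the claimed bound
  (\<open>program_correct\<close>, \<open>algorithm_of_weights\<close>).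
\<close>

section \<open>Windows in base three\<close>

text \<open>
  A digit is addressed by its weight \<open>w = 3 ^ d\<close> instead of \<open>d\<close>, because the machine has a
  division but no power. The weight 0 can then stand for an absent neighbour: division by 0 gives 0,
  the digit of a vertex that neither dominates nor needs domination.
\<close>

definition trit :: "nat \<Rightarrow> nat \<Rightarrow> nat" where
  "trit x w = x div w mod 3"

definition clear1 :: "nat \<Rightarrow> nat \<Rightarrow> nat" where
  "clear1 w x = x - w * (if trit x w = 1 then 1 else 0)"

text \<open>
  Selecting a vertex turns its undominated neighbours, of digit 1, into dominated ones.
  Doing this one by one tolerates repeated weights, as they occur for cycles of length 2.
\<close>

definition clear :: "nat list \<Rightarrow> nat \<Rightarrow> nat" where
  "clear ws = fold clear1 ws"

definition new_digit :: "nat list \<Rightarrow> nat \<Rightarrow> nat" where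
  "new_digit ws x = (if \<exists>w\<in>set ws. trit x w = 2 then 0 else 1)"

lemma trit_zero [simp]: "trit x 0 = 0"
  by (simp add: trit_def)

lemma trit_Suc: "trit x (3 ^ Suc d) = trit (x div 3) (3 ^ d)"
  by (simp add: trit_def div_mult2_eq)

lemma trits_eqI:
  assumes "x < 3 ^ k" "y < 3 ^ k" "\<And>d. d < k \<Longrightarrow> trit x (3 ^ d) = trit y (3 ^ d)"
  shows "x = y"
  using assms
proof (induction k arbitrary: x y)
  case (Suc k)
  have "x div 3 = y div 3"
  proof (rule Suc.IH)
    show "trit (x div 3) (3 ^ d) = trit (y div 3) (3 ^ d)" if "d < k" for d
      using Suc.prems(3)[of "Suc d"] that unfolding trit_Suc by simp
  qed (use Suc.prems in auto)
  moreover have "x mod 3 = y mod 3"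
    using Suc.prems(3)[of 0] by (simp add: trit_def)
  ultimately show ?case by (metis div_mult_mod_eq)
qed simp

lemma clear1_le: "clear1 w x \<le> x"
  by (simp add: clear1_def)

lemma trit_clear1:
  "trit (clear1 (3 ^ d) x) (3 ^ e) =
     (if e = d \<and> trit x (3 ^ d) = 1 then 0 else trit x (3 ^ e))"
proof (cases "trit x (3 ^ d) = 1")
  case True
  \<comment> \<open>split \<open>x\<close> into the part above, the digit 1, and the part below the place \<open>d\<close>\<close>
  define q where "q = x div 3 ^ d div 3"
  define r where "r = x mod 3 ^ d"
  have "x div 3 ^ d = q * 3 + 1"
    using True unfolding trit_def q_def by (metis div_mult_mod_eq)
  then have x: "x = (3 * q + 1) * 3 ^ d + r"
    unfolding r_def by (metis div_mult_mod_eq mult.commute)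
  have r: "r < 3 ^ d" by (simp add: r_def)
  have c: "clear1 (3 ^ d) x = (3 * q) * 3 ^ d + r"
    using True x by (simp add: clear1_def algebra_simps)
  consider (lt) "e < d" | (eq) "e = d" | (gt) "e > d" by linarith
  then show ?thesis
  proof cases
    case lt
    then obtain k where k: "d = Suc k + e"
      by (metis add.commute add_Suc_right less_imp_Suc_add)
    have gen: "trit (a * 3 ^ d + r) (3 ^ e) = trit r (3 ^ e)" for a
    proof -
      have "a * 3 ^ d + r = r + (a * 3 ^ k * 3) * 3 ^ e"
        by (simp add: k power_add mult.commute mult.left_commute)
      then have "(a * 3 ^ d + r) div 3 ^ e = a * 3 ^ k * 3 + r div 3 ^ e"
        by (simp only: div_mult_self1 power_not_zero zero_neq_numeral not_False_eq_True
            simp_thms)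
      then show ?thesis by (simp add: trit_def)
    qed
    show ?thesis unfolding c using lt gen[of "3 * q"] gen[of "3 * q + 1"] x by simp
  next
    case eq
    have "(3 * q * 3 ^ d + r) div 3 ^ d = 3 * q" using r by simp
    then show ?thesis unfolding c using eq True by (simp add: trit_def)
  next
    case gt
    then obtain k where k: "e = d + Suc k"
      using less_imp_Suc_add[OF gt] by auto
    have "((3 * q + i) * 3 ^ d + r) div 3 ^ e = q div 3 ^ k" if "i < 3" for i
    proof -
      have "((3 * q + i) * 3 ^ d + r) div 3 ^ d = 3 * q + i" using r by simp
      moreover have "(3 * q + i) div 3 = q" using that by simp
      ultimately show ?thesis unfolding k power_add
        by (simp add: div_mult2_eq)
    qed
    from this[of 0] this[of 1] show ?thesis unfolding c using gt x
      by (simp add: trit_def)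
  qed
qed (auto simp: clear1_def)

lemma clear_le: "clear ws x \<le> x"
  by (induction ws arbitrary: x) (auto simp: clear_def intro: order_trans clear1_le)

lemma trit_clear:
  assumes "\<forall>w\<in>set ws. w = 0 \<or> (\<exists>d. w = 3 ^ d)"
  shows "trit (clear ws x) (3 ^ e) =
           (if 3 ^ e \<in> set ws \<and> trit x (3 ^ e) = 1 then 0 else trit x (3 ^ e))"
  using assms
proof (induction ws arbitrary: x)
  case (Cons w ws)
  have "clear (w # ws) x = clear ws (clear1 w x)" by (simp add: clear_def)
  moreover have "trit (clear1 w x) (3 ^ e) =
      (if 3 ^ e = w \<and> trit x (3 ^ e) = 1 then 0 else trit x (3 ^ e))"
  proof (cases "w = 0")
    case False
    then obtain d where "w = 3 ^ d" using Cons.prems by auto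
    then show ?thesis using trit_clear1[of d x e] by auto
  qed (simp add: clear1_def)
  ultimately show ?case using Cons by auto
qed (simp add: clear_def)


text \<open>
  The product of two digits is 2 exactly if they are 1 and 2: an undominated vertex next to a
  selected one.
\<close>

definition compatible :: "nat \<Rightarrow> nat set" where
  "compatible k = {x. x < 3 ^ k \<and>
     (\<forall>d. Suc d < k \<longrightarrow> trit x (3 ^ d) * trit x (3 ^ Suc d) \<noteq> 2)}"

lemma finite_compatible: "finite (compatible k)"
  by (rule finite_subset[of _ "{..<3 ^ k}"]) (auto simp: compatible_def)

lemma compatible_0: "compatible 0 = {0}"
  by (auto simp: compatible_def)

lemma compatible_1: "compatible (Suc 0) = {0, 1, 2}"
  by (auto simp: compatible_def)

lemma compatible_Suc_div:
  assumes "x \<in> compatible (Suc k)"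
  shows "x div 3 \<in> compatible k"
proof -
  have "trit (x div 3) (3 ^ d) * trit (x div 3) (3 ^ Suc d) \<noteq> 2" if "Suc d < k" for d
    using assms that unfolding compatible_def trit_Suc[symmetric] mem_Collect_eq
    by (metis Suc_less_eq)
  then show ?thesis using assms by (auto simp: compatible_def)
qed

text \<open>
  The letter 0 may stand below any string, 1 below those not starting with 2, and 2 below those
  not starting with 1. So strings starting with 0 are counted three times and all others twice; the
  former are as many as the compatible strings that are shorter by one.
\<close>

lemma card_compatible_rec:
  "card (compatible (Suc (Suc k))) \<le> 2 * card (compatible (Suc k)) + card (compatible k)"
proof -
  let ?A = "compatible (Suc k)"
  let ?B = "\<lambda>i. {x \<in> ?A. x mod 3 = i}"
  let ?f = "\<lambda>d x. 3 * x + d :: nat"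
  have fin: "finite ?A" by (rule finite_compatible)
  have sub: "compatible (Suc (Suc k)) \<subseteq>
      ?f 0 ` ?A \<union> ?f 1 ` (?A - ?B 2) \<union> ?f 2 ` (?A - ?B 1)"
  proof
    fix x assume x: "x \<in> compatible (Suc (Suc k))"
    have a: "x div 3 \<in> ?A" by (rule compatible_Suc_div[OF x])
    have "trit x (3 ^ 0) * trit x (3 ^ Suc 0) \<noteq> 2"
      using x unfolding compatible_def by blast
    then have b: "(x mod 3) * (x div 3 mod 3) \<noteq> 2"
      by (simp add: trit_def)
    have e: "x = 3 * (x div 3) + x mod 3" by simp
    have "x mod 3 < 3" by simp
    then consider "x mod 3 = 0" | "x mod 3 = 1" | "x mod 3 = 2" by linarith
    then show "x \<in> ?f 0 ` ?A \<union> ?f 1 ` (?A - ?B 2) \<union> ?f 2 ` (?A - ?B 1)"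
    proof cases
      case 1
      then have "x = ?f 0 (x div 3)" using e by linarith
      with a show ?thesis by blast
    next
      case 2
      then have "x div 3 \<in> ?A - ?B 2" "x = ?f 1 (x div 3)" using a b e by simp_all
      then show ?thesis by blast
    next
      case 3
      then have "x div 3 \<in> ?A - ?B 1" "x = ?f 2 (x div 3)" using a b e by simp_all
      then show ?thesis by blast
    qed
  qed
  have "card (compatible (Suc (Suc k))) \<le>
      card (?f 0 ` ?A \<union> ?f 1 ` (?A - ?B 2) \<union> ?f 2 ` (?A - ?B 1))"
    by (rule card_mono[OF _ sub]) (use fin in auto)
  also have "\<dots> \<le> card (?f 0 ` ?A) + card (?f 1 ` (?A - ?B 2)) + card (?f 2 ` (?A - ?B 1))"
    by (meson add_mono card_Un_le dual_order.trans order_refl)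
  also have "\<dots> \<le> card ?A + card (?A - ?B 2) + card (?A - ?B 1)"
    by (intro add_mono card_image_le) (use fin in auto)
  also have "card (?A - ?B 2) = card (?B 0 \<union> ?B 1)"
    by (rule arg_cong[where f = card]) auto
  also have "\<dots> \<le> card (?B 0) + card (?B 1)" by (rule card_Un_le)
  also have "card (?A - ?B 1) = card ?A - card (?B 1)"
    using fin by (intro card_Diff_subset) auto
  also have "card (?B 0) \<le> card (compatible k)"
  proof (rule card_inj_on_le[of "\<lambda>x. x div 3"])
    show "inj_on (\<lambda>x. x div 3) (?B 0)"
      by (rule inj_onI) (metis (mono_tags, lifting) div_mult_mod_eq mem_Collect_eq)
  qed (auto intro: compatible_Suc_div finite_compatible)
  finally show ?thesis using card_mono[OF fin, of "?B 1"] by auto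
qed

text \<open>
  \<open>1 + sqrt 2\<close> is the positive solution of \<open>x\<^sup>2 = 2 * x + 1\<close>.
\<close>

lemma card_compatible_le:
  "real (card (compatible k)) \<le> (1 + sqrt 2) ^ (k + 1)"
proof (induction k rule: less_induct)
  case (less k)
  let ?l = "1 + sqrt 2 :: real"
  have sq: "?l ^ 2 = 2 * ?l + 1" by (simp add: power2_eq_square algebra_simps)
  have ge: "1 \<le> sqrt 2" by simp
  consider "k = 0" | "k = Suc 0" | j where "k = Suc (Suc j)"
    by (metis not0_implies_Suc)
  then show ?case
  proof cases
    case 1 then show ?thesis by (simp add: compatible_0)
  next
    case 2
    have "?l ^ (k + 1) = 2 * ?l + 1" using sq 2 by (simp add: numeral_2_eq_2)
    then show ?thesis using 2 ge by (simp add: compatible_1)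
  next
    case 3
    have "real (card (compatible k)) \<le> 2 * card (compatible (Suc j)) + card (compatible j)"
      unfolding 3 using card_compatible_rec[of j] by (simp only: of_nat_le_iff)
    also have "\<dots> \<le> 2 * ?l ^ (Suc j + 1) + ?l ^ (j + 1)"
      unfolding of_nat_add of_nat_mult of_nat_numeral using less[of "Suc j"] less[of j] 3 by (intro add_mono mult_left_mono) auto
    also have "\<dots> = ?l ^ (j + 1) * (2 * ?l + 1)" by (simp add: algebra_simps)
    also have "\<dots> = ?l ^ (k + 1)" using 3 unfolding sq[symmetric] power_add[symmetric] by (simp add: eval_nat_numeral)
    finally show ?thesis .
  qed
qed

text \<open>
  Cutting at the one place where the rule may be violated leaves two compatible strings, of
  lengths \<open>b + 1\<close> and \<open>k - b\<close>.
\<close>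

lemma card_compatible_split:
  assumes b: "b < k"
    and A: "\<And>x. x \<in> A \<Longrightarrow> x < 3 ^ Suc k"
      "\<And>x d. x \<in> A \<Longrightarrow> d < k \<Longrightarrow> d \<noteq> b \<Longrightarrow> trit x (3 ^ d) * trit x (3 ^ Suc d) \<noteq> 2"
  shows "finite A" and "real (card A) \<le> (1 + sqrt 2) ^ (k + 3)"
proof -
  show "finite A" by (rule finite_subset[of _ "{..<3 ^ Suc k}"]) (use A in blast, simp)
  let ?f = "\<lambda>x. (x mod 3 ^ Suc b, x div 3 ^ Suc b) :: nat \<times> nat"
  have low: "trit (x mod 3 ^ Suc b) (3 ^ d) = trit x (3 ^ d)" if "d < Suc b" for x d
  proof -
    define e where "e = b - d"
    have e: "Suc b = d + Suc e" using that by (simp add: e_def)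
    have "x mod 3 ^ Suc b div 3 ^ d = x div 3 ^ d mod 3 ^ Suc e"
      unfolding e power_add by (simp add: mod_mult2_eq)
    moreover have "(3::nat) dvd 3 ^ Suc e" by simp
    ultimately show ?thesis unfolding trit_def by (simp only: mod_mod_cancel)
  qed
  have high: "trit (x div 3 ^ Suc b) (3 ^ d) = trit x (3 ^ (Suc b + d))" for x d
    by (simp add: trit_def div_mult2_eq power_add mult.assoc)
  have img: "?f ` A \<subseteq> compatible (Suc b) \<times> compatible (k - b)"
  proof
    fix y assume "y \<in> ?f ` A"
    then obtain x where x: "x \<in> A" "y = ?f x" by auto
    have "x mod 3 ^ Suc b \<in> compatible (Suc b)"
      unfolding compatible_def mem_Collect_eq
    proof (intro conjI allI impI)
      fix d assume d: "Suc d < Suc b"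
      show "trit (x mod 3 ^ Suc b) (3 ^ d) * trit (x mod 3 ^ Suc b) (3 ^ Suc d) \<noteq> 2"
        using A(2)[OF x(1), of d] d b low[of d x] low[of "Suc d" x] by (simp del: power_Suc)
    qed simp
    moreover have "x div 3 ^ Suc b \<in> compatible (k - b)"
      unfolding compatible_def mem_Collect_eq
    proof (intro conjI allI impI)
      have "(3::nat) ^ Suc k = 3 ^ (k - b) * 3 ^ Suc b"
      proof -
        have "Suc k = k - b + Suc b" using b by simp
        then show ?thesis unfolding power_add[symmetric] by (rule arg_cong)
      qed
      then show "x div 3 ^ Suc b < 3 ^ (k - b)"
        using A(1)[OF x(1)] by (simp only: less_mult_imp_div_less)
      fix d assume d: "Suc d < k - b"
      show "trit (x div 3 ^ Suc b) (3 ^ d) * trit (x div 3 ^ Suc b) (3 ^ Suc d) \<noteq> 2"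
        using A(2)[OF x(1), of "Suc b + d"] d unfolding high by (simp del: power_Suc)
    qed
    ultimately show "y \<in> compatible (Suc b) \<times> compatible (k - b)" using x by simp
  qed
  have inj: "inj_on ?f A"
    by (rule inj_onI) (metis Pair_inject div_mult_mod_eq)
  have "card A \<le> card (compatible (Suc b) \<times> compatible (k - b))"
    by (rule card_inj_on_le[OF inj img]) (intro finite_cartesian_product finite_compatible)
  then have "real (card A) \<le> real (card (compatible (Suc b))) * real (card (compatible (k - b)))"
    unfolding card_cartesian_product of_nat_mult[symmetric] of_nat_le_iff .
  also have "\<dots> \<le> (1 + sqrt 2) ^ (Suc b + 1) * (1 + sqrt 2) ^ (k - b + 1)"
    by (intro mult_mono card_compatible_le) auto
  also have "\<dots> = (1 + sqrt 2) ^ (k + 3)"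
  proof -
    have "Suc b + 1 + (k - b + 1) = k + 3" using b by simp
    then show ?thesis unfolding power_add[symmetric] by (rule arg_cong)
  qed
  finally show "real (card A) \<le> (1 + sqrt 2) ^ (k + 3)" .
qed

section \<open>An automaton for dominating sets\<close>

text \<open>
  A graph on \<open>{..<N}\<close> given by the weights, within a window of \<open>m + 1\<close> digits, of the earlier
  neighbours of each vertex. The last assumption says that vertices next to each other within a
  block of length \<open>m\<close> are adjacent; this is what limits the number of windows.
\<close>

locale frontier =
  fixes m N :: nat and ws :: "nat \<Rightarrow> nat list"
  assumes m_pos: "1 \<le> m"
    and weights: "\<And>t w. w \<in> set (ws t) \<Longrightarrow> w = 0 \<or> (\<exists>d\<le>m. w = 3 ^ d)"
    and column: "\<And>t. t mod m \<noteq> 0 \<Longrightarrow> 1 \<in> set (ws t)"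
begin

definition adj :: "nat \<Rightarrow> nat \<Rightarrow> bool" where
  "adj u v \<longleftrightarrow> u < v \<and> v < N \<and> 3 ^ (v - 1 - u) \<in> set (ws v)"

definition dominated :: "nat \<Rightarrow> nat set \<Rightarrow> nat \<Rightarrow> bool" where
  "dominated t S v \<longleftrightarrow> v \<in> S \<or> (\<exists>u\<in>S. u < t \<and> (adj u v \<or> adj v u))"

text \<open>
  The vertex that leaves the window has no later neighbours; if it is still undominated, no
  completion is a dominating set.
\<close>

definition push :: "nat \<Rightarrow> nat \<Rightarrow> nat option" where
  "push x d = (if x div 3 ^ m = 1 then None else Some (3 * (x mod 3 ^ m) + d))"

definition step :: "nat \<Rightarrow> nat \<Rightarrow> bool \<Rightarrow> nat option" where
  "step t x z =
     (if z then (if t < N then push (clear (ws t) x) 2 else None)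
      else push x (if t < N then new_digit (ws t) x else 0))"

primrec run :: "nat \<Rightarrow> nat set \<Rightarrow> nat option" where
  "run 0 S = Some 0"
| "run (Suc t) S = Option.bind (run t S) (\<lambda>x. step t x (t \<in> S))"

text \<open>
  What the digit \<open>d\<close> of the window at time \<open>t\<close> has to be: it belongs to the vertex \<open>t - 1 - d\<close>, with
  0 for the positions before the first and after the last vertex.
\<close>

definition digit :: "nat \<Rightarrow> nat set \<Rightarrow> nat \<Rightarrow> nat" where
  "digit t S d =
     (if t \<le> d \<or> N \<le> t - 1 - d then 0 else if t - 1 - d \<in> S then 2
      else if dominated t S (t - 1 - d) then 0 else 1)"

lemma trit_push:
  assumes "push x d = Some y" "d < 3"
  shows "trit y 1 = d" and "e < m \<Longrightarrow> trit y (3 ^ Suc e) = trit x (3 ^ e)" and "y < 3 ^ Suc m"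
proof -
  have y: "y = 3 * (x mod 3 ^ m) + d"
    using assms by (auto simp: push_def split: if_splits)
  show "trit y 1 = d" using assms(2) by (simp add: trit_def y)
  have "Suc (x mod 3 ^ m) \<le> 3 ^ m" by (simp add: Suc_leI)
  then show "y < 3 ^ Suc m" using y assms(2) by simp
  show "trit y (3 ^ Suc e) = trit x (3 ^ e)" if "e < m"
  proof -
    define k where "k = m - e - 1"
    have m: "m = e + Suc k" using that by (simp add: k_def)
    have "x mod 3 ^ m div 3 ^ e = x div 3 ^ e mod 3 ^ Suc k"
      unfolding m power_add by (simp add: mod_mult2_eq)
    moreover have "y div 3 = x mod 3 ^ m" using y assms(2) by simp
    moreover have "(3::nat) dvd 3 ^ Suc k" by simp
    ultimately show ?thesis unfolding trit_Suc unfolding trit_def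
      by (simp only: mod_mod_cancel)
  qed
qed

lemma top_digit:
  assumes "x < 3 ^ Suc m"
  shows "x div 3 ^ m = trit x (3 ^ m)"
  using assms by (simp add: trit_def less_mult_imp_div_less)

lemma adj_less: "adj u v \<Longrightarrow> u < v \<and> v \<le> u + m + 1 \<and> v < N"
proof -
  assume a: "adj u v"
  then have "3 ^ (v - 1 - u) \<in> set (ws v)" by (simp add: adj_def)
  with weights obtain d where "d \<le> m" "(3::nat) ^ (v - 1 - u) = 3 ^ d"
    by (metis power_not_zero zero_neq_numeral)
  then have "v - 1 - u \<le> m" by simp
  then show ?thesis using a by (auto simp: adj_def)
qed

text \<open>
  The window tells the truth about the last \<open>m + 1\<close> vertices, and all older vertices are dominated
  as long as the run has not failed. Domination of an older vertex does not change any more, because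
  adjacent vertices differ by at most \<open>m + 1\<close>.
\<close>

lemma run_invariant:
  assumes S: "S \<subseteq> {..<N}"
  shows "(run t S \<noteq> None \<longleftrightarrow> (\<forall>v. v + m + 1 < t \<longrightarrow> v < N \<longrightarrow> dominated t S v)) \<and>
    (\<forall>x. run t S = Some x \<longrightarrow> x < 3 ^ Suc m \<and> (\<forall>d\<le>m. trit x (3 ^ d) = digit t S d))"
proof (induction t)
  case 0
  show ?case by (simp add: digit_def trit_def)
next
  case (Suc t)
  have old: "dominated (Suc t) S v \<longleftrightarrow> dominated t S v" if "v + m + 1 < t" for v
    using that adj_less[of v t] adj_less[of t v] by (auto simp: dominated_def less_Suc_eq)
  have mono: "dominated t S v \<Longrightarrow> dominated (Suc t) S v" for v
    by (auto simp: dominated_def less_Suc_eq)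
  show ?case
  proof (cases "run t S")
    case None
    then obtain v where "v + m + 1 < t" "v < N" "\<not> dominated t S v" using Suc by auto
    then have "v + m + 1 < Suc t" "v < N" "\<not> dominated (Suc t) S v" using old by auto
    then show ?thesis using None by auto
  next
    case (Some x)
    have x: "x < 3 ^ Suc m" "\<And>d. d \<le> m \<Longrightarrow> trit x (3 ^ d) = digit t S d"
      using Suc Some by auto
    have dom_old: "\<forall>v. v + m + 1 < t \<longrightarrow> v < N \<longrightarrow> dominated t S v" using Suc Some by auto
    \<comment> \<open>the window after the update by the vertex \<open>t\<close> and before the shift, and the new digit\<close>
    define y where "y = (if t \<in> S then clear (ws t) x else x)"
    define n where "n = (if t \<in> S then 2 else if t < N then new_digit (ws t) x else 0)"
    have step: "run (Suc t) S = push y n"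
      using S Some by (auto simp: step_def y_def n_def)
    have n: "n < 3" by (simp add: n_def new_digit_def)
    have y_less: "y < 3 ^ Suc m"
      using x(1) clear_le[of "ws t" x] by (auto simp: y_def)
    have w: "\<forall>w\<in>set (ws t). w = 0 \<or> (\<exists>d. w = 3 ^ d)" using weights by blast
    have y_digit: "trit y (3 ^ d) = digit (Suc t) S (Suc d)" if d: "d \<le> m" for d
    proof (cases "t \<le> d \<or> N \<le> t - 1 - d")
      case True
      then show ?thesis using x(2)[OF d] trit_clear[OF w, of x d] by (auto simp: digit_def y_def)
    next
      case False
      let ?v = "t - 1 - d"
      have v: "?v < t" "?v < N" "t - 1 - ?v = d" using False by auto
      have "dominated (Suc t) S ?v \<longleftrightarrow> dominated t S ?v \<or> t \<in> S \<and> 3 ^ d \<in> set (ws t)"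
        using v S unfolding dominated_def adj_def by (auto simp: less_Suc_eq)
      then show ?thesis
        using x(2)[OF d] trit_clear[OF w, of x d] False
        by (auto simp: digit_def y_def)
    qed
    have n_digit: "n = digit (Suc t) S 0"
    proof -
      have "(\<exists>w\<in>set (ws t). trit x w = 2) \<longleftrightarrow> dominated (Suc t) S t" if t: "t < N" "t \<notin> S"
      proof
        assume "\<exists>w\<in>set (ws t). trit x w = 2"
        then obtain w where w': "w \<in> set (ws t)" "trit x w = 2" by auto
        then have "w \<noteq> 0" by (metis trit_zero zero_neq_numeral)
        then obtain d where d: "w = 3 ^ d" "d \<le> m" using weights[OF w'(1)] by auto
        then have "digit t S d = 2" using x(2) w' by auto
        then have "d < t" "t - 1 - d \<in> S" by (auto simp: digit_def split: if_splits)
        then show "dominated (Suc t) S t" using t d w'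
          unfolding dominated_def adj_def by (auto intro!: bexI[of _ "t - 1 - d"])
      next
        assume "dominated (Suc t) S t"
        then obtain u where u: "u \<in> S" "adj u t"
          using t unfolding dominated_def adj_def by (auto simp: less_Suc_eq)
        then have "t - 1 - u \<le> m" "u < t" using adj_less[of u t] by auto
        then have *: "t - 1 - (t - 1 - u) = u" "\<not> t \<le> t - 1 - u" "\<not> N \<le> u" "t - 1 - u \<le> m"
          using t by auto
        have "trit x (3 ^ (t - 1 - u)) = 2"
          unfolding x(2)[OF *(4)] digit_def *(1) using * u by simp
        moreover have "3 ^ (t - 1 - u) \<in> set (ws t)" using u by (simp add: adj_def)
        ultimately show "\<exists>w\<in>set (ws t). trit x w = 2" by blast
      qed
      then show ?thesis using S by (auto simp: digit_def n_def new_digit_def)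
    qed
    have top: "y div 3 ^ m = digit (Suc t) S (Suc m)"
      using top_digit[OF y_less] y_digit by simp
    have bad: "y div 3 ^ m = 1 \<longleftrightarrow>
        \<not> (m < t \<longrightarrow> t - 1 - m < N \<longrightarrow> dominated (Suc t) S (t - 1 - m))"
      unfolding top by (auto simp: digit_def dominated_def)
    have "push y n \<noteq> None \<longleftrightarrow> (m < t \<longrightarrow> t - 1 - m < N \<longrightarrow> dominated (Suc t) S (t - 1 - m))"
      using bad by (auto simp: push_def)
    also have "\<dots> \<longleftrightarrow> (\<forall>v. v + m + 1 < Suc t \<longrightarrow> v < N \<longrightarrow> dominated (Suc t) S v)"
    proof
      assume *: "m < t \<longrightarrow> t - 1 - m < N \<longrightarrow> dominated (Suc t) S (t - 1 - m)"
      show "\<forall>v. v + m + 1 < Suc t \<longrightarrow> v < N \<longrightarrow> dominated (Suc t) S v"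
      proof (intro allI impI)
        fix v assume v: "v + m + 1 < Suc t" "v < N"
        show "dominated (Suc t) S v"
        proof (cases "v + m + 1 = t")
          case True
          then have "v = t - 1 - m" "m < t" by auto
          then show ?thesis using * v by simp
        next
          case False
          then show ?thesis using v dom_old mono by simp
        qed
      qed
    qed auto
    finally have 1: "run (Suc t) S \<noteq> None \<longleftrightarrow>
      (\<forall>v. v + m + 1 < Suc t \<longrightarrow> v < N \<longrightarrow> dominated (Suc t) S v)" unfolding step .
    have 2: "z < 3 ^ Suc m \<and> (\<forall>d\<le>m. trit z (3 ^ d) = digit (Suc t) S d)"
      if "run (Suc t) S = Some z" for z
    proof -
      have p: "push y n = Some z" using that step by simp
      have "trit z (3 ^ d) = digit (Suc t) S d" if "d \<le> m" for d
      proof (cases d)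
        case 0
        then show ?thesis using trit_push(1)[OF p n] n_digit by simp
      next
        case (Suc e)
        then show ?thesis using trit_push(2)[OF p n, of e] y_digit[of e] that by simp
      qed
      then show ?thesis using trit_push(3)[OF p n] by simp
    qed
    show ?thesis using 1 2 by blast
  qed
qed

lemma run_inter: "run t (S \<inter> {..<t'}) = run t S" if "t \<le> t'"
  using that by (induction t) auto

lemma run_bounded: "run t S \<noteq> None \<Longrightarrow> S \<inter> {..<t} \<subseteq> {..<N}"
proof (induction t)
  case (Suc t)
  then obtain x where x: "run t S = Some x" by (cases "run t S") auto
  with Suc have "t < N" if "t \<in> S" using that by (auto simp: step_def split: if_splits)
  moreover have "S \<inter> {..<t} \<subseteq> {..<N}" using Suc x by auto
  ultimately show ?case by (auto simp: less_Suc_eq)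
qed auto

text \<open>
  After \<open>m + 1\<close> absent vertices the window has forgotten all real ones, so that it is 0 and every
  real vertex has been checked.
\<close>

lemma run_final:
  assumes S: "S \<subseteq> {..<N}"
  shows "run (N + m + 1) S = Some 0 \<longleftrightarrow> (\<forall>v<N. v \<in> S \<or> (\<exists>u\<in>S. adj u v \<or> adj v u))"
proof -
  have "x = 0" if "run (N + m + 1) S = Some x" for x
  proof (rule trits_eqI)
    show "x < 3 ^ Suc m" using run_invariant[OF S] that by blast
    show "trit x (3 ^ d) = trit 0 (3 ^ d)" if d: "d < Suc m" for d
    proof -
      have "trit x (3 ^ d) = digit (N + m + 1) S d"
        using run_invariant[OF S] \<open>run (N + m + 1) S = Some x\<close> d by (meson less_Suc_eq_le)
      also have "\<dots> = 0" using d by (simp add: digit_def)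
      finally show ?thesis by (simp add: trit_def)
    qed
  qed simp
  then have "run (N + m + 1) S = Some 0 \<longleftrightarrow> run (N + m + 1) S \<noteq> None" by auto
  also have "\<dots> \<longleftrightarrow> (\<forall>v<N. dominated (N + m + 1) S v)"
    using run_invariant[OF S, of "N + m + 1"] by auto
  also have "\<dots> \<longleftrightarrow> (\<forall>v<N. v \<in> S \<or> (\<exists>u\<in>S. adj u v \<or> adj v u))"
    using S by (fastforce simp: dominated_def)
  finally show ?thesis .
qed

definition reach :: "nat \<Rightarrow> nat set" where
  "reach t = {x. \<exists>S. run t S = Some x}"

lemma reach_0: "reach 0 = {0}"
  by (simp add: reach_def)

lemma reach_Suc: "reach (Suc t) = {y. \<exists>x\<in>reach t. \<exists>z. step t x z = Some y}"
proof (intro set_eqI iffI)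
  fix y assume "y \<in> reach (Suc t)"
  then show "y \<in> {y. \<exists>x\<in>reach t. \<exists>z. step t x z = Some y}"
    by (auto simp: reach_def bind_eq_Some_conv)
next
  fix y assume "y \<in> {y. \<exists>x\<in>reach t. \<exists>z. step t x z = Some y}"
  then obtain S x z where *: "run t S = Some x" "step t x z = Some y" by (auto simp: reach_def)
  \<comment> \<open>membership of \<open>t\<close> can be chosen freely, as earlier steps do not look at it\<close>
  define S' where "S' = (if z then insert t (S \<inter> {..<t}) else S \<inter> {..<t})"
  have "S' \<inter> {..<t} = S \<inter> {..<t}" "t \<in> S' \<longleftrightarrow> z" by (auto simp: S'_def)
  moreover from this have "run t S' = Some x"
    using *(1) run_inter[of t t S] run_inter[of t t S'] by simp
  ultimately have "run (Suc t) S' = Some y" using *(2) by simp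
  then show "y \<in> reach (Suc t)" by (auto simp: reach_def)
qed

lemma reach_digits:
  assumes "x \<in> reach t"
  obtains S where "S \<subseteq> {..<N}" "x < 3 ^ Suc m" "\<forall>d\<le>m. trit x (3 ^ d) = digit t S d"
proof -
  obtain S where "run t S = Some x" using assms by (auto simp: reach_def)
  then have *: "run t (S \<inter> {..<t}) = Some x" "S \<inter> {..<t} \<subseteq> {..<N}"
    using run_inter[of t t S] run_bounded[of t S] by auto
  have "x < 3 ^ Suc m \<and> (\<forall>d\<le>m. trit x (3 ^ d) = digit t (S \<inter> {..<t}) d)"
    using run_invariant[OF *(2), of t] *(1) by (elim conjE allE[of _ x]) (erule mp)
  then show ?thesis using that[OF *(2)] by simp
qed

lemma reach_less: "x \<in> reach t \<Longrightarrow> x < 3 ^ Suc m"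
  using reach_digits[of x t] by blast

text \<open>
  A pair of neighbouring digits \<open>d\<close> and \<open>d + 1\<close> may be 1 and 2 only if the vertex \<open>t - 1 - d\<close> is
  the first of its block, which happens for one residue of \<open>d\<close> modulo \<open>m\<close>.
\<close>

lemma card_reach:
  "finite (reach t)" "real (card (reach t)) \<le> (1 + sqrt 2) ^ (m + 3)"
proof -
  \<comment> \<open>the one place at which the window passes from a block to the previous one\<close>
  define b where "b = (t - 1) mod m"
  have "b < m" using m_pos by (simp add: b_def)
  moreover have "trit x (3 ^ d) * trit x (3 ^ Suc d) \<noteq> 2"
    if x: "x \<in> reach t" and d: "d < m" "d \<noteq> b" for x d
  proof -
    obtain S where S: "S \<subseteq> {..<N}" "\<forall>d\<le>m. trit x (3 ^ d) = digit t S d"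
      using reach_digits[OF x] by metis
    have "digit t S d * digit t S (Suc d) \<noteq> 2"
    proof (cases "t \<le> Suc d \<or> N \<le> t - 1 - d")
      case True
      then show ?thesis by (auto simp: digit_def)
    next
      case False
      let ?v = "t - 1 - d"
      have "?v mod m \<noteq> 0"
      proof
        assume "?v mod m = 0"
        then have "(d + ?v) mod m = d mod m" by (metis add.right_neutral mod_add_right_eq)
        moreover have "d + ?v = t - 1" using False by simp
        ultimately show False using d by (simp add: b_def)
      qed
      then have "1 \<in> set (ws ?v)" by (rule column)
      then have "adj (t - 1 - Suc d) ?v" using False by (auto simp: adj_def)
      then show ?thesis using False by (auto simp: digit_def dominated_def)
    qed
    then show ?thesis using S d by (simp del: power_Suc)
  qed
  ultimately show "finite (reach t)" "real (card (reach t)) \<le> (1 + sqrt 2) ^ (m + 3)"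
    using card_compatible_split[of b m "reach t"] reach_less by blast+
qed

lemma reach_final: "reach (N + m + 1) = {0}"
proof (intro equalityI subsetI)
  fix x assume "x \<in> reach (N + m + 1)"
  then obtain S where S: "x < 3 ^ Suc m" "\<forall>d\<le>m. trit x (3 ^ d) = digit (N + m + 1) S d"
    using reach_digits by metis
  then have "trit x (3 ^ d) = trit 0 (3 ^ d)" if "d < Suc m" for d
    using that by (simp add: digit_def trit_def)
  with S(1) have "x = 0" by (intro trits_eqI[of x "Suc m" 0]) auto
  then show "x \<in> {0}" by simp
next
  have "run (N + m + 1) {..<N} = Some 0" using run_final[of "{..<N}"] by auto
  then show "x \<in> reach (N + m + 1)" if "x \<in> {0}" for x using that unfolding reach_def by blast
qed

definition count :: "nat \<Rightarrow> nat \<Rightarrow> nat \<Rightarrow> nat" where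
  "count t x k = card {S. S \<subseteq> {..<t} \<and> run t S = Some x \<and> card S = k}"

lemma count_0: "count 0 x k = (if x = 0 \<and> k = 0 then 1 else 0)"
proof -
  have "{S::nat set. S \<subseteq> {..<0} \<and> run 0 S = Some x \<and> card S = k} =
      {S. S = {} \<and> x = 0 \<and> k = 0}"
    by (auto simp del: card_0_eq)
  then show ?thesis by (cases "x = 0 \<and> k = 0") (auto simp: count_def)
qed

definition contribution :: "nat \<Rightarrow> nat \<Rightarrow> nat \<Rightarrow> nat \<Rightarrow> nat" where
  "contribution t x y k =
     (if step t x False = Some y then count t x k else 0) +
     (if step t x True = Some y \<and> 1 \<le> k then count t x (k - 1) else 0)"

text \<open>
  This recurrence is the dynamic program: a choice for the first \<open>t + 1\<close> vertices either leaves
  out the vertex \<open>t\<close>, or selects it and has one element less before.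
\<close>

lemma count_Suc: "count (Suc t) y k = (\<Sum>x\<in>reach t. contribution t x y k)"
proof -
  let ?A = "\<lambda>x. {S. S \<subseteq> {..<t} \<and> run t S = Some x \<and> card S = k \<and> step t x False = Some y}"
  let ?B = "\<lambda>x. {S. S \<subseteq> {..<t} \<and> run t S = Some x \<and> Suc (card S) = k \<and> step t x True = Some y}"
  have fin: "finite (?A x)" "finite (?B x)" for x
    by (rule finite_subset[of _ "Pow {..<t}"]; auto)+
  have run_insert: "run t (insert t S) = run t S" for S
    using run_inter[of t t S] run_inter[of t t "insert t S"] by simp
  have card_insert: "card (insert t S) = Suc (card S)" if "S \<subseteq> {..<t}" for S
    using that finite_subset[OF that] by (subst card_insert_disjoint) auto
  have eq: "{S. S \<subseteq> {..<Suc t} \<and> run (Suc t) S = Some y \<and> card S = k} =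
      (\<Union>x\<in>reach t. ?A x) \<union> (\<Union>x\<in>reach t. insert t ` ?B x)" (is "?L = ?R")
  proof (intro set_eqI iffI)
    fix S assume S: "S \<in> ?L"
    then obtain x where x: "run t S = Some x" "step t x (t \<in> S) = Some y"
      by (auto simp: bind_eq_Some_conv)
    have xr: "x \<in> reach t" using x by (auto simp: reach_def)
    show "S \<in> ?R"
    proof (cases "t \<in> S")
      case True
      then obtain S' where S': "S = insert t S'" "t \<notin> S'" by (meson mk_disjoint_insert)
      then have "S' \<subseteq> {..<t}" using S by (auto simp: less_Suc_eq)
      then have "S' \<in> ?B x" using S x S' card_insert[of S'] True by (auto simp: run_insert)
      then show ?thesis using xr S' by blast
    next
      case False
      then have "S \<subseteq> {..<t}" using S by (auto simp: less_Suc_eq subset_iff)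
      then have "S \<in> ?A x" using S x False by auto
      then show ?thesis using xr by blast
    qed
  next
    fix S assume "S \<in> ?R"
    then consider x where "S \<in> ?A x" | x S' where "S' \<in> ?B x" "S = insert t S'" by blast
    then show "S \<in> ?L"
    proof cases
      case 1
      then have "t \<notin> S" by auto
      then show ?thesis using 1 by auto
    next
      case 2
      then show ?thesis using card_insert[of S'] by (auto simp: run_insert)
    qed
  qed
  have fr: "finite (reach t)" by (rule card_reach)
  have "count (Suc t) y k = card (\<Union>x\<in>reach t. ?A x) + card (\<Union>x\<in>reach t. insert t ` ?B x)"
    unfolding count_def eq
    by (rule card_Un_disjoint) (use fin fr in auto)
  also have "card (\<Union>x\<in>reach t. ?A x) = (\<Sum>x\<in>reach t. card (?A x))"
    by (rule card_UN_disjoint) (use fr fin in auto)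
  also have "card (\<Union>x\<in>reach t. insert t ` ?B x) = (\<Sum>x\<in>reach t. card (insert t ` ?B x))"
    by (rule card_UN_disjoint) (use fr fin in \<open>auto simp: run_insert dest: arg_cong[of _ _ "run t"]\<close>)
  also have "(\<Sum>x\<in>reach t. card (insert t ` ?B x)) = (\<Sum>x\<in>reach t. card (?B x))"
  proof (rule sum.cong[OF refl], rule card_image, rule inj_onI)
    fix x S S' assume "S \<in> ?B x" "S' \<in> ?B x" "insert t S = insert t S'"
    then show "S = S'" by (subst (asm) insert_ident) auto
  qed
  finally have total: "count (Suc t) y k = (\<Sum>x\<in>reach t. card (?A x)) + (\<Sum>x\<in>reach t. card (?B x))" .
  have a: "card (?A x) = (if step t x False = Some y then count t x k else 0)" for x
    by (simp add: count_def)
  have b: "card (?B x) =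
      (if step t x True = Some y \<and> 1 \<le> k then count t x (k - 1) else 0)" for x
  proof (cases k)
    case (Suc j)
    then show ?thesis by (auto simp: count_def)
  qed auto
  show ?thesis unfolding total a b contribution_def sum.distrib ..
qed

lemma count_final:
  "count (N + m + 1) 0 k =
     card {S. S \<subseteq> {..<N} \<and> (\<forall>v<N. v \<in> S \<or> (\<exists>u\<in>S. adj u v \<or> adj v u)) \<and> card S = k}"
proof -
  let ?T = "N + m + 1"
  have "S \<subseteq> {..<?T} \<and> run ?T S = Some 0 \<longleftrightarrow>
      S \<subseteq> {..<N} \<and> (\<forall>v<N. v \<in> S \<or> (\<exists>u\<in>S. adj u v \<or> adj v u))" for S
  proof (cases "S \<subseteq> {..<N}")
    case True
    then have "S \<subseteq> {..<?T}" by auto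
    then show ?thesis using run_final[OF True] True by simp
  next
    case False
    then show ?thesis using run_bounded[of ?T S] by (auto simp: inf.absorb1)
  qed
  then have "{S. S \<subseteq> {..<?T} \<and> run ?T S = Some 0 \<and> card S = k} =
    {S. S \<subseteq> {..<N} \<and> (\<forall>v<N. v \<in> S \<or> (\<exists>u\<in>S. adj u v \<or> adj v u)) \<and> card S = k}"
    by blast
  then show ?thesis by (simp add: count_def)
qed

end

section \<open>Weakest preconditions with running times\<close>

text \<open>
  Since execution is deterministic, this weakest precondition determines the final state and the
  running time. It satisfies an equation for every construct except loops, so straight-line code is
  executed symbolically by rewriting.
\<close>

definition wp :: "machine \<Rightarrow> com \<Rightarrow> state \<Rightarrow> (nat \<Rightarrow> state \<Rightarrow> bool) \<Rightarrow> bool" where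
  "wp M c s Q \<longleftrightarrow> (\<exists>t s'. exec M c s t s' \<and> Q t s')"

lemma wp_mono: "wp M c s Q \<Longrightarrow> (\<And>t s'. Q t s' \<Longrightarrow> R t s') \<Longrightarrow> wp M c s R"
  by (auto simp: wp_def)

lemma wp_Skip [simp]: "wp M Skip s Q \<longleftrightarrow> Q 1 s"
  by (auto simp: wp_def simp del: One_nat_def intro: exec_Skip elim!: Skip_cases) simp_all

lemma wp_Assign [simp]:
  "wp M (Assign r e) s Q \<longleftrightarrow>
     legal M s e \<and> Q (1 + cost e) (s\<lparr>reg := (reg s)(r := eval s e)\<rparr>)"
  by (auto simp: wp_def simp del: One_nat_def intro: exec_Assign elim!: Assign_cases) simp_all

lemma wp_Store [simp]:
  "wp M (Store a e) s Q \<longleftrightarrow>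
     legal M s a \<and> eval s a < word_cap M \<and> legal M s e \<and>
     Q (1 + cost a + cost e) (s\<lparr>words := (words s)(eval s a := eval s e)\<rparr>)"
  by (auto simp: wp_def simp del: One_nat_def intro: exec_Store elim!: Store_cases) simp_all

lemma wp_CoefZero [simp]:
  "wp M (CoefZero a) s Q \<longleftrightarrow>
     coef_address M s a \<and> Q (1 + cost a) (s\<lparr>coefs := (coefs s)(eval s a := 0)\<rparr>)"
  by (auto simp: wp_def simp del: One_nat_def intro: exec_CoefZero elim!: CoefZero_cases) simp_all

lemma wp_CoefOne [simp]:
  "wp M (CoefOne a) s Q \<longleftrightarrow>
     coef_address M s a \<and> Q (1 + cost a) (s\<lparr>coefs := (coefs s)(eval s a := 1 mod modulus M)\<rparr>)"
  by (auto simp: wp_def simp del: One_nat_def intro: exec_CoefOne elim!: CoefOne_cases) simp_all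

lemma wp_CoefCopy [simp]:
  "wp M (CoefCopy a b) s Q \<longleftrightarrow>
     coef_address M s a \<and> coef_address M s b \<and>
     Q (1 + cost a + cost b) (s\<lparr>coefs := (coefs s)(eval s a := coefs s (eval s b))\<rparr>)"
  by (auto simp: wp_def simp del: One_nat_def intro: exec_CoefCopy elim!: CoefCopy_cases) simp_all

lemma wp_CoefAdd [simp]:
  "wp M (CoefAdd a b c) s Q \<longleftrightarrow>
     coef_address M s a \<and> coef_address M s b \<and> coef_address M s c \<and>
     Q (1 + cost a + cost b + cost c)
       (s\<lparr>coefs := (coefs s)
          (eval s a := (coefs s (eval s b) + coefs s (eval s c)) mod modulus M)\<rparr>)"
  by (auto simp: wp_def simp del: One_nat_def intro: exec_CoefAdd elim!: CoefAdd_cases) simp_all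

lemma wp_Insert [simp]:
  "wp M (Insert k v) s Q \<longleftrightarrow>
     legal M s k \<and> legal M s v \<and>
     card (insert (eval s k) (dom (container s))) \<le> entry_cap M \<and>
     Q (container_cost s + cost k + cost v)
       (s\<lparr>container := (container s)(eval s k \<mapsto> eval s v)\<rparr>)"
  by (auto simp: wp_def simp del: One_nat_def intro: exec_Insert elim!: Insert_cases)

lemma wp_Delete [simp]:
  "wp M (Delete k) s Q \<longleftrightarrow>
     legal M s k \<and>
     Q (container_cost s + cost k) (s\<lparr>container := (container s)(eval s k := None)\<rparr>)"
  by (auto simp: wp_def simp del: One_nat_def intro: exec_Delete elim!: Delete_cases)

lemma wp_Lookup [simp]:
  "wp M (Lookup r k) s Q \<longleftrightarrow>
     (let w = (case container s (eval s k) of None \<Rightarrow> 0 | Some v \<Rightarrow> Suc v) in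
      legal M s k \<and> w < word_bound M \<and>
      Q (container_cost s + cost k) (s\<lparr>reg := (reg s)(r := w)\<rparr>))"
  unfolding wp_def Let_def by (auto intro: exec_Lookup elim: Lookup_cases)

lemma wp_Seq [simp]:
  "wp M (Seq c d) s Q \<longleftrightarrow> wp M c s (\<lambda>t s'. wp M d s' (\<lambda>u. Q (t + u)))"
  unfolding wp_def by (blast intro: exec_Seq elim: Seq_cases)

lemma wp_If [simp]:
  "wp M (If b c d) s Q \<longleftrightarrow>
     legal M s b \<and> wp M (if eval s b \<noteq> 0 then c else d) s (\<lambda>t. Q (1 + cost b + t))"
  by (cases "eval s b = 0"; auto simp: wp_def simp del: One_nat_def
      intro: exec_If_true exec_If_false elim!: If_cases; force)

lemma wp_while:
  assumes step: "\<And>i s. i < k \<Longrightarrow> I i s \<Longrightarrow>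
      legal M s b \<and> eval s b \<noteq> 0 \<and> wp M c s (\<lambda>t s'. t \<le> B \<and> I (Suc i) s')"
    and stop: "\<And>s. I k s \<Longrightarrow> legal M s b \<and> eval s b = 0"
    and init: "I 0 s"
  shows "wp M (While b c) s (\<lambda>t s'. t \<le> k * (B + 1 + cost b) + (1 + cost b) \<and> I k s')"
proof -
  have "wp M (While b c) s
      (\<lambda>t s'. t \<le> j * (B + 1 + cost b) + (1 + cost b) \<and> I k s')"
    if "I (k - j) s" "j \<le> k" for j s
    using that
  proof (induction j arbitrary: s)
    case 0
    then have "legal M s b \<and> eval s b = 0" "I k s" using stop by auto
    then show ?case unfolding wp_def by (auto intro!: exI[of _ s] exec_While_false)
  next
    case (Suc j)
    then have *: "k - Suc j < k" "Suc (k - Suc j) = k - j" by auto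
    from step[OF *(1) Suc.prems(1)] obtain t s' where s': "legal M s b" "eval s b \<noteq> 0"
      "exec M c s t s'" "t \<le> B" "I (k - j) s'" unfolding wp_def * by auto
    from Suc.IH[OF s'(5)] Suc.prems obtain u s'' where "exec M (While b c) s' u s''"
      "u \<le> j * (B + 1 + cost b) + (1 + cost b)" "I k s''" unfolding wp_def by auto
    with exec_While_true[OF s'(1-3)] s'(4) show ?case
      unfolding wp_def by (intro exI[of _ s''] exI conjI) auto
  qed
  from this[of k] init show ?thesis by simp
qed

section \<open>The program\<close>

text \<open>
  Everything that belongs to the list of the current vertex lives at even addresses and everything
  that belongs to the list under construction at odd ones, so that no address depends on the
  maximal length of the lists. Entry \<open>a\<close> of a list has its window in word \<open>2 * a\<close> or \<open>2 * a + 1\<close>, and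
  the coefficient of \<open>z ^ k\<close> is cell \<open>2 * (a * Q + k)\<close> or \<open>2 * (a * Q + k) + 1\<close>, where \<open>Q\<close> is the
  number of coefficients. The container maps the windows of the list under construction to their
  positions in it.
\<close>

abbreviation add_expr (infixl "\<^bold>+" 65) where "a \<^bold>+ b \<equiv> Bin OpAdd a b"
abbreviation sub_expr (infixl "\<^bold>-" 65) where "a \<^bold>- b \<equiv> Bin OpSub a b"
abbreviation mul_expr (infixl "\<^bold>*" 70) where "a \<^bold>* b \<equiv> Bin OpMul a b"
abbreviation div_expr (infixl "\<^bold>'/" 70) where "a \<^bold>/ b \<equiv> Bin OpDiv a b"
abbreviation mod_expr (infixl "\<^bold>%" 70) where "a \<^bold>% b \<equiv> Bin OpMod a b"
abbreviation less_expr (infix "\<^bold><" 50) where "a \<^bold>< b \<equiv> Bin OpLess a b"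
abbreviation eq_expr (infix "\<^bold>=" 50) where "a \<^bold>= b \<equiv> Bin OpEq a b"
abbreviation seq_com (infixr ";;" 45) where "c ;; d \<equiv> Seq c d"
abbreviation assign_com (infix "::=" 48) where "r ::= e \<equiv> Assign r e"

text \<open>
  The input is \<open>m\<close> in \<open>rM\<close> and \<open>n\<close> in the register 1. The further registers contain
  the number of vertices (\<open>rN\<close>) and of coefficients (\<open>rQ\<close>), the weight \<open>3 ^ m\<close> of the highest digit
  (\<open>rP\<close>), the vertex to be decided on (\<open>rT\<close>) with the weights of its earlier neighbours (\<open>rW1\<close> to
  \<open>rW4\<close>), the lengths of the current and of the new list (\<open>rOld\<close>, \<open>rNew\<close>), a position in the
  current list (\<open>rJ\<close>), a window (\<open>rX\<close>), the new digit and then the new window (\<open>rY\<close>), the exponent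
  by which the polynomial is shifted (\<open>rZ\<close>), the places where the target and the source of an
  addition begin (\<open>rA\<close>, \<open>rB\<close>) and a counter (\<open>rC\<close>).
\<close>

abbreviation (input) "rM \<equiv> 0 :: nat"
abbreviation (input) "rN \<equiv> 2 :: nat"
abbreviation (input) "rP \<equiv> 3 :: nat"
abbreviation (input) "rT \<equiv> 4 :: nat"
abbreviation (input) "rOld \<equiv> 5 :: nat"
abbreviation (input) "rNew \<equiv> 6 :: nat"
abbreviation (input) "rJ \<equiv> 7 :: nat"
abbreviation (input) "rW1 \<equiv> 8 :: nat"
abbreviation (input) "rW2 \<equiv> 9 :: nat"
abbreviation (input) "rW3 \<equiv> 10 :: nat"
abbreviation (input) "rW4 \<equiv> 11 :: nat"
abbreviation (input) "rX \<equiv> 12 :: nat"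
abbreviation (input) "rY \<equiv> 13 :: nat"
abbreviation (input) "rA \<equiv> 14 :: nat"
abbreviation (input) "rC \<equiv> 15 :: nat"
abbreviation (input) "rZ \<equiv> 16 :: nat"
abbreviation (input) "rB \<equiv> 17 :: nat"
abbreviation (input) "rQ \<equiv> 18 :: nat"

definition find_slot :: com where
  "find_slot =
     (Lookup rA (Reg rY) ;;
      If (Reg rA) Skip
        (Insert (Reg rY) (Reg rNew) ;;
         Store (Const 2 \<^bold>* Reg rNew \<^bold>+ Const 1) (Reg rY) ;;
         rNew ::= Reg rNew \<^bold>+ Const 1 ;;
         rA ::= Reg rNew))"

definition add_loop :: com where
  "add_loop =
     While (Reg rC \<^bold>+ Reg rZ \<^bold>< Reg rQ)
       (CoefAdd (Const 2 \<^bold>* (Reg rA \<^bold>+ Reg rC) \<^bold>+ Const 1)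
                (Const 2 \<^bold>* (Reg rA \<^bold>+ Reg rC) \<^bold>+ Const 1)
                (Const 2 \<^bold>* (Reg rB \<^bold>+ Reg rC)) ;;
        rC ::= Reg rC \<^bold>+ Const 1)"

text \<open>
  Multiplication of a polynomial by \<open>z\<close>, for a selected vertex, amounts to adding its
  coefficients to the target with an offset of 1. The register \<open>rA\<close> contains the successor of the
  position of the target, as it is left by a lookup.
\<close>

definition add_poly :: com where
  "add_poly =
     (rA ::= (Reg rA \<^bold>- Const 1) \<^bold>* Reg rQ \<^bold>+ Reg rZ ;;
      rB ::= Reg rJ \<^bold>* Reg rQ ;;
      rC ::= Const 0 ;;
      add_loop)"

definition accumulate :: com where
  "accumulate = (find_slot ;; add_poly)"

definition emit :: com where
  "emit =
     If (Reg rX \<^bold>/ Reg rP \<^bold>= Const 1) Skip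
       (rY ::= Const 3 \<^bold>* (Reg rX \<^bold>% Reg rP) \<^bold>+ Reg rY ;;
        accumulate)"

abbreviation trit_expr :: "nat \<Rightarrow> expr" where
  "trit_expr w \<equiv> Reg rX \<^bold>/ Reg w \<^bold>% Const 3"

definition clear_expr :: "nat \<Rightarrow> expr" where
  "clear_expr w = Reg rX \<^bold>- Reg w \<^bold>* (trit_expr w \<^bold>= Const 1)"

text \<open>
  Truncated subtraction turns the number of selected neighbours into a truth value; the first
  factor gives 0 to absent vertices.
\<close>

definition digit_expr :: expr where
  "digit_expr = (Reg rT \<^bold>< Reg rN) \<^bold>*
     (Const 1 \<^bold>- ((trit_expr rW1 \<^bold>= Const 2) \<^bold>+ (trit_expr rW2 \<^bold>= Const 2) \<^bold>+
        (trit_expr rW3 \<^bold>= Const 2) \<^bold>+ (trit_expr rW4 \<^bold>= Const 2)))"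

definition load_code :: com where
  "load_code =
     (rX ::= Word (Const 2 \<^bold>* Reg rJ) ;;
      rY ::= digit_expr ;;
      rZ ::= Const 0)"

definition select :: com where
  "select =
     (rX ::= clear_expr rW1 ;; rX ::= clear_expr rW2 ;; rX ::= clear_expr rW3 ;; rX ::= clear_expr rW4 ;;
      rY ::= Const 2 ;;
      rZ ::= Const 1)"

text \<open>
  The first \<open>emit\<close> handles the choices that leave out the vertex \<open>t\<close>, the second one those that
  select it.
\<close>

definition process :: com where
  "process =
     (load_code ;;
      emit ;;
      If (Reg rT \<^bold>< Reg rN) (select ;; emit) Skip ;;
      rJ ::= Reg rJ \<^bold>+ Const 1)"

definition process_all :: com where
  "process_all =
     (rNew ::= Const 0 ;; rJ ::= Const 0 ;; While (Reg rJ \<^bold>< Reg rOld) process)"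

definition move_words :: com where
  "move_words =
      While (Reg rJ \<^bold>< Reg rNew)
        (rX ::= Word (Const 2 \<^bold>* Reg rJ \<^bold>+ Const 1) ;;
         Store (Const 2 \<^bold>* Reg rJ) (Reg rX) ;;
         Delete (Reg rX) ;;
         rJ ::= Reg rJ \<^bold>+ Const 1)"

definition move_coefs :: com where
  "move_coefs =
      While (Reg rC \<^bold>< Reg rB)
        (CoefCopy (Const 2 \<^bold>* Reg rC) (Const 2 \<^bold>* Reg rC \<^bold>+ Const 1) ;;
         CoefZero (Const 2 \<^bold>* Reg rC \<^bold>+ Const 1) ;;
         rC ::= Reg rC \<^bold>+ Const 1)"

text \<open>
  The new list becomes the current one, and its old storage is reset to the state in which the
  next round expects it: an empty container and vanishing coefficients at odd addresses.
\<close>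

definition transfer :: com where
  "transfer =
     (rJ ::= Const 0 ;;
      move_words ;;
      rB ::= Reg rNew \<^bold>* Reg rQ ;;
      rC ::= Const 0 ;;
      move_coefs ;;
      rOld ::= Reg rNew)"

text \<open>
  The predecessor within the same column and the vertex before in the same row are neighbours in
  all three families; the parameters \<open>ea\<close> and \<open>eb\<close> are left for the others.
\<close>

definition load_weights :: "expr \<Rightarrow> expr \<Rightarrow> com" where
  "load_weights ea eb =
     (rW1 ::= Const 0 \<^bold>< Reg rT \<^bold>% Reg rM ;;
      rW2 ::= Reg rP \<^bold>/ Const 3 ;;
      rW3 ::= ea ;;
      rW4 ::= eb)"

definition sweep_round :: "com \<Rightarrow> com" where
  "sweep_round W = (W ;; process_all ;; transfer ;; rT ::= Reg rT \<^bold>+ Const 1)"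

definition power_loop :: com where
  "power_loop =
     While (Reg rC \<^bold>< Reg rM) (rP ::= Reg rP \<^bold>* Const 3 ;; rC ::= Reg rC \<^bold>+ Const 1)"

definition prepare :: com where
  "prepare =
     (rN ::= Reg rM \<^bold>* Reg 1 ;;
      rQ ::= Reg rN \<^bold>+ Const 1 ;;
      rP ::= Const 1 ;;
      power_loop ;;
      CoefOne (Const 0) ;;
      rOld ::= Const 1)"

text \<open>
  Copying upwards never overwrites a cell that is still to be read, because \<open>j \<le> 2 * j\<close>.
\<close>

definition write_out :: com where
  "write_out =
     (rC ::= Const 0 ;;
      While (Reg rC \<^bold>< Reg rQ)
        (CoefCopy (Reg rC) (Const 2 \<^bold>* Reg rC) ;; rC ::= Reg rC \<^bold>+ Const 1))"

definition program :: "com \<Rightarrow> com" where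
  "program W =
     (prepare ;;
      While (Reg rT \<^bold>< Reg rN \<^bold>+ Reg rM \<^bold>+ Const 1) (sweep_round W) ;;
      write_out)"

section \<open>Correctness and running time of the program\<close>

lemma cost_clear_expr [simp]: "cost (clear_expr w) = 11"
  by (simp add: clear_expr_def)

lemma eval_clear_expr [simp]: "eval s (clear_expr w) = clear1 (reg s w) (reg s rX)"
  by (simp add: clear_expr_def clear1_def trit_def)

lemma cost_digit_expr [simp]: "cost digit_expr = 37"
  by (simp add: digit_expr_def)

definition old_same :: "state \<Rightarrow> state \<Rightarrow> bool" where
  "old_same s s' \<longleftrightarrow> (\<forall>a. words s' (2 * a) = words s (2 * a) \<and> coefs s' (2 * a) = coefs s (2 * a))"

lemma old_same_refl: "old_same s s"
  by (simp add: old_same_def)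

lemma old_same_trans: "old_same s s' \<Longrightarrow> old_same s' s'' \<Longrightarrow> old_same s s''"
  by (simp add: old_same_def)

lemma old_same_coefs: "old_same s s' \<Longrightarrow> coefs s' (2 * a) = coefs s (2 * a)"
  by (simp add: old_same_def)

text \<open>
  \<open>K\<close> bounds the length of the lists. The assumption \<open>room\<close> bounds all windows, counters and
  addresses with all intermediate results at once.
\<close>

locale sweep = frontier m N ws for m N ws +
  fixes M :: machine and K Q :: nat
  assumes Q: "Q = N + 1"
    and caps: "2 * K \<le> word_cap M" "2 * (K * Q) \<le> coef_cap M" "K \<le> entry_cap M"
    and room: "9 * 3 ^ m + 2 * (K * Q) + 2 * K + 2 * N + 2 * m + 12 < word_bound M"
begin

definition lookup_cost :: nat where
  "lookup_cost = 1 + floor_log (1 + K)"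

definition old_rep :: "state \<Rightarrow> nat list \<Rightarrow> (nat \<Rightarrow> nat \<Rightarrow> nat) \<Rightarrow> bool" where
  "old_rep s xs f \<longleftrightarrow>
     (\<forall>j<length xs. words s (2 * j) = xs ! j \<and>
        (\<forall>k\<le>N. coefs s (2 * (j * Q + k)) = int (f (xs ! j) k) mod modulus M))"

text \<open>
  The third conjunct lets the next entry start as the zero polynomial without any initialization;
  the last one expresses that windows not in the list have been contributed nothing.
\<close>

definition new_rep :: "state \<Rightarrow> nat list \<Rightarrow> (nat \<Rightarrow> nat \<Rightarrow> nat) \<Rightarrow> bool" where
  "new_rep s ys g \<longleftrightarrow>
     (\<forall>y a. container s y = Some a \<longleftrightarrow> a < length ys \<and> ys ! a = y) \<and>
     (\<forall>a<length ys. words s (2 * a + 1) = ys ! a \<and>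
        (\<forall>k\<le>N. coefs s (2 * (a * Q + k) + 1) = int (g (ys ! a) k) mod modulus M)) \<and>
     (\<forall>a\<ge>length ys * Q. coefs s (2 * a + 1) = 0) \<and>
     (\<forall>y k. y \<notin> set ys \<longrightarrow> g y k = 0)"

lemma slot_bound: "a < K \<Longrightarrow> a * Q + Q \<le> K * Q"
  using mult_le_mono1[of "Suc a" K Q] by simp

lemma container_cost_le:
  assumes "card (dom (container s)) \<le> K"
  shows "container_cost s \<le> lookup_cost"
  unfolding container_cost_def lookup_cost_def using assms floor_log_mono by (auto simp: mono_def)

lemma new_rep_dom: "new_rep s ys g \<Longrightarrow> dom (container s) = set ys"
  unfolding new_rep_def dom_def in_set_conv_nth set_eq_iff by auto

lemma new_rep_distinct: "new_rep s ys g \<Longrightarrow> distinct ys"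
  unfolding new_rep_def distinct_conv_nth by (metis option.inject)

lemma new_rep_cost:
  assumes "new_rep s ys g" "card (set ys) \<le> K"
  shows "container_cost s \<le> lookup_cost"
  using container_cost_le assms new_rep_dom by simp

text \<open>
  The set \<open>R\<close>, in the applications the set of windows reachable at the next vertex, keeps the list
  from growing beyond \<open>K\<close>.
\<close>

lemma find_slot_correct:
  assumes rep: "new_rep s ys g" and R: "finite R" "card R \<le> K" "set ys \<subseteq> R" "y \<in> R"
    and y: "y < 3 * 3 ^ m"
    and regs: "reg s rNew = length ys" "reg s rY = y"
  shows "wp M find_slot s (\<lambda>t s'. t \<le> 2 * lookup_cost + 30 \<and>
     (\<exists>ys' a. new_rep s' ys' g \<and> set ys' = insert y (set ys) \<and> a < length ys' \<and> ys' ! a = y \<and>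
        reg s' rNew = length ys' \<and> reg s' rA = Suc a) \<and>
     (\<forall>r. r \<notin> {rNew, rA} \<longrightarrow> reg s' r = reg s r) \<and> old_same s s')"
proof -
  have len: "length ys \<le> K"
    using card_mono[OF R(1,3)] R(2) distinct_card[OF new_rep_distinct[OF rep]] by simp
  have cost: "container_cost s \<le> lookup_cost"
    using new_rep_cost[OF rep] card_mono[OF R(1,3)] R(2) by simp
  have cont: "container s y = Some a \<longleftrightarrow> a < length ys \<and> ys ! a = y" for y a
    using rep by (auto simp: new_rep_def)
  show ?thesis
  proof (cases "y \<in> set ys")
    case True
    then obtain a where a: "a < length ys" "ys ! a = y" by (auto simp: in_set_conv_nth)
    then have c: "container s y = Some a" by (simp add: cont)
    have "new_rep (s\<lparr>reg := (reg s)(rA := Suc a)\<rparr>) ys g" using rep by (simp add: new_rep_def)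
    then show ?thesis using a c len room y cost True regs
      unfolding find_slot_def by (auto simp: old_same_def intro!: exI[of _ ys])
  next
    case False
    then have c: "container s y = None" using cont by (metis in_set_conv_nth not_Some_eq)
    have "Suc (card (set ys)) \<le> K"
      using False card_mono[OF R(1), of "insert y (set ys)"] R by simp
    then have len': "length ys < K" using distinct_card[OF new_rep_distinct[OF rep]] by simp
    define s' where "s' = s\<lparr>container := (container s)(y \<mapsto> length ys),
      words := (words s)(Suc (2 * length ys) := y),
      reg := (reg s)(rA := Suc (length ys), rNew := Suc (length ys))\<rparr>"
    have "new_rep s' (ys @ [y]) g"
      unfolding new_rep_def
    proof (intro conjI allI impI)
      show "container s' z = Some a \<longleftrightarrow> a < length (ys @ [y]) \<and> (ys @ [y]) ! a = z" for z a
        using cont[of z a] False by (auto simp: s'_def nth_append less_Suc_eq in_set_conv_nth)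
    next
      fix a assume a: "a < length (ys @ [y])"
      show "words s' (2 * a + 1) = (ys @ [y]) ! a"
        using a rep by (auto simp: s'_def new_rep_def nth_append less_Suc_eq)
      fix k assume k: "k \<le> N"
      show "coefs s' (2 * (a * Q + k) + 1) = int (g ((ys @ [y]) ! a) k) mod modulus M"
      proof (cases "a = length ys")
        case True
        have "\<forall>a\<ge>length ys * Q. coefs s (2 * a + 1) = 0" using rep by (simp add: new_rep_def)
        from this[rule_format, of "a * Q + k"] have "coefs s (2 * (a * Q + k) + 1) = 0"
          using True by simp
        moreover have "g y k = 0" using rep False by (auto simp: new_rep_def)
        moreover note True
        ultimately have "coefs s (2 * (a * Q + k) + 1) = 0" "g y k = 0" by auto
        then show ?thesis using True by (simp add: s'_def)
      next
        case False
        then show ?thesis using a k rep by (auto simp: s'_def new_rep_def nth_append less_Suc_eq)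
      qed
    next
      show "coefs s' (2 * a + 1) = 0" if "length (ys @ [y]) * Q \<le> a" for a
        using that rep by (auto simp: s'_def new_rep_def)
      show "z \<notin> set (ys @ [y]) \<Longrightarrow> g z k = 0" for z k
        using rep by (auto simp: new_rep_def)
    qed
    moreover have "card (insert y (dom (container s))) \<le> K"
      using \<open>Suc (card (set ys)) \<le> K\<close> False new_rep_dom[OF rep] by simp
    moreover have "old_same s s'"
      using double_not_eq_Suc_double by (auto simp: old_same_def s'_def)
    moreover have "container_cost (s\<lparr>reg := f\<rparr>) = container_cost s" for f
      by (simp add: container_cost_def)
    ultimately show ?thesis using c len' room y cost regs caps
      unfolding find_slot_def
      by (auto simp: s'_def fun_upd_twist intro!: exI[of _ "ys @ [y]"] exI[of _ "length ys"])
  qed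
qed

text \<open>
  Distinct entries occupy disjoint intervals of length \<open>Q\<close>, so that only the entry \<open>a\<close> changes.
  Coefficients beyond \<open>N\<close> are cut off by the loop bound; they cannot influence lower ones.
\<close>

lemma add_poly_correct:
  assumes rep: "new_rep s ys g" and a: "a < length ys" "length ys \<le> K" and j: "j < K"
    and z: "z \<le> N"
    and regs: "reg s rA = Suc a" "reg s rQ = Q" "reg s rZ = z" "reg s rJ = j"
    and old: "\<And>k. k \<le> N \<Longrightarrow> coefs s (2 * (j * Q + k)) = int (f k) mod modulus M"
  shows "wp M add_poly s (\<lambda>t s'. t \<le> 31 * Q + 40 \<and>
     new_rep s' ys (\<lambda>y k. g y k + (if y = ys ! a \<and> z \<le> k then f (k - z) else 0)) \<and>
     (\<forall>r. r \<notin> {rA, rB, rC} \<longrightarrow> reg s' r = reg s r) \<and> old_same s s')"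
proof -
  let ?A = "a * Q + z" let ?B = "j * Q" let ?p = "modulus M"
  \<comment> \<open>the exact state after \<open>i\<close> iterations\<close>
  define st where "st i = s\<lparr>reg := (reg s)(rA := ?A, rB := ?B, rC := i),
    coefs := (\<lambda>c. if odd c \<and> ?A \<le> c div 2 \<and> c div 2 < ?A + i
      then (coefs s c + coefs s (2 * (?B + (c div 2 - ?A)))) mod ?p else coefs s c)\<rparr>" for i
  have bounds: "a * Q + Q \<le> K * Q" "j * Q + Q \<le> K * Q" using slot_bound a j by auto
  have Qz: "z < Q" "Q \<le> N + 1" using z Q by auto
  let ?b = "Reg rC \<^bold>+ Reg rZ \<^bold>< Reg rQ"
  let ?c = "(CoefAdd (Const 2 \<^bold>* (Reg rA \<^bold>+ Reg rC) \<^bold>+ Const 1)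
                 (Const 2 \<^bold>* (Reg rA \<^bold>+ Reg rC) \<^bold>+ Const 1)
                 (Const 2 \<^bold>* (Reg rB \<^bold>+ Reg rC)) ;;
         rC ::= Reg rC \<^bold>+ Const 1)"
  have loop: "wp M add_loop (st 0)
     (\<lambda>t s'. t \<le> (Q - z) * (25 + 1 + cost ?b) + (1 + cost ?b) \<and> s' = st (Q - z))"
    unfolding add_loop_def
  proof (rule wp_while)
    fix i s' assume i: "i < Q - z" and s': "s' = st i"
    have upd: "(st i)\<lparr>coefs := (coefs (st i))(Suc (2 * (?A + i)) :=
         (coefs (st i) (Suc (2 * (?A + i))) + coefs (st i) (2 * (?B + i))) mod ?p),
       reg := (reg (st i))(rC := Suc i)\<rparr> = st (Suc i)"
    proof -
      have "((coefs (st i))(Suc (2 * (?A + i)) :=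
          (coefs (st i) (Suc (2 * (?A + i))) + coefs (st i) (2 * (?B + i))) mod ?p)) c =
          coefs (st (Suc i)) c" for c
      proof (cases "c = Suc (2 * (?A + i))")
        case False
        then have "\<not> (odd c \<and> c div 2 = ?A + i)" by (metis odd_two_times_div_two_succ Suc_eq_plus1)
        then have "odd c \<and> ?A \<le> c div 2 \<and> c div 2 < ?A + Suc i \<longleftrightarrow>
            odd c \<and> ?A \<le> c div 2 \<and> c div 2 < ?A + i" by auto
        then show ?thesis using False by (simp add: st_def)
      qed (simp add: st_def)
      then have c: "(coefs (st i))(Suc (2 * (?A + i)) :=
          (coefs (st i) (Suc (2 * (?A + i))) + coefs (st i) (2 * (?B + i))) mod ?p) =
          coefs (st (Suc i))" by blast
      have r: "(reg (st i))(rC := Suc i) = reg (st (Suc i))" by (simp add: st_def)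
      have "(st i)\<lparr>coefs := h, reg := f\<rparr> = (st (Suc i))\<lparr>coefs := h, reg := f\<rparr>" for f h
        by (simp add: st_def)
      then show ?thesis unfolding c r by simp
    qed
    show "legal M s' ?b \<and> eval s' ?b \<noteq> 0 \<and> wp M ?c s' (\<lambda>t s'. t \<le> 25 \<and> s' = st (Suc i))"
      using i less_diff_conv[THEN iffD1, OF i] regs bounds room Qz caps upd unfolding s'
      by (simp add: coef_address_def) (simp add: st_def)
  next
    fix s' assume "s' = st (Q - z)"
    then show "legal M s' ?b \<and> eval s' ?b = 0"
      using regs room Qz z by (simp add: st_def)
  qed simp
  have st0: "s\<lparr>reg := (reg s)(rA := ?A, rB := ?B, rC := 0)\<rparr> = st 0"
    by (rule state.equality) (auto simp: st_def)
  have rep': "new_rep (st (Q - z)) ys (\<lambda>y k. g y k + (if y = ys ! a \<and> z \<le> k then f (k - z) else 0))"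
    unfolding new_rep_def
  proof (intro conjI allI impI)
    show "container (st (Q - z)) y = Some b \<longleftrightarrow> b < length ys \<and> ys ! b = y" for y b
      using rep by (auto simp: new_rep_def st_def)
  next
    fix b assume b: "b < length ys"
    show "words (st (Q - z)) (2 * b + 1) = ys ! b"
      using b rep by (auto simp: new_rep_def st_def)
    fix k assume k: "k \<le> N"
    have old_val: "coefs s (2 * (b * Q + k) + 1) = int (g (ys ! b) k) mod ?p"
      using rep b k by (auto simp: new_rep_def)
    have eq: "ys ! b = ys ! a \<longleftrightarrow> b = a"
      using new_rep_distinct[OF rep] b a by (simp add: nth_eq_iff_index_eq)
    show "coefs (st (Q - z)) (2 * (b * Q + k) + 1) =
        int (g (ys ! b) k + (if ys ! b = ys ! a \<and> z \<le> k then f (k - z) else 0)) mod ?p"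
    proof (cases "b = a")
      case False
      have "\<not> (?A \<le> b * Q + k \<and> b * Q + k < ?A + (Q - z))"
      proof (cases "b < a")
        case True
        then have "b * Q + Q \<le> a * Q" using mult_le_mono1[of "Suc b" a Q] by simp
        then show ?thesis using k Q by simp
      next
        case False
        then have "a * Q + Q \<le> b * Q" using \<open>b \<noteq> a\<close> mult_le_mono1[of "Suc a" b Q] by simp
        then show ?thesis using Qz by simp
      qed
      then show ?thesis using False eq old_val by (auto simp: st_def)
    next
      case True
      have shifted: "coefs s (2 * (?B + (k - z))) = int (f (k - z)) mod ?p"
        by (rule old) (use k in simp)
      have "a * Q + k - ?A = k - z" "a * Q + k < ?A + (Q - z)" using k Q z by simp_all
      then have new: "coefs (st (Q - z)) (2 * (a * Q + k) + 1) = (if z \<le> k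
          then (coefs s (2 * (a * Q + k) + 1) + coefs s (2 * (?B + (k - z)))) mod ?p
          else coefs s (2 * (a * Q + k) + 1))"
        by (simp add: st_def)
      show ?thesis unfolding True new shifted old_val[unfolded True] by (simp add: mod_simps)
    qed
  next
    show "coefs (st (Q - z)) (2 * b + 1) = 0" if "length ys * Q \<le> b" for b
    proof -
      have "a * Q + Q \<le> length ys * Q" using mult_le_mono1[of "Suc a" "length ys" Q] a by simp
      then show ?thesis using that rep Qz by (auto simp: st_def new_rep_def)
    qed
    show "g y k + (if y = ys ! a \<and> z \<le> k then f (k - z) else 0) = 0" if "y \<notin> set ys" for y k
      using that rep a by (auto simp: new_rep_def)
  qed
  have same: "old_same s (st (Q - z))" by (auto simp: old_same_def st_def)
  have frame: "\<forall>r. r \<notin> {rA, rB, rC} \<longrightarrow> reg (st (Q - z)) r = reg s r" by (auto simp: st_def)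
  have "(Q - z) * (25 + 1 + cost ?b) \<le> Q * 31"
    by (rule mult_le_mono) auto
  then have post: "wp M add_loop (st 0) (\<lambda>t s'. t \<le> 31 * Q + 10 \<and>
     new_rep s' ys (\<lambda>y k. g y k + (if y = ys ! a \<and> z \<le> k then f (k - z) else 0)) \<and>
     (\<forall>r. r \<notin> {rA, rB, rC} \<longrightarrow> reg s' r = reg s r) \<and> old_same s s')"
    using rep' same frame by (intro wp_mono[OF loop]) auto
  have "a < K" using a by simp
  then show ?thesis unfolding add_poly_def
    using regs room bounds Qz st0 j by (auto intro!: wp_mono[OF post])
qed

lemma emit_correct:
  assumes rep: "new_rep s ys g" and R: "finite R" "card R \<le> K" "set ys \<subseteq> R"
    and inR: "\<And>y. push x d = Some y \<Longrightarrow> y \<in> R"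
    and x: "x < 3 ^ Suc m" and d: "d < 3" and z: "z \<le> N" and j: "j < K"
    and regs: "reg s rX = x" "reg s rY = d" "reg s rZ = z" "reg s rJ = j" "reg s rQ = Q"
      "reg s rP = 3 ^ m" "reg s rNew = length ys"
    and old: "\<And>k. k \<le> N \<Longrightarrow> coefs s (2 * (j * Q + k)) = int (f k) mod modulus M"
  shows "wp M emit s (\<lambda>t s'. t \<le> 2 * lookup_cost + 31 * Q + 90 \<and>
     (\<exists>ys'. new_rep s' ys' (\<lambda>y k. g y k + (if push x d = Some y \<and> z \<le> k then f (k - z) else 0)) \<and>
        set ys' = set ys \<union> set_option (push x d) \<and> reg s' rNew = length ys') \<and>
     (\<forall>r. r \<notin> {rNew, rY, rA, rB, rC} \<longrightarrow> reg s' r = reg s r) \<and> old_same s s')"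
proof (cases "push x d")
  case None
  then have "x div 3 ^ m = 1" by (auto simp: push_def split: if_splits)
  then show ?thesis using None rep x regs room
    unfolding emit_def by (auto simp: old_same_refl intro!: exI[of _ ys])
next
  case (Some y)
  then have y: "x div 3 ^ m \<noteq> 1" "y = 3 * (x mod 3 ^ m) + d"
    by (auto simp: push_def split: if_splits)
  have y_less: "y < 3 * 3 ^ m" using trit_push(3)[OF Some d] by simp
  have xm: "x div 3 ^ m \<le> x" "x mod 3 ^ m < 3 ^ m" by (simp_all add: div_le_dividend)
  define s1 where "s1 = s\<lparr>reg := (reg s)(rY := y)\<rparr>"
  have rep1: "new_rep s1 ys g" using rep by (simp add: s1_def new_rep_def)
  have "wp M accumulate s1 (\<lambda>t s'. t \<le> 2 * lookup_cost + 31 * Q + 70 \<and>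
     (\<exists>ys'. new_rep s' ys' (\<lambda>y k. g y k + (if push x d = Some y \<and> z \<le> k then f (k - z) else 0)) \<and>
        set ys' = set ys \<union> set_option (push x d) \<and> reg s' rNew = length ys') \<and>
     (\<forall>r. r \<notin> {rNew, rA, rB, rC} \<longrightarrow> reg s' r = reg s1 r) \<and> old_same s1 s')"
    unfolding accumulate_def wp_Seq
  proof (rule wp_mono[OF find_slot_correct[OF rep1 R inR[OF Some] y_less]])
    show "reg s1 rNew = length ys" "reg s1 rY = y" using regs by (simp_all add: s1_def)
  next
    fix t1 s2
    assume "t1 \<le> 2 * lookup_cost + 30 \<and>
     (\<exists>ys' a. new_rep s2 ys' g \<and> set ys' = insert y (set ys) \<and> a < length ys' \<and> ys' ! a = y \<and>
        reg s2 rNew = length ys' \<and> reg s2 rA = Suc a) \<and>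
     (\<forall>r. r \<notin> {rNew, rA} \<longrightarrow> reg s2 r = reg s1 r) \<and> old_same s1 s2"
    then obtain ys' a where t1: "t1 \<le> 2 * lookup_cost + 30" and s2: "new_rep s2 ys' g"
      "set ys' = insert y (set ys)" "a < length ys'" "ys' ! a = y" "reg s2 rNew = length ys'"
      "reg s2 rA = Suc a" and frame: "\<forall>r. r \<notin> {rNew, rA} \<longrightarrow> reg s2 r = reg s1 r"
      and same: "old_same s1 s2" by auto
    have "card (set ys') \<le> card R"
      by (rule card_mono[OF R(1)]) (use R inR[OF Some] s2 in auto)
    then have len: "length ys' \<le> K" using R distinct_card[OF new_rep_distinct[OF s2(1)]] by simp
    have regs2: "reg s2 rQ = Q" "reg s2 rZ = z" "reg s2 rJ = j"
      using frame regs by (simp_all add: s1_def)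
    have old2: "coefs s2 (2 * (j * Q + k)) = int (f k) mod modulus M" if "k \<le> N" for k
      using old[OF that] unfolding old_same_coefs[OF same] by (simp add: s1_def)
    have eq: "(y' = y) = (push x d = Some y')" for y'
      unfolding Some option.inject by (rule eq_commute)
    show "wp M add_poly s2 (\<lambda>u s'. t1 + u \<le> 2 * lookup_cost + 31 * Q + 70 \<and>
     (\<exists>ys'. new_rep s' ys' (\<lambda>y k. g y k + (if push x d = Some y \<and> z \<le> k then f (k - z) else 0)) \<and>
        set ys' = set ys \<union> set_option (push x d) \<and> reg s' rNew = length ys') \<and>
     (\<forall>r. r \<notin> {rNew, rA, rB, rC} \<longrightarrow> reg s' r = reg s1 r) \<and> old_same s1 s')"
    proof (rule wp_mono[OF add_poly_correct[OF s2(1,3) len j z s2(6) regs2 old2]])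
      fix u s'
      assume *: "u \<le> 31 * Q + 40 \<and>
        new_rep s' ys' (\<lambda>y k. g y k + (if y = ys' ! a \<and> z \<le> k then f (k - z) else 0)) \<and>
        (\<forall>r. r \<notin> {rA, rB, rC} \<longrightarrow> reg s' r = reg s2 r) \<and> old_same s2 s'"
      have rep': "new_rep s' ys' (\<lambda>y k. g y k + (if push x d = Some y \<and> z \<le> k then f (k - z) else 0))"
        using * unfolding s2(4) eq by blast
      have frame': "\<forall>r. r \<notin> {rNew, rA, rB, rC} \<longrightarrow> reg s' r = reg s1 r" using * frame by simp
      have set': "set ys' = set ys \<union> set_option (push x d)" using s2(2) Some by auto
      have new': "reg s' rNew = length ys'" using * s2(5) by simp
      have time: "t1 + u \<le> 2 * lookup_cost + 31 * Q + 70" using t1 * by simp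
      have same': "old_same s1 s'" using old_same_trans[OF same] * by blast
      show "t1 + u \<le> 2 * lookup_cost + 31 * Q + 70 \<and>
       (\<exists>ys'. new_rep s' ys' (\<lambda>y k. g y k + (if push x d = Some y \<and> z \<le> k then f (k - z) else 0)) \<and>
          set ys' = set ys \<union> set_option (push x d) \<and> reg s' rNew = length ys') \<and>
       (\<forall>r. r \<notin> {rNew, rA, rB, rC} \<longrightarrow> reg s' r = reg s1 r) \<and> old_same s1 s'"
        by (intro conjI exI[of _ ys'] time rep' set' new' frame' same')
    qed
  qed
  note rest = this
  have div: "x div 3 ^ m < word_bound M" "x < word_bound M"
    using le_less_trans[OF xm(1)] x room by simp_all
  have "x mod 3 ^ m < word_bound M" "3 * (x mod 3 ^ m) < word_bound M"
    "3 * (x mod 3 ^ m) + d < word_bound M"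
    using xm(2) d room by linarith+
  note div = div this
  have head: "legal M s (Reg rX \<^bold>/ Reg rP \<^bold>= Const 1)" "eval s (Reg rX \<^bold>/ Reg rP \<^bold>= Const 1) = 0"
    "legal M s (Const 3 \<^bold>* (Reg rX \<^bold>% Reg rP) \<^bold>+ Reg rY)"
    "eval s (Const 3 \<^bold>* (Reg rX \<^bold>% Reg rP) \<^bold>+ Reg rY) = y"
    subgoal using regs room div y_less by simp
    subgoal using regs y(1) by simp
    subgoal unfolding legal.simps eval.simps apply_op.simps regs
      by (intro conjI; use div room d in linarith)
    subgoal using regs unfolding y(2) by simp
    done
  show ?thesis
    unfolding emit_def
    apply (simp only: wp_If wp_Seq head wp_Assign simp_thms if_False)
    apply (fold s1_def)
    apply (rule wp_mono[OF rest])
    subgoal for t s'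
      by (elim conjE, intro conjI, simp, assumption, simp add: s1_def, simp add: old_same_def s1_def)
    done
qed

lemma weights_le: "w \<in> set (ws t) \<Longrightarrow> w \<le> 3 ^ m"
  using weights[of w t] by (auto intro: power_increasing)

lemma legal_clear_expr:
  assumes "reg u rX < 3 ^ Suc m" "reg u w \<le> 3 ^ m"
  shows "legal M u (clear_expr w)"
proof -
  have "reg u rX div reg u w \<le> reg u rX" by (rule div_le_dividend)
  moreover have "reg u rX div reg u w mod 3 < 3" by simp
  ultimately have "reg u rX div reg u w < word_bound M" "reg u rX < word_bound M"
    "reg u w < word_bound M" "3 < word_bound M" "reg u rX div reg u w mod 3 < word_bound M"
    using assms room by (simp_all only: power_Suc)
  then show ?thesis by (auto simp: clear_expr_def)
qed

lemma select_correct: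
  assumes W: "ws t = [w1, w2, w3, w4]"
    and regsW: "reg s rW1 = w1" "reg s rW2 = w2" "reg s rW3 = w3" "reg s rW4 = w4"
    and x: "reg s rX = x" "x < 3 ^ Suc m"
  shows "wp M select s (\<lambda>\<tau> s'. \<tau> \<le> 60 \<and>
    s' = s\<lparr>reg := (reg s)(rX := clear (ws t) x, rY := 2, rZ := 1)\<rparr>)"
proof -
  have w: "w1 \<le> 3 ^ m" "w2 \<le> 3 ^ m" "w3 \<le> 3 ^ m" "w4 \<le> 3 ^ m"
    using weights_le[of _ t] by (simp_all add: W)
  have c: "clear1 w y < 3 ^ Suc m" if "y < 3 ^ Suc m" for w y
    using clear1_le[of w y] that by simp
  have legal: "legal M (s\<lparr>reg := (reg s)(rX := y)\<rparr>) (clear_expr rW2)"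
    "legal M (s\<lparr>reg := (reg s)(rX := y)\<rparr>) (clear_expr rW3)"
    "legal M (s\<lparr>reg := (reg s)(rX := y)\<rparr>) (clear_expr rW4)" if "y < 3 ^ Suc m" for y
    by (rule legal_clear_expr; use that w regsW in simp)+
  have "legal M s (clear_expr rW1)"
    by (rule legal_clear_expr; use x w regsW in simp)
  moreover have "2 < word_bound M" using room by simp
  ultimately show ?thesis using regsW x legal[OF c[OF x(2)]] legal[OF c[OF c[OF x(2)]]]
      legal[OF c[OF c[OF c[OF x(2)]]]]
    unfolding select_def by (simp add: clear_def W)
qed

lemma legal_trit_expr:
  assumes "reg s rX < 3 ^ Suc m" "reg s w \<le> 3 ^ m"
  shows "legal M s (trit_expr w \<^bold>= Const 2)" "eval s (trit_expr w \<^bold>= Const 2) \<le> 1"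
proof -
  have "reg s rX div reg s w \<le> reg s rX" by (rule div_le_dividend)
  moreover have "reg s rX div reg s w mod 3 < 3" by simp
  ultimately have "reg s rX div reg s w < word_bound M" "reg s rX < word_bound M"
    "reg s w < word_bound M" "3 < word_bound M" "reg s rX div reg s w mod 3 < word_bound M"
    using assms room by (simp_all only: power_Suc)
  then show "legal M s (trit_expr w \<^bold>= Const 2)" by auto
  show "eval s (trit_expr w \<^bold>= Const 2) \<le> 1" by simp
qed

lemma legal_digit_expr:
  assumes x: "reg s rX < 3 ^ Suc m"
    and w: "reg s rW1 \<le> 3 ^ m" "reg s rW2 \<le> 3 ^ m" "reg s rW3 \<le> 3 ^ m" "reg s rW4 \<le> 3 ^ m"
    and t: "reg s rT \<le> N + m" "reg s rN = N"
  shows "legal M s digit_expr"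
proof -
  define e where "e = ((trit_expr rW1 \<^bold>= Const 2) \<^bold>+ (trit_expr rW2 \<^bold>= Const 2) \<^bold>+
        (trit_expr rW3 \<^bold>= Const 2) \<^bold>+ (trit_expr rW4 \<^bold>= Const 2))"
  have sum: "legal M s (a \<^bold>+ b) \<and> eval s (a \<^bold>+ b) \<le> i + 1"
    if "legal M s a" "eval s a \<le> i" "legal M s b" "eval s b \<le> 1" "i < 9" for a b i
    using that room by simp
  note w = legal_trit_expr[OF x w(1)] legal_trit_expr[OF x w(2)] legal_trit_expr[OF x w(3)]
    legal_trit_expr[OF x w(4)]
  have "legal M s e"
    unfolding e_def using sum[OF w(1,2,3,4)] sum[OF _ _ w(5,6), of _ 2] sum[OF _ _ w(7,8), of _ 3]
    by (simp del: legal.simps eval.simps)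
  moreover have "1 - eval s e \<le> 1" by simp
  moreover have "legal M s (Reg rT \<^bold>< Reg rN)" using t room by simp
  moreover have "eval s (Reg rT \<^bold>< Reg rN) \<le> 1" by simp
  ultimately show ?thesis
    unfolding digit_expr_def e_def[symmetric] using room
    by (cases "reg s rT < reg s rN") simp_all
qed

lemma eval_digit_expr:
  assumes "ws t = [reg s rW1, reg s rW2, reg s rW3, reg s rW4]" "reg s rT = t" "reg s rN = N"
  shows "eval s digit_expr = (if t < N then new_digit (ws t) (reg s rX) else 0)"
proof -
  have arith: "(if b then 1 else 0) * (1 - ((if p then 1 else 0) + (if q then 1 else 0) +
      (if u then 1 else 0) + (if v then 1 else 0))) =
      (if b then if p \<or> q \<or> u \<or> v then 0 else 1 else (0::nat))" for b p q u v
    by simp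
  show ?thesis using assms(2,3)
    unfolding digit_expr_def eval.simps apply_op.simps arith
    by (simp add: new_digit_def assms(1) trit_def)
qed

lemma load_code_correct:
  assumes W: "ws t = [w1, w2, w3, w4]"
    and regsW: "reg s rW1 = w1" "reg s rW2 = w2" "reg s rW3 = w3" "reg s rW4 = w4"
    and x: "words s (2 * j) = x" "x < 3 ^ Suc m" "j < K"
    and regs: "reg s rT = t" "reg s rJ = j" "reg s rN = N" "t \<le> N + m"
  shows "wp M load_code s (\<lambda>\<tau> s'. \<tau> \<le> 60 \<and> s' = s\<lparr>reg := (reg s)
     (rX := x, rY := (if t < N then new_digit (ws t) x else 0), rZ := 0)\<rparr>)"
proof -
  have w: "w1 \<le> 3 ^ m" "w2 \<le> 3 ^ m" "w3 \<le> 3 ^ m" "w4 \<le> 3 ^ m"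
    using weights_le[of _ t] by (simp_all add: W)
  let ?s = "s\<lparr>reg := (reg s)(rX := x)\<rparr>"
  have "legal M ?s digit_expr"
    by (rule legal_digit_expr) (use w regsW regs x in simp_all)
  moreover have "eval ?s digit_expr = (if t < N then new_digit (ws t) x else 0)"
    using eval_digit_expr[of t ?s] W regsW regs by simp
  moreover have "legal M s (Word (Const 2 \<^bold>* Reg rJ))" "eval s (Word (Const 2 \<^bold>* Reg rJ)) = x"
    using x regs caps room by simp_all
  moreover have "0 < word_bound M" using room by simp
  ultimately show ?thesis
    unfolding load_code_def by (simp del: legal.simps(3) eval.simps(3))
qed

lemma old_rep_cong:
  assumes "old_rep s xs f" "old_same s s'"
  shows "old_rep s' xs f"
  unfolding old_rep_def
proof (intro allI impI conjI)
  fix j assume j: "j < length xs"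
  show "words s' (2 * j) = xs ! j" using assms j by (simp add: old_rep_def old_same_def)
  fix k assume k: "k \<le> N"
  have "coefs s (2 * (j * Q + k)) = int (f (xs ! j) k) mod modulus M"
    using assms(1) j k unfolding old_rep_def by blast
  then show "coefs s' (2 * (j * Q + k)) = int (f (xs ! j) k) mod modulus M"
    unfolding old_same_coefs[OF assms(2)] .
qed

lemma process_correct:
  assumes W: "ws t = [w1, w2, w3, w4]"
    and regsW: "reg s rW1 = w1" "reg s rW2 = w2" "reg s rW3 = w3" "reg s rW4 = w4"
    and rep: "new_rep s ys g" "old_rep s xs (count t)"
    and R: "card (reach (Suc t)) \<le> K" "set ys \<subseteq> reach (Suc t)"
    and xs: "set xs = reach t" "length xs \<le> K" "j < length xs"
    and t: "t \<le> N + m"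
    and regs: "reg s rT = t" "reg s rJ = j" "reg s rQ = Q" "reg s rN = N"
      "reg s rP = 3 ^ m" "reg s rNew = length ys"
  shows "wp M process s (\<lambda>\<tau> s'. \<tau> \<le> 4 * lookup_cost + 62 * Q + 350 \<and>
     (\<exists>ys'. new_rep s' ys' (\<lambda>y k. g y k + contribution t (xs ! j) y k) \<and>
        set ys' = set ys \<union> {y. \<exists>z. step t (xs ! j) z = Some y} \<and> reg s' rNew = length ys') \<and>
     reg s' rJ = Suc j \<and>
     (\<forall>r. r \<notin> {rNew, rJ, rX, rY, rA, rB, rC, rZ} \<longrightarrow> reg s' r = reg s r) \<and> old_same s s')"
    (is "wp M process s ?P")
proof -
  let ?x = "xs ! j"
  have xr: "?x \<in> reach t" using nth_mem[OF xs(3)] xs(1) by simp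
  have x: "?x < 3 ^ Suc m" using reach_less[OF xr] .
  have word: "words s (2 * j) = ?x" using rep(2) xs(3) by (simp add: old_rep_def)
  have j: "j < K" using xs by simp
  have inR: "y \<in> reach (Suc t)" if "step t ?x z = Some y" for y z
    using that xr unfolding reach_Suc by blast
  define d where "d = (if t < N then new_digit (ws t) ?x else 0)"
  have d: "d < 3" by (simp add: d_def new_digit_def)
  have stepF: "step t ?x False = push ?x d" by (simp add: step_def d_def)
  define s1 where "s1 = s\<lparr>reg := (reg s)(rX := ?x, rY := d, rZ := 0)\<rparr>"
  have rep1: "new_rep s1 ys g" using rep(1) by (simp add: s1_def new_rep_def)
  have old1: "coefs s1 (2 * (j * Q + k)) = int (count t ?x k) mod modulus M" if "k \<le> N" for k
  proof -
    have "coefs s (2 * (j * Q + k)) = int (count t ?x k) mod modulus M"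
      using rep(2) xs(3) that unfolding old_rep_def by blast
    then show ?thesis by (simp add: s1_def)
  qed
  have same1: "old_same s s1" by (simp add: old_same_def s1_def)
  let ?g1 = "\<lambda>y k. g y k + (if step t ?x False = Some y then count t ?x k else 0)"
  let ?g2 = "\<lambda>y k. ?g1 y k + (if step t ?x True = Some y \<and> 1 \<le> k then count t ?x (k - 1) else 0)"
  have g2: "?g2 = (\<lambda>y k. g y k + contribution t ?x y k)"
    by (simp add: contribution_def fun_eq_iff)
  have Un: "{y. \<exists>z. step t ?x z = Some y} = set_option (step t ?x False) \<union> set_option (step t ?x True)"
    by (auto simp: ex_bool_eq)
  let ?fr = "\<lambda>s'. \<forall>r. r \<notin> {rNew, rX, rY, rA, rB, rC, rZ} \<longrightarrow> reg s' r = reg s r"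
  let ?mid = "\<lambda>s'. (\<exists>ys'. new_rep s' ys' (\<lambda>y k. g y k + contribution t ?x y k) \<and>
        set ys' = set ys \<union> {y. \<exists>z. step t ?x z = Some y} \<and> reg s' rNew = length ys') \<and>
     ?fr s' \<and> old_same s s'"
  have finish: "wp M (rJ ::= Reg rJ \<^bold>+ Const 1) s' (\<lambda>u s''. ?P (\<tau> + u) s'')"
    if mid: "?mid s'" and \<tau>: "\<tau> \<le> 4 * lookup_cost + 62 * Q + 340" for s' \<tau>
  proof -
    obtain ys' where ys': "new_rep s' ys' (\<lambda>y k. g y k + contribution t ?x y k)"
      "set ys' = set ys \<union> {y. \<exists>z. step t ?x z = Some y}" "reg s' rNew = length ys'"
      and fr: "?fr s'" and same: "old_same s s'" using mid by auto
    define s'' where "s'' = s'\<lparr>reg := (reg s')(rJ := Suc j)\<rparr>"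
    have J: "reg s' rJ = j" using fr regs by simp
    have "new_rep s'' ys' (\<lambda>y k. g y k + contribution t ?x y k)"
      using ys'(1) by (simp add: new_rep_def s''_def)
    moreover have "old_same s s''" using same by (simp add: old_same_def s''_def)
    moreover have "reg s'' rNew = length ys'" "reg s'' rJ = Suc j"
      "\<forall>r. r \<notin> {rNew, rJ, rX, rY, rA, rB, rC, rZ} \<longrightarrow> reg s'' r = reg s r"
      using ys'(3) fr by (simp_all add: s''_def)
    moreover note ys'(2)
    ultimately have "?P (\<tau> + 4) s''" using \<tau> by auto
    moreover have "Suc j < word_bound M" "1 < word_bound M" using j room by simp_all
    ultimately show ?thesis using J by (simp add: s''_def)
  qed
  have middle: "wp M (If (Reg rT \<^bold>< Reg rN) (select ;; emit) Skip) s2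
      (\<lambda>\<tau> s'. \<tau> \<le> 2 * lookup_cost + 31 * Q + 170 \<and> ?mid s')"
    if s2: "new_rep s2 ys2 ?g1" "set ys2 = set ys \<union> set_option (step t ?x False)"
      "reg s2 rNew = length ys2"
      "\<forall>r. r \<notin> {rNew, rY, rA, rB, rC} \<longrightarrow> reg s2 r = reg s1 r" "old_same s1 s2" for s2 ys2
  proof -
    have fr2: "?fr s2" using s2(4) by (simp add: s1_def)
    have same2: "old_same s s2" using old_same_trans[OF same1 s2(5)] .
    have regs2: "reg s2 rT = t" "reg s2 rN = N" using fr2 regs by simp_all
    have legal: "legal M s2 (Reg rT \<^bold>< Reg rN)" using regs2 t room by simp
    show ?thesis
    proof (cases "t < N")
      case False
      then have none: "step t ?x True = None" by (simp add: step_def)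
      have "?mid s2"
      proof (intro conjI exI[of _ ys2])
        show "new_rep s2 ys2 (\<lambda>y k. g y k + contribution t ?x y k)"
          using s2(1) unfolding g2[symmetric] none by simp
        show "set ys2 = set ys \<union> {y. \<exists>z. step t ?x z = Some y}"
          unfolding Un s2(2) none by simp
      qed (use s2(3) fr2 same2 in simp_all)
      then show ?thesis using False regs2 legal by simp
    next
      case True
      let ?y = "clear (ws t) ?x"
      have stepT: "step t ?x True = push ?y 2" using True by (simp add: step_def)
      have y: "?y < 3 ^ Suc m" using x clear_le[of "ws t" ?x] by simp
      define s3 where "s3 = s2\<lparr>reg := (reg s2)(rX := ?y, rY := 2, rZ := 1)\<rparr>"
      have rep3: "new_rep s3 ys2 ?g1" using s2(1) by (simp add: s3_def new_rep_def)
      have sub: "set ys2 \<subseteq> reach (Suc t)" using s2(2) R(2) inR by auto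
      have same3: "old_same s s3" using same2 by (simp add: s3_def old_same_def)
      have old3: "coefs s3 (2 * (j * Q + k)) = int (count t ?x k) mod modulus M" if "k \<le> N" for k
        using old1[OF that] unfolding old_same_coefs[OF same3] by (simp add: s1_def)
      have emit2: "wp M emit s3 (\<lambda>\<tau> s'. \<tau> \<le> 2 * lookup_cost + 31 * Q + 90 \<and>
         (\<exists>ys'. new_rep s' ys' ?g2 \<and>
            set ys' = set ys2 \<union> set_option (step t ?x True) \<and> reg s' rNew = length ys') \<and>
         (\<forall>r. r \<notin> {rNew, rY, rA, rB, rC} \<longrightarrow> reg s' r = reg s3 r) \<and> old_same s3 s')"
        unfolding stepT
        by (rule emit_correct[OF rep3 card_reach(1) R(1) sub])
          (use inR[of True] y True j old3 regs fr2 s2(3) stepT in \<open>simp_all add: s3_def\<close>)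
      have sel: "wp M select s2 (\<lambda>\<tau> s'. \<tau> \<le> 60 \<and> s' = s3)"
        unfolding s3_def
        by (rule select_correct[OF W]) (use regsW fr2 s2(4) x in \<open>simp_all add: s1_def\<close>)
      have "wp M (select ;; emit) s2 (\<lambda>\<tau> s'. \<tau> \<le> 2 * lookup_cost + 31 * Q + 150 \<and> ?mid s')"
        unfolding wp_Seq
      proof (rule wp_mono[OF sel])
        fix \<tau> :: nat and s' assume "\<tau> \<le> 60 \<and> s' = s3"
        then have \<tau>: "\<tau> \<le> 60" and s': "s' = s3" by auto
        show "wp M emit s' (\<lambda>u s'. \<tau> + u \<le> 2 * lookup_cost + 31 * Q + 150 \<and> ?mid s')"
          unfolding s'
        proof (rule wp_mono[OF emit2])
          fix u s4
          assume *: "u \<le> 2 * lookup_cost + 31 * Q + 90 \<and>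
           (\<exists>ys'. new_rep s4 ys' ?g2 \<and>
              set ys' = set ys2 \<union> set_option (step t ?x True) \<and> reg s4 rNew = length ys') \<and>
           (\<forall>r. r \<notin> {rNew, rY, rA, rB, rC} \<longrightarrow> reg s4 r = reg s3 r) \<and> old_same s3 s4"
          then obtain ys' where ys': "new_rep s4 ys' ?g2"
            "set ys' = set ys2 \<union> set_option (step t ?x True)" "reg s4 rNew = length ys'" by auto
          have "?mid s4"
          proof (intro conjI exI[of _ ys'])
            show "new_rep s4 ys' (\<lambda>y k. g y k + contribution t ?x y k)"
              using ys'(1) unfolding g2 .
            show "set ys' = set ys \<union> {y. \<exists>z. step t ?x z = Some y}"
              unfolding Un ys'(2) s2(2) by blast
            show "?fr s4" using * fr2 by (simp add: s3_def)
            show "old_same s s4" using * old_same_trans[OF same3] by blast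
          qed (rule ys'(3))
          then show "\<tau> + u \<le> 2 * lookup_cost + 31 * Q + 150 \<and> ?mid s4" using \<tau> * by simp
        qed
      qed
      then show ?thesis using True regs2 legal
        by (simp del: wp_Seq) (erule wp_mono, simp)
    qed
  qed
  have emit1: "wp M emit s1 (\<lambda>\<tau> s'. \<tau> \<le> 2 * lookup_cost + 31 * Q + 90 \<and>
     (\<exists>ys'. new_rep s' ys' (\<lambda>y k. g y k + (if step t ?x False = Some y \<and> 0 \<le> k then count t ?x (k - 0) else 0)) \<and>
        set ys' = set ys \<union> set_option (step t ?x False) \<and> reg s' rNew = length ys') \<and>
     (\<forall>r. r \<notin> {rNew, rY, rA, rB, rC} \<longrightarrow> reg s' r = reg s1 r) \<and> old_same s1 s')"
    unfolding stepF
    by (rule emit_correct[OF rep1 card_reach(1) R])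
      (use inR[of False] x d j old1 regs stepF in \<open>simp_all add: s1_def\<close>)
  have load: "wp M load_code s (\<lambda>\<tau> s'. \<tau> \<le> 60 \<and> s' = s1)"
    unfolding s1_def d_def
    by (rule load_code_correct[OF W regsW word x j regs(1,2,4) t])
  show ?thesis
    unfolding process_def wp_Seq
  proof (rule wp_mono[OF load])
    fix \<tau> :: nat and s' assume "\<tau> \<le> 60 \<and> s' = s1"
    then have \<tau>: "\<tau> \<le> 60" and s': "s' = s1" by auto
    show "wp M emit s' (\<lambda>ta s'. wp M (If (Reg rT \<^bold>< Reg rN) (select ;; emit) Skip) s'
      (\<lambda>tb s'. wp M (rJ ::= Reg rJ \<^bold>+ Const 1) s' (\<lambda>u. ?P (\<tau> + (ta + (tb + u))))))"
      unfolding s'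
    proof (rule wp_mono[OF emit1], elim conjE exE)
      fix ta s2 ys2
      assume ta: "ta \<le> 2 * lookup_cost + 31 * Q + 90"
        and s2: "new_rep s2 ys2 (\<lambda>y k. g y k + (if step t ?x False = Some y \<and> 0 \<le> k then count t ?x (k - 0) else 0))"
          "set ys2 = set ys \<union> set_option (step t ?x False)" "reg s2 rNew = length ys2"
          "\<forall>r. r \<notin> {rNew, rY, rA, rB, rC} \<longrightarrow> reg s2 r = reg s1 r" "old_same s1 s2"
      have s2': "new_rep s2 ys2 ?g1" using s2(1) by (simp cong: if_cong)
      show "wp M (If (Reg rT \<^bold>< Reg rN) (select ;; emit) Skip) s2
        (\<lambda>tb s'. wp M (rJ ::= Reg rJ \<^bold>+ Const 1) s' (\<lambda>u. ?P (\<tau> + (ta + (tb + u)))))"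
      proof (rule wp_mono[OF middle[OF s2' s2(2-5)]])
        fix tb s3 assume *: "tb \<le> 2 * lookup_cost + 31 * Q + 170 \<and> ?mid s3"
        have "\<tau> + (ta + tb) \<le> 4 * lookup_cost + 62 * Q + 340" using \<tau> ta * by simp
        note fin = finish[OF _ this, of s3]
        show "wp M (rJ ::= Reg rJ \<^bold>+ Const 1) s3 (\<lambda>u. ?P (\<tau> + (ta + (tb + u))))"
        proof (rule wp_mono[OF fin])
          show "?mid s3" using * by (rule conjunct2)
          fix u s'' assume P: "?P (\<tau> + (ta + tb) + u) s''"
          have eq: "\<tau> + (ta + (tb + u)) = \<tau> + (ta + tb) + u" by simp
          show "?P (\<tau> + (ta + (tb + u))) s''" unfolding eq by (rule P)
        qed
      qed
    qed
  qed
qed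

lemma process_all_correct:
  assumes W: "ws t = [w1, w2, w3, w4]"
    and regsW: "reg s rW1 = w1" "reg s rW2 = w2" "reg s rW3 = w3" "reg s rW4 = w4"
    and rep: "old_rep s xs (count t)" "container s = Map.empty" "\<forall>a. coefs s (2 * a + 1) = 0"
    and R: "\<And>t. card (reach t) \<le> K"
    and xs: "set xs = reach t" "distinct xs"
    and t: "t \<le> N + m"
    and regs: "reg s rT = t" "reg s rQ = Q" "reg s rN = N" "reg s rP = 3 ^ m"
      "reg s rOld = length xs"
  shows "wp M process_all s (\<lambda>\<tau> s'. \<tau> \<le> K * (4 * lookup_cost + 62 * Q + 360) + 20 \<and>
     (\<exists>ys. new_rep s' ys (count (Suc t)) \<and> set ys = reach (Suc t) \<and> reg s' rNew = length ys) \<and>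
     (\<forall>r. r \<notin> {rNew, rJ, rX, rY, rA, rB, rC, rZ} \<longrightarrow> reg s' r = reg s r) \<and> old_same s s')"
proof -
  have len: "length xs \<le> K" using R[of t] distinct_card[OF xs(2)] xs(1) by simp
  let ?g = "\<lambda>i y k. \<Sum>x\<leftarrow>take i xs. contribution t x y k"
  let ?fr = "\<lambda>s'. \<forall>r. r \<notin> {rNew, rJ, rX, rY, rA, rB, rC, rZ} \<longrightarrow> reg s' r = reg s r"
  define Inv where "Inv i s' \<longleftrightarrow>
     (\<exists>ys. new_rep s' ys (?g i) \<and> set ys = {y. \<exists>x\<in>set (take i xs). \<exists>z. step t x z = Some y} \<and>
        reg s' rNew = length ys) \<and> reg s' rJ = i \<and> ?fr s' \<and> old_same s s'" for i and s' :: state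
  define s0 where "s0 = s\<lparr>reg := (reg s)(rNew := 0, rJ := 0)\<rparr>"
  have loop: "wp M (While (Reg rJ \<^bold>< Reg rOld) process) s0
    (\<lambda>\<tau> s'. \<tau> \<le> length xs * (4 * lookup_cost + 62 * Q + 350 + 1 + cost (Reg rJ \<^bold>< Reg rOld)) +
       (1 + cost (Reg rJ \<^bold>< Reg rOld)) \<and> Inv (length xs) s')"
  proof (rule wp_while)
    fix i s' assume i: "i < length xs" and inv: "Inv i s'"
    then obtain ys where ys: "new_rep s' ys (?g i)"
      "set ys = {y. \<exists>x\<in>set (take i xs). \<exists>z. step t x z = Some y}" "reg s' rNew = length ys"
      and s': "reg s' rJ = i" "?fr s'" "old_same s s'" unfolding Inv_def by auto
    have sub: "set ys \<subseteq> reach (Suc t)"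
      unfolding ys(2) reach_Suc xs(1)[symmetric] using set_take_subset[of i xs] by blast
    have take: "take (Suc i) xs = take i xs @ [xs ! i]" using i by (rule take_Suc_conv_app_nth)
    have body: "wp M process s' (\<lambda>\<tau> s''. \<tau> \<le> 4 * lookup_cost + 62 * Q + 350 \<and> Inv (Suc i) s'')"
    proof (rule wp_mono[OF process_correct[OF W _ _ _ _ ys(1) old_rep_cong[OF rep(1) s'(3)]
          R sub xs(1) len i t]], (use s' regs regsW ys(3) in simp_all)[10], elim conjE exE)
      fix \<tau> s'' ys'
      assume \<tau>: "\<tau> \<le> 4 * lookup_cost + 62 * Q + 350"
        and ys': "new_rep s'' ys' (\<lambda>y k. ?g i y k + contribution t (xs ! i) y k)"
          "set ys' = set ys \<union> {y. \<exists>z. step t (xs ! i) z = Some y}" "reg s'' rNew = length ys'"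
        and s'': "reg s'' rJ = Suc i"
          "\<forall>r. r \<notin> {rNew, rJ, rX, rY, rA, rB, rC, rZ} \<longrightarrow> reg s'' r = reg s' r" "old_same s' s''"
      have "new_rep s'' ys' (?g (Suc i))" using ys'(1) unfolding take by simp
      moreover have "set ys' = {y. \<exists>x\<in>set (take (Suc i) xs). \<exists>z. step t x z = Some y}"
        unfolding ys'(2) ys(2) take by auto
      moreover have "?fr s''" using s''(2) s'(2) by simp
      ultimately show "\<tau> \<le> 4 * lookup_cost + 62 * Q + 350 \<and> Inv (Suc i) s''"
        unfolding Inv_def using \<tau> ys'(3) s''(1) old_same_trans[OF s'(3) s''(3)] by auto
    qed
    have "reg s' rOld = length xs" using s'(2) regs by simp
    then show "legal M s' (Reg rJ \<^bold>< Reg rOld) \<and> eval s' (Reg rJ \<^bold>< Reg rOld) \<noteq> 0 \<and>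
        wp M process s' (\<lambda>\<tau> s''. \<tau> \<le> 4 * lookup_cost + 62 * Q + 350 \<and> Inv (Suc i) s'')"
      using body i s'(1) len room by simp
  next
    fix s' assume "Inv (length xs) s'"
    then have "reg s' rJ = length xs" "reg s' rOld = length xs" using regs by (auto simp: Inv_def)
    then show "legal M s' (Reg rJ \<^bold>< Reg rOld) \<and> eval s' (Reg rJ \<^bold>< Reg rOld) = 0"
      using len room by simp
  next
    have "new_rep s0 [] (?g 0)" using rep(2,3) by (simp add: new_rep_def s0_def)
    then show "Inv 0 s0" by (auto simp: Inv_def s0_def old_same_def)
  qed
  have final: "new_rep s' ys (count (Suc t)) \<and> set ys = reach (Suc t)"
    if "new_rep s' ys (?g (length xs))"
      "set ys = {y. \<exists>x\<in>set (take (length xs) xs). \<exists>z. step t x z = Some y}" for s' ys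
  proof -
    have "?g (length xs) = count (Suc t)"
      unfolding count_Suc fun_eq_iff using xs by (simp add: sum_list_distinct_conv_sum_set)
    then show ?thesis using that unfolding reach_Suc xs(1)[symmetric] by simp
  qed
  have le: "length xs * (4 * lookup_cost + 62 * Q + 350 + 1 + cost (Reg rJ \<^bold>< Reg rOld)) \<le>
      K * (4 * lookup_cost + 62 * Q + 360)"
    by (rule mult_le_mono[OF len]) simp
  have "wp M (While (Reg rJ \<^bold>< Reg rOld) process) s0 (\<lambda>\<tau> s'.
     \<tau> \<le> K * (4 * lookup_cost + 62 * Q + 360) + 10 \<and>
     (\<exists>ys. new_rep s' ys (count (Suc t)) \<and> set ys = reach (Suc t) \<and> reg s' rNew = length ys) \<and>
     ?fr s' \<and> old_same s s')"
  proof (rule wp_mono[OF loop], elim conjE)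
    fix \<tau> s'
    assume \<tau>: "\<tau> \<le> length xs * (4 * lookup_cost + 62 * Q + 350 + 1 + cost (Reg rJ \<^bold>< Reg rOld)) +
       (1 + cost (Reg rJ \<^bold>< Reg rOld))" and inv: "Inv (length xs) s'"
    from inv obtain ys where ys: "new_rep s' ys (?g (length xs))"
      "set ys = {y. \<exists>x\<in>set (take (length xs) xs). \<exists>z. step t x z = Some y}"
      "reg s' rNew = length ys" and fr: "?fr s'" "old_same s s'"
      unfolding Inv_def by (elim conjE exE)
    have "\<tau> \<le> K * (4 * lookup_cost + 62 * Q + 360) + 10" using \<tau> le by simp
    then show "\<tau> \<le> K * (4 * lookup_cost + 62 * Q + 360) + 10 \<and>
     (\<exists>ys. new_rep s' ys (count (Suc t)) \<and> set ys = reach (Suc t) \<and> reg s' rNew = length ys) \<and>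
     ?fr s' \<and> old_same s s'"
      using final[OF ys(1,2)] ys(3) fr by (intro conjI exI[of _ ys]) simp_all
  qed
  then show ?thesis unfolding process_all_def using room
    by (simp add: s0_def) (erule wp_mono, simp)
qed

lemma move_words_correct:
  assumes rep: "new_rep s ys g" and len: "length ys \<le> K"
    and bound: "\<And>y. y \<in> set ys \<Longrightarrow> y < word_bound M"
    and regs: "reg s rJ = 0" "reg s rNew = length ys"
  shows "wp M move_words s (\<lambda>\<tau> s'. \<tau> \<le> K * (lookup_cost + 30) + 10 \<and>
     (\<forall>j<length ys. words s' (2 * j) = ys ! j) \<and> container s' = Map.empty \<and> coefs s' = coefs s \<and>
     (\<forall>r. r \<notin> {rJ, rX} \<longrightarrow> reg s' r = reg s r))"
proof -
  let ?b = "Reg rJ \<^bold>< Reg rNew"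
  let ?c = "rX ::= Word (Const 2 \<^bold>* Reg rJ \<^bold>+ Const 1) ;;
         Store (Const 2 \<^bold>* Reg rJ) (Reg rX) ;;
         Delete (Reg rX) ;;
         rJ ::= Reg rJ \<^bold>+ Const 1"
  define Inv where "Inv i s' \<longleftrightarrow>
     (\<forall>j<i. words s' (2 * j) = ys ! j) \<and> (\<forall>j<length ys. words s' (2 * j + 1) = ys ! j) \<and>
     container s' = (\<lambda>y. if y \<in> set (take i ys) then None else container s y) \<and>
     coefs s' = coefs s \<and> reg s' rJ = i \<and> (\<forall>r. r \<notin> {rJ, rX} \<longrightarrow> reg s' r = reg s r)" for i and s' :: state
  have dom: "dom (container s) = set ys" using new_rep_dom[OF rep] .
  have card: "card (set ys) \<le> K" using len distinct_card[OF new_rep_distinct[OF rep]] by simp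
  have loop: "wp M (While ?b ?c) s
    (\<lambda>\<tau> s'. \<tau> \<le> length ys * (lookup_cost + 24 + 1 + cost ?b) + (1 + cost ?b) \<and> Inv (length ys) s')"
  proof (rule wp_while)
    fix i s' assume i: "i < length ys" and inv: "Inv i s'"
    then have s': "\<forall>j<i. words s' (2 * j) = ys ! j" "\<forall>j<length ys. words s' (2 * j + 1) = ys ! j"
     "container s' = (\<lambda>y. if y \<in> set (take i ys) then None else container s y)"
     "coefs s' = coefs s" "reg s' rJ = i" "\<forall>r. r \<notin> {rJ, rX} \<longrightarrow> reg s' r = reg s r"
      unfolding Inv_def by blast+
    have take: "take (Suc i) ys = take i ys @ [ys ! i]" using i by (rule take_Suc_conv_app_nth)
    define s'' where "s'' = s'\<lparr>words := (words s')(2 * i := ys ! i),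
      container := (container s')(ys ! i := None),
      reg := (reg s')(rX := ys ! i, rJ := Suc i)\<rparr>"
    have "Inv (Suc i) s''"
      unfolding Inv_def
    proof (intro conjI)
      show "\<forall>j<Suc i. words s'' (2 * j) = ys ! j"
        using s'(1) by (simp add: s''_def less_Suc_eq)
      show "\<forall>j<length ys. words s'' (2 * j + 1) = ys ! j"
        using s'(2) Suc_double_not_eq_double by (simp add: s''_def)
      show "container s'' = (\<lambda>y. if y \<in> set (take (Suc i) ys) then None else container s y)"
        unfolding take by (auto simp: s''_def s'(3))
    qed (use s' in \<open>simp_all add: s''_def\<close>)
    moreover have "container_cost (s'\<lparr>reg := f, words := h\<rparr>) = container_cost s'" for f h
      by (simp add: container_cost_def)
    moreover have "container_cost s' \<le> lookup_cost"
    proof (rule container_cost_le)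
      have "dom (container s') \<subseteq> set ys" unfolding s'(3) using dom by (auto split: if_splits)
      then show "card (dom (container s')) \<le> K"
        using card_mono[of "set ys" "dom (container s')"] card by simp
    qed
    moreover have "words s' (Suc (2 * i)) = ys ! i" using s'(2) i by simp
    moreover have "reg s' rNew = length ys" using s'(6) regs by simp
    moreover have "ys ! i < word_bound M" using bound[of "ys ! i"] i by simp
    ultimately show "legal M s' ?b \<and> eval s' ?b \<noteq> 0 \<and> wp M ?c s' (\<lambda>\<tau> s''. \<tau> \<le> lookup_cost + 24 \<and> Inv (Suc i) s'')"
      using i s'(5) len room caps by (simp add: s''_def)
  next
    fix s' assume "Inv (length ys) s'"
    then have "reg s' rJ = length ys" "reg s' rNew = length ys" using regs by (auto simp: Inv_def)
    then show "legal M s' ?b \<and> eval s' ?b = 0" using len room by simp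
  next
    show "Inv 0 s" using rep regs by (auto simp: Inv_def new_rep_def)
  qed
  have le: "length ys * (lookup_cost + 24 + 1 + cost ?b) \<le> K * (lookup_cost + 30)"
    by (rule mult_le_mono[OF len]) simp
  show ?thesis
    unfolding move_words_def
  proof (rule wp_mono[OF loop], elim conjE)
    fix \<tau> s' assume "\<tau> \<le> length ys * (lookup_cost + 24 + 1 + cost ?b) + (1 + cost ?b)" and inv: "Inv (length ys) s'"
    then have "\<tau> \<le> K * (lookup_cost + 30) + 10" using le by simp
    moreover have "container s' = Map.empty"
      using inv dom unfolding Inv_def by (auto simp: fun_eq_iff dom_def)
    ultimately show "\<tau> \<le> K * (lookup_cost + 30) + 10 \<and>
     (\<forall>j<length ys. words s' (2 * j) = ys ! j) \<and> container s' = Map.empty \<and> coefs s' = coefs s \<and>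
     (\<forall>r. r \<notin> {rJ, rX} \<longrightarrow> reg s' r = reg s r)"
      using inv unfolding Inv_def by simp
  qed
qed

lemma move_coefs_correct:
  assumes zero: "\<forall>a\<ge>b. coefs s (2 * a + 1) = 0" and b: "b \<le> K * Q"
    and regs: "reg s rC = 0" "reg s rB = b"
  shows "wp M move_coefs s (\<lambda>\<tau> s'. \<tau> \<le> K * Q * 30 + 10 \<and>
     (\<forall>a<b. coefs s' (2 * a) = coefs s (2 * a + 1)) \<and> (\<forall>a. coefs s' (2 * a + 1) = 0) \<and>
     words s' = words s \<and> container s' = container s \<and>
     (\<forall>r. r \<noteq> rC \<longrightarrow> reg s' r = reg s r))"
proof -
  let ?b = "Reg rC \<^bold>< Reg rB"
  let ?c = "CoefCopy (Const 2 \<^bold>* Reg rC) (Const 2 \<^bold>* Reg rC \<^bold>+ Const 1) ;;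
         CoefZero (Const 2 \<^bold>* Reg rC \<^bold>+ Const 1) ;;
         rC ::= Reg rC \<^bold>+ Const 1"
  define Inv where "Inv i s' \<longleftrightarrow>
     (\<forall>a<i. coefs s' (2 * a) = coefs s (2 * a + 1)) \<and>
     (\<forall>a<i. coefs s' (2 * a + 1) = 0) \<and> (\<forall>a\<ge>i. coefs s' (2 * a + 1) = coefs s (2 * a + 1)) \<and>
     words s' = words s \<and> container s' = container s \<and> reg s' rC = i \<and>
     (\<forall>r. r \<noteq> rC \<longrightarrow> reg s' r = reg s r)" for i and s' :: state
  have loop: "wp M (While ?b ?c) s
    (\<lambda>\<tau> s'. \<tau> \<le> b * (24 + 1 + cost ?b) + (1 + cost ?b) \<and> Inv b s')"
  proof (rule wp_while)
    fix i s' assume i: "i < b" and inv: "Inv i s'"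
    then have s': "\<forall>a<i. coefs s' (2 * a) = coefs s (2 * a + 1)"
     "\<forall>a<i. coefs s' (2 * a + 1) = 0" "\<forall>a\<ge>i. coefs s' (2 * a + 1) = coefs s (2 * a + 1)"
     "words s' = words s" "container s' = container s" "reg s' rC = i"
     "\<forall>r. r \<noteq> rC \<longrightarrow> reg s' r = reg s r"
      unfolding Inv_def by blast+
    define s'' where "s'' = s'\<lparr>coefs := (coefs s')(2 * i := coefs s' (2 * i + 1), 2 * i + 1 := 0),
      reg := (reg s')(rC := Suc i)\<rparr>"
    have neq: "2 * a \<noteq> Suc (2 * c)" "Suc (2 * c) \<noteq> 2 * a" for a c :: nat by presburger+
    have "Inv (Suc i) s''"
      unfolding Inv_def
    proof (intro conjI)
      show "\<forall>a<Suc i. coefs s'' (2 * a) = coefs s (2 * a + 1)"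
        using s'(1,3) neq by (simp add: s''_def less_Suc_eq)
      show "\<forall>a<Suc i. coefs s'' (2 * a + 1) = 0"
        using s'(2) neq by (simp add: s''_def less_Suc_eq)
      show "\<forall>a\<ge>Suc i. coefs s'' (2 * a + 1) = coefs s (2 * a + 1)"
        using s'(3) neq by (simp add: s''_def)
    qed (use s' in \<open>simp_all add: s''_def\<close>)
    moreover have "reg s' rB = b" using s'(7) regs by simp
    ultimately show "legal M s' ?b \<and> eval s' ?b \<noteq> 0 \<and> wp M ?c s' (\<lambda>\<tau> s''. \<tau> \<le> 24 \<and> Inv (Suc i) s'')"
      using i s'(6) b room caps by (simp add: s''_def coef_address_def)
  next
    fix s' assume "Inv b s'"
    then have "reg s' rC = b" "reg s' rB = b" using regs by (auto simp: Inv_def)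
    then show "legal M s' ?b \<and> eval s' ?b = 0" using b room by simp
  next
    show "Inv 0 s" using regs by (simp add: Inv_def)
  qed
  have le: "b * (24 + 1 + cost ?b) \<le> K * Q * 30"
    by (rule mult_le_mono[OF b]) simp
  show ?thesis
    unfolding move_coefs_def
  proof (rule wp_mono[OF loop], elim conjE)
    fix \<tau> s' assume "\<tau> \<le> b * (24 + 1 + cost ?b) + (1 + cost ?b)" and inv: "Inv b s'"
    then have "\<tau> \<le> K * Q * 30 + 10" using le by simp
    moreover have "coefs s' (2 * a + 1) = 0" for a
      using inv zero unfolding Inv_def by (cases "a < b") auto
    ultimately show "\<tau> \<le> K * Q * 30 + 10 \<and>
     (\<forall>a<b. coefs s' (2 * a) = coefs s (2 * a + 1)) \<and> (\<forall>a. coefs s' (2 * a + 1) = 0) \<and>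
     words s' = words s \<and> container s' = container s \<and>
     (\<forall>r. r \<noteq> rC \<longrightarrow> reg s' r = reg s r)"
      using inv unfolding Inv_def by simp
  qed
qed

text \<open>
  The loop invariant of the main loop.
\<close>

definition ready :: "nat \<Rightarrow> state \<Rightarrow> bool" where
  "ready t s \<longleftrightarrow> (\<exists>xs. old_rep s xs (count t) \<and> set xs = reach t \<and> distinct xs \<and>
     reg s rOld = length xs) \<and>
     container s = Map.empty \<and> (\<forall>a. coefs s (2 * a + 1) = 0) \<and>
     reg s rT = t \<and> reg s rM = m \<and> reg s rN = N \<and> reg s rP = 3 ^ m \<and> reg s rQ = Q"

lemma transfer_correct:
  assumes rep: "new_rep s ys g" and len: "length ys \<le> K"
    and bound: "\<And>y. y \<in> set ys \<Longrightarrow> y < word_bound M"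
    and regs: "reg s rNew = length ys" "reg s rQ = Q"
  shows "wp M transfer s (\<lambda>\<tau> s'. \<tau> \<le> K * (lookup_cost + 30) + K * Q * 30 + 60 \<and>
     old_rep s' ys g \<and> container s' = Map.empty \<and> (\<forall>a. coefs s' (2 * a + 1) = 0) \<and>
     reg s' rOld = length ys \<and> (\<forall>r. r \<notin> {rJ, rX, rB, rC, rOld} \<longrightarrow> reg s' r = reg s r))"
proof -
  let ?b = "length ys * Q"
  have b: "?b \<le> K * Q" by (rule mult_le_mono1[OF len])
  define s0 where "s0 = s\<lparr>reg := (reg s)(rJ := 0)\<rparr>"
  have rep0: "new_rep s0 ys g" using rep by (simp add: new_rep_def s0_def)
  have regs0: "reg s0 rJ = 0" "reg s0 rNew = length ys" using regs by (simp_all add: s0_def)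
  let ?P = "\<lambda>\<tau> s'. \<tau> \<le> K * (lookup_cost + 30) + K * Q * 30 + 60 \<and>
     old_rep s' ys g \<and> container s' = Map.empty \<and> (\<forall>a. coefs s' (2 * a + 1) = 0) \<and>
     reg s' rOld = length ys \<and> (\<forall>r. r \<notin> {rJ, rX, rB, rC, rOld} \<longrightarrow> reg s' r = reg s r)"
  have second: "wp M (rB ::= Reg rNew \<^bold>* Reg rQ ;; rC ::= Const 0 ;; move_coefs ;; rOld ::= Reg rNew) s1
      (\<lambda>\<tau>. ?P (4 + (\<tau>1 + \<tau>)))"
    if \<tau>1: "\<tau>1 \<le> K * (lookup_cost + 30) + 10" and words: "\<forall>j<length ys. words s1 (2 * j) = ys ! j"
      and s1: "container s1 = Map.empty" "coefs s1 = coefs s0"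
      "\<forall>r. r \<notin> {rJ, rX} \<longrightarrow> reg s1 r = reg s0 r" for \<tau>1 s1
  proof -
    have regs1: "reg s1 rNew = length ys" "reg s1 rQ = Q" using s1(3) regs by (simp_all add: s0_def)
    define s2 where "s2 = s1\<lparr>reg := (reg s1)(rB := ?b, rC := 0)\<rparr>"
    have zero: "\<forall>a\<ge>?b. coefs s2 (2 * a + 1) = 0"
      using rep s1(2) unfolding new_rep_def by (simp add: s0_def s2_def)
    have fin: "wp M (rOld ::= Reg rNew) s3 (\<lambda>\<tau>. ?P (4 + (\<tau>1 + (4 + (2 + (\<tau>3 + \<tau>))))))"
      if \<tau>3: "\<tau>3 \<le> K * Q * 30 + 10" and c: "\<forall>a<?b. coefs s3 (2 * a) = coefs s2 (2 * a + 1)"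
        "\<forall>a. coefs s3 (2 * a + 1) = 0" "words s3 = words s2" "container s3 = container s2"
        "\<forall>r. r \<noteq> rC \<longrightarrow> reg s3 r = reg s2 r" for \<tau>3 s3
    proof -
      define s4 where "s4 = s3\<lparr>reg := (reg s3)(rOld := length ys)\<rparr>"
      have rN3: "reg s3 rNew = length ys" using c(5) regs1 by (simp add: s2_def)
      have "old_rep s4 ys g"
        unfolding old_rep_def
      proof (intro allI impI conjI)
        fix j assume j: "j < length ys"
        show "words s4 (2 * j) = ys ! j" using words j c(3) by (simp add: s4_def s2_def)
        fix k assume k: "k \<le> N"
        have "j * Q + Q \<le> ?b" using mult_le_mono1[of "Suc j" "length ys" Q] j by simp
        then have "j * Q + k < ?b" using k Q by simp
        then have "coefs s4 (2 * (j * Q + k)) = coefs s (2 * (j * Q + k) + 1)"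
          using c(1)[rule_format, of "j * Q + k"] s1(2) by (simp add: s4_def s2_def s0_def)
        also have "\<dots> = int (g (ys ! j) k) mod modulus M"
          using rep j k unfolding new_rep_def by blast
        finally show "coefs s4 (2 * (j * Q + k)) = int (g (ys ! j) k) mod modulus M" .
      qed
      moreover have "container s4 = Map.empty" "\<forall>a. coefs s4 (2 * a + 1) = 0"
        "reg s4 rOld = length ys" using c s1 by (simp_all add: s4_def s2_def)
      moreover have "\<forall>r. r \<notin> {rJ, rX, rB, rC, rOld} \<longrightarrow> reg s4 r = reg s r"
        using c(5) s1(3) by (simp add: s4_def s2_def s0_def)
      moreover have "4 + (\<tau>1 + (4 + (2 + (\<tau>3 + 2)))) \<le> K * (lookup_cost + 30) + K * Q * 30 + 60"
        using \<tau>1 \<tau>3 by simp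
      ultimately have "?P (4 + (\<tau>1 + (4 + (2 + (\<tau>3 + 2))))) s4" by blast
      then show ?thesis using rN3 len room by (simp add: s4_def)
    qed
    have "wp M (move_coefs ;; rOld ::= Reg rNew) s2 (\<lambda>\<tau>. ?P (4 + (\<tau>1 + (4 + (2 + \<tau>)))))"
      unfolding wp_Seq
    proof (rule wp_mono[OF move_coefs_correct[OF zero b]], goal_cases)
      case (3 t s')
      then show ?case using fin[of t s'] by blast
    qed (simp_all add: s2_def)
    moreover have "?b < word_bound M" "Q < word_bound M" using b room Q by linarith+
    ultimately show ?thesis using regs1 len room
      unfolding s2_def by (simp del: wp_Seq add: wp_Seq[of _ "Assign _ _"])
  qed
  have "wp M (move_words ;; rB ::= Reg rNew \<^bold>* Reg rQ ;; rC ::= Const 0 ;; move_coefs ;; rOld ::= Reg rNew) s0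
      (\<lambda>\<tau>. ?P (4 + \<tau>))"
    unfolding wp_Seq[of _ move_words]
    by (rule wp_mono[OF move_words_correct[OF rep0 len bound regs0]])
      (assumption, elim conjE, rule second, assumption+)
  then show ?thesis
    unfolding transfer_def using room
    by (simp del: wp_Seq add: wp_Seq[of _ "Assign _ _"] s0_def) (erule wp_mono, simp)
qed

text \<open>
  All that the correctness proof needs to know about the program part that depends on the graph.
\<close>

definition loads_weights :: "com \<Rightarrow> bool" where
  "loads_weights W \<longleftrightarrow> (\<forall>s t. t \<le> N + m \<longrightarrow> reg s rM = m \<longrightarrow> reg s rP = 3 ^ m \<longrightarrow> reg s rT = t \<longrightarrow>
     (\<exists>w1 w2 w3 w4. ws t = [w1, w2, w3, w4] \<and> wp M W s (\<lambda>\<tau> s'. \<tau> \<le> 60 \<and>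
        s' = s\<lparr>reg := (reg s)(rW1 := w1, rW2 := w2, rW3 := w3, rW4 := w4)\<rparr>)))"

definition round_time :: nat where
  "round_time = K * (5 * lookup_cost + 92 * Q + 390) + 200"

lemma sweep_round_correct:
  assumes W: "loads_weights W" and R: "\<And>t. card (reach t) \<le> K"
    and ready: "ready t s" and t: "t \<le> N + m"
  shows "wp M (sweep_round W) s (\<lambda>\<tau> s'. \<tau> \<le> round_time \<and> ready (Suc t) s')"
proof -
  from ready obtain xs where xs: "old_rep s xs (count t)" "set xs = reach t" "distinct xs"
      "reg s rOld = length xs"
    and s: "container s = Map.empty" "\<forall>a. coefs s (2 * a + 1) = 0"
     "reg s rT = t" "reg s rM = m" "reg s rN = N" "reg s rP = 3 ^ m" "reg s rQ = Q"
    unfolding ready_def by (elim conjE exE)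
  obtain w1 w2 w3 w4 where ws: "ws t = [w1, w2, w3, w4]"
    and wpW: "wp M W s (\<lambda>\<tau> s'. \<tau> \<le> 60 \<and>
        s' = s\<lparr>reg := (reg s)(rW1 := w1, rW2 := w2, rW3 := w3, rW4 := w4)\<rparr>)"
    using W t s unfolding loads_weights_def by metis
  define s1 where "s1 = s\<lparr>reg := (reg s)(rW1 := w1, rW2 := w2, rW3 := w3, rW4 := w4)\<rparr>"
  have "wp M process_all s1 (\<lambda>\<tau> s'. \<tau> \<le> K * (4 * lookup_cost + 62 * Q + 360) + 20 \<and>
     (\<exists>ys. new_rep s' ys (count (Suc t)) \<and> set ys = reach (Suc t) \<and> reg s' rNew = length ys) \<and>
     (\<forall>r. r \<notin> {rNew, rJ, rX, rY, rA, rB, rC, rZ} \<longrightarrow> reg s' r = reg s1 r) \<and> old_same s1 s')"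
  proof (rule process_all_correct[OF ws _ _ _ _ _ _ _ R xs(2,3) t])
    show "old_rep s1 xs (count t)" using xs(1) by (simp add: old_rep_def s1_def)
  qed (use xs s in \<open>simp_all add: s1_def\<close>)
  note proc = this
  have room': "t + 1 < word_bound M" "1 < word_bound M" using t room by linarith+
  show ?thesis
    unfolding sweep_round_def wp_Seq
  proof (rule wp_mono[OF wpW], fold s1_def)
    fix \<tau>1 :: nat and s' assume 1: "\<tau>1 \<le> 60 \<and> s' = s1"
    show "wp M process_all s' (\<lambda>\<tau>2 s'. wp M transfer s' (\<lambda>\<tau>3 s'. wp M (rT ::= Reg rT \<^bold>+ Const 1) s'
      (\<lambda>u s'. \<tau>1 + (\<tau>2 + (\<tau>3 + u)) \<le> round_time \<and> ready (Suc t) s')))"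
      unfolding conjunct2[OF 1]
    proof (rule wp_mono[OF proc], elim conjE exE)
      fix \<tau>2 s2 ys
      assume 2: "\<tau>2 \<le> K * (4 * lookup_cost + 62 * Q + 360) + 20"
        and ys: "new_rep s2 ys (count (Suc t))" "set ys = reach (Suc t)" "reg s2 rNew = length ys"
        and fr2: "\<forall>r. r \<notin> {rNew, rJ, rX, rY, rA, rB, rC, rZ} \<longrightarrow> reg s2 r = reg s1 r"
      have dist: "distinct ys" using new_rep_distinct[OF ys(1)] .
      have len: "length ys \<le> K" using R[of "Suc t"] distinct_card[OF dist] ys(2) by simp
      have bound: "y < word_bound M" if "y \<in> set ys" for y
        using reach_less[of y "Suc t"] that ys(2) room by simp
      have Q2: "reg s2 rQ = Q" using fr2 s by (simp add: s1_def)
      show "wp M transfer s2 (\<lambda>\<tau>3 s'. wp M (rT ::= Reg rT \<^bold>+ Const 1) s'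
        (\<lambda>u s'. \<tau>1 + (\<tau>2 + (\<tau>3 + u)) \<le> round_time \<and> ready (Suc t) s'))"
      proof (rule wp_mono[OF transfer_correct[OF ys(1) len bound ys(3) Q2]], assumption, elim conjE)
        fix \<tau>3 s3
        assume 3: "\<tau>3 \<le> K * (lookup_cost + 30) + K * Q * 30 + 60"
          and s3: "old_rep s3 ys (count (Suc t))" "container s3 = Map.empty"
            "\<forall>a. coefs s3 (2 * a + 1) = 0" "reg s3 rOld = length ys"
          and fr3: "\<forall>r. r \<notin> {rJ, rX, rB, rC, rOld} \<longrightarrow> reg s3 r = reg s2 r"
        define s4 where "s4 = s3\<lparr>reg := (reg s3)(rT := Suc t)\<rparr>"
        have regs3: "reg s3 rT = t" "reg s3 rM = m" "reg s3 rN = N" "reg s3 rP = 3 ^ m" "reg s3 rQ = Q"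
          using fr3 fr2 s by (simp_all add: s1_def)
        have "old_rep s4 ys (count (Suc t))" using s3(1) by (simp add: old_rep_def s4_def)
        then have "ready (Suc t) s4"
          unfolding ready_def using s3 regs3 ys(2) dist
          by (intro conjI exI[of _ ys]) (simp_all add: s4_def)
        moreover have "\<tau>1 + (\<tau>2 + (\<tau>3 + 4)) \<le> round_time"
          using 1 2 3 unfolding round_time_def by (simp add: algebra_simps)
        ultimately show "wp M (rT ::= Reg rT \<^bold>+ Const 1) s3
          (\<lambda>u s'. \<tau>1 + (\<tau>2 + (\<tau>3 + u)) \<le> round_time \<and> ready (Suc t) s')"
          using regs3 room' by (simp add: s4_def)
      qed
    qed
  qed
qed

lemma prepare_correct:
  assumes N: "N = m * n" and n: "1 \<le> n" and K: "1 \<le> K"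
  shows "wp M prepare (init_state m n) (\<lambda>\<tau> s. \<tau> \<le> 20 * m + 50 \<and> ready 0 s)"
proof -
  define st where "st i = (init_state m n)\<lparr>reg := (reg (init_state m n))
     (rN := N, rQ := Q, rP := 3 ^ i, rC := i)\<rparr>" for i
  let ?b = "Reg rC \<^bold>< Reg rM"
  have loop: "wp M power_loop (st 0) (\<lambda>\<tau> s. \<tau> \<le> m * (10 + 1 + cost ?b) + (1 + cost ?b) \<and> s = st m)"
    unfolding power_loop_def
  proof (rule wp_while)
    fix i s assume i: "i < m" and s: "s = st i"
    have "(3::nat) ^ Suc i \<le> 3 ^ m" using i by (intro power_increasing) auto
    then have "3 * (3::nat) ^ i \<le> 3 ^ m" by simp
    then have "(3::nat) ^ i * 3 < word_bound M" "(3::nat) ^ i < word_bound M"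
      "i < word_bound M" "m < word_bound M" "Suc i < word_bound M" "3 < word_bound M"
      using room i by linarith+
    then show "legal M s ?b \<and> eval s ?b \<noteq> 0 \<and>
      wp M (rP ::= Reg rP \<^bold>* Const 3 ;; rC ::= Reg rC \<^bold>+ Const 1) s
        (\<lambda>\<tau> s'. \<tau> \<le> 10 \<and> s' = st (Suc i))"
      using i room s by (simp add: st_def init_state_def mult.commute fun_upd_twist)
  next
    fix s assume "s = st m"
    then show "legal M s ?b \<and> eval s ?b = 0" using room by (simp add: st_def init_state_def)
  qed simp
  define s1 where "s1 = (st m)\<lparr>coefs := (coefs (st m))(0 := 1 mod modulus M),
    reg := (reg (st m))(rOld := 1)\<rparr>"
  have "old_rep s1 [0] (count 0)"
    unfolding old_rep_def by (auto simp: s1_def st_def init_state_def count_0)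
  then have ready: "ready 0 s1"
    unfolding ready_def using reach_0
    by (intro conjI exI[of _ "[0]"]) (simp_all add: s1_def st_def init_state_def)
  have "n \<le> N" "m \<le> N" using N n m_pos by simp_all
  moreover have "1 * (1 * 1) \<le> K * Q" by (intro mult_le_mono) (use K Q in auto)
  ultimately have bounds: "n < word_bound M" "m < word_bound M" "N < word_bound M" "0 < word_bound M"
    "Q < word_bound M" "1 < word_bound M" "0 < coef_cap M"
    using room caps Q by linarith+
  have tail: "wp M (CoefOne (Const 0) ;; rOld ::= Const 1) (st m) (\<lambda>\<tau> s. \<tau> \<le> 10 \<and> ready 0 s)"
    using ready bounds by (simp add: coef_address_def s1_def)
  have main: "wp M (power_loop ;; CoefOne (Const 0) ;; rOld ::= Const 1) (st 0)
      (\<lambda>\<tau> s. \<tau> \<le> 20 * m + 20 \<and> ready 0 s)"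
    unfolding wp_Seq[of _ power_loop]
  proof (rule wp_mono[OF loop], elim conjE)
    fix \<tau> s assume *: "\<tau> \<le> m * (10 + 1 + cost ?b) + (1 + cost ?b)" "s = st m"
    show "wp M (CoefOne (Const 0) ;; rOld ::= Const 1) s (\<lambda>u s. \<tau> + u \<le> 20 * m + 20 \<and> ready 0 s)"
      unfolding *(2) by (rule wp_mono[OF tail]) (use *(1) in simp)
  qed
  have upd: "(init_state m n)\<lparr>reg := (reg (init_state m n))(rN := N, rQ := Q, rP := 1)\<rparr> = st 0"
    by (rule state.equality) (simp_all add: st_def init_state_def fun_eq_iff)
  have head: "wp M prepare (init_state m n) P"
    if "wp M (power_loop ;; CoefOne (Const 0) ;; rOld ::= Const 1) (st 0) (\<lambda>\<tau>. P (4 + (4 + (2 + \<tau>))))" for P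
  proof -
    have "reg (init_state m n) rM = m" "reg (init_state m n) 1 = n" by (simp_all add: init_state_def)
    then show ?thesis
      unfolding prepare_def using that[folded upd] bounds N Q
      by (simp del: wp_Seq add: wp_Seq[of _ "Assign _ _"] eval_nat_numeral)
  qed
  show ?thesis by (rule head, rule wp_mono[OF main]) simp
qed

lemma write_out_correct:
  assumes regs: "reg s rQ = Q" and K: "1 \<le> K"
  shows "wp M write_out s (\<lambda>\<tau> s'. \<tau> \<le> 20 * Q + 20 \<and> (\<forall>j\<le>N. coefs s' j = coefs s (2 * j)))"
proof -
  let ?b = "Reg rC \<^bold>< Reg rQ"
  let ?c = "CoefCopy (Reg rC) (Const 2 \<^bold>* Reg rC) ;; rC ::= Reg rC \<^bold>+ Const 1"
  define s0 where "s0 = s\<lparr>reg := (reg s)(rC := 0)\<rparr>"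
  define Inv where "Inv i s' \<longleftrightarrow> (\<forall>j<i. coefs s' j = coefs s (2 * j)) \<and>
    (\<forall>j\<ge>i. coefs s' j = coefs s j) \<and> reg s' rC = i \<and> reg s' rQ = Q" for i and s' :: state
  have KQ: "1 * Q \<le> K * Q" by (rule mult_le_mono1[OF K])
  have loop: "wp M (While ?b ?c) s0 (\<lambda>\<tau> s'. \<tau> \<le> Q * (14 + 1 + cost ?b) + (1 + cost ?b) \<and> Inv Q s')"
  proof (rule wp_while)
    fix i s' assume i: "i < Q" and inv: "Inv i s'"
    have "2 * i < word_bound M" "i < word_bound M" "Suc i < word_bound M" "2 < word_bound M"
      "Q < word_bound M" "2 * i < coef_cap M" "i < coef_cap M"
      using i KQ room caps by linarith+
    then show "legal M s' ?b \<and> eval s' ?b \<noteq> 0 \<and> wp M ?c s' (\<lambda>\<tau> s''. \<tau> \<le> 14 \<and> Inv (Suc i) s'')"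
      using i inv by (simp add: Inv_def coef_address_def less_Suc_eq)
  next
    fix s' assume "Inv Q s'"
    then show "legal M s' ?b \<and> eval s' ?b = 0" using room Q by (simp add: Inv_def)
  qed (use regs in \<open>simp add: Inv_def s0_def\<close>)
  have "wp M (While ?b ?c) s0 (\<lambda>\<tau> s'. 2 + \<tau> \<le> 20 * Q + 20 \<and> (\<forall>j\<le>N. coefs s' j = coefs s (2 * j)))"
    by (rule wp_mono[OF loop]) (simp add: Inv_def Q)
  then show ?thesis unfolding write_out_def using room by (simp add: s0_def)
qed

definition total_time :: nat where
  "total_time = (N + m + 1) * (round_time + 10) + 20 * m + 20 * Q + 100"

lemma program_correct:
  assumes N: "N = m * n" and n: "1 \<le> n"
    and W: "loads_weights W" and R: "\<And>t. card (reach t) \<le> K"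
  shows "wp M (program W) (init_state m n) (\<lambda>\<tau> s. \<tau> \<le> total_time \<and>
     (\<forall>j\<le>N. coefs s j = int (count (N + m + 1) 0 j) mod modulus M))"
proof -
  have K: "1 \<le> K" using R[of 0] by (simp add: reach_0)
  let ?T = "N + m + 1"
  let ?b = "Reg rT \<^bold>< Reg rN \<^bold>+ Reg rM \<^bold>+ Const 1"
  have loop: "wp M (While ?b (sweep_round W)) s
      (\<lambda>\<tau> s'. \<tau> \<le> ?T * (round_time + 1 + cost ?b) + (1 + cost ?b) \<and> ready ?T s')"
    if "ready 0 s" for s
  proof (rule wp_while)
    fix i s assume i: "i < ?T" and r: "ready i s"
    have "legal M s ?b" "eval s ?b \<noteq> 0" using i r room unfolding ready_def by simp_all
    then show "legal M s ?b \<and> eval s ?b \<noteq> 0 \<and>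
        wp M (sweep_round W) s (\<lambda>\<tau> s'. \<tau> \<le> round_time \<and> ready (Suc i) s')"
      using sweep_round_correct[OF W R r] i by simp
  next
    fix s assume "ready ?T s"
    then show "legal M s ?b \<and> eval s ?b = 0" using room unfolding ready_def by simp
  qed (rule that)
  show ?thesis
    unfolding program_def wp_Seq
  proof (rule wp_mono[OF prepare_correct[OF N n K]], elim conjE)
    fix \<tau>1 s1 assume 1: "\<tau>1 \<le> 20 * m + 50" and r1: "ready 0 s1"
    show "wp M (While ?b (sweep_round W)) s1 (\<lambda>\<tau>2 s. wp M write_out s (\<lambda>u s.
      \<tau>1 + (\<tau>2 + u) \<le> total_time \<and> (\<forall>j\<le>N. coefs s j = int (count ?T 0 j) mod modulus M)))"
    proof (rule wp_mono[OF loop[OF r1]], elim conjE)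
      fix \<tau>2 s2
      assume 2: "\<tau>2 \<le> ?T * (round_time + 1 + cost ?b) + (1 + cost ?b)" and r2: "ready ?T s2"
      from r2 obtain xs where xs: "old_rep s2 xs (count ?T)" "set xs = reach ?T" "distinct xs"
        and Q2: "reg s2 rQ = Q" unfolding ready_def by (elim conjE exE)
      have "set xs = {0}" using xs(2) unfolding reach_final .
      then have "length xs = 1" using distinct_card[OF xs(3)] by simp
      with \<open>set xs = {0}\<close> have x: "xs = [0]" by (cases xs) auto
      have val: "coefs s2 (2 * j) = int (count ?T 0 j) mod modulus M" if "j \<le> N" for j
        using xs(1) that unfolding x old_rep_def by simp
      show "wp M write_out s2 (\<lambda>u s. \<tau>1 + (\<tau>2 + u) \<le> total_time \<and>
        (\<forall>j\<le>N. coefs s j = int (count ?T 0 j) mod modulus M))"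
      proof (rule wp_mono[OF write_out_correct[OF Q2 K]], elim conjE, intro conjI)
        fix \<tau>3 s3
        assume 3: "\<tau>3 \<le> 20 * Q + 20" and c: "\<forall>j\<le>N. coefs s3 j = coefs s2 (2 * j)"
        show "\<forall>j\<le>N. coefs s3 j = int (count ?T 0 j) mod modulus M" using c val by simp
        have "cost ?b = 7" by simp
        then have "?T * (round_time + 1 + cost ?b) \<le> ?T * (round_time + 10)"
          by (intro mult_le_mono2) simp
        with 1 2 3 show "\<tau>1 + (\<tau>2 + \<tau>3) \<le> total_time" unfolding total_time_def by simp
      qed
    qed
  qed
qed

end

section \<open>The three families of graphs\<close>

lemma path_edge:
  "{x, y} \<in> edges (path_graph k) \<longleftrightarrow> (y = Suc x \<and> y < k) \<or> (x = Suc y \<and> x < k)"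
  by (auto simp: path_graph_def doubleton_eq_iff)

lemma cycle_edge:
  "{x, y} \<in> edges (cycle_graph k) \<longleftrightarrow>
     x \<noteq> y \<and> x < k \<and> y < k \<and> (y = Suc x mod k \<or> x = Suc y mod k)"
  by (auto simp: cycle_graph_def doubleton_eq_iff)

lemma cartesian_edge:
  "{(i, j), (i', j')} \<in> edges (cartesian_product G H) \<longleftrightarrow>
     (i = i' \<and> i \<in> verts G \<and> {j, j'} \<in> edges H) \<or> (j = j' \<and> {i, i'} \<in> edges G \<and> j \<in> verts H)"
  (is "?L \<longleftrightarrow> ?R")
proof
  show "?L \<Longrightarrow> ?R" by (auto simp: cartesian_product_def doubleton_eq_iff insert_commute)
  show "?R \<Longrightarrow> ?L" unfolding cartesian_product_def by (simp, blast)
qed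

lemma strong_edge:
  "{(i, j), (i', j')} \<in> edges (strong_product G H) \<longleftrightarrow>
     {(i, j), (i', j')} \<in> edges (cartesian_product G H) \<or> ({i, i'} \<in> edges G \<and> {j, j'} \<in> edges H)"
  (is "?L \<longleftrightarrow> ?C \<or> ?R")
proof
  show "?L \<Longrightarrow> ?C \<or> ?R" by (auto simp: strong_product_def doubleton_eq_iff insert_commute)
  show "?C \<or> ?R \<Longrightarrow> ?L" unfolding strong_product_def by (simp, blast)
qed

lemma verts_graphs:
  "verts (grid_graph m n) = {..<m} \<times> {..<n}"
  "verts (cylinder_graph m n) = {..<m} \<times> {..<n}"
  "verts (king_graph m n) = {..<m} \<times> {..<n}"
  by (simp_all add: grid_graph_def cylinder_graph_def king_graph_def cartesian_product_def
      strong_product_def path_graph_def cycle_graph_def)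

definition position :: "nat \<Rightarrow> nat \<times> nat \<Rightarrow> nat" where
  "position m = (\<lambda>(i, j). j * m + i)"

lemma position_eq:
  fixes i j m :: nat
  assumes "i < m" "i' < m"
  shows "j * m + i = j' * m + i' \<longleftrightarrow> i = i' \<and> j = j'"
proof
  assume eq: "j * m + i = j' * m + i'"
  have "(j * m + i) mod m = i" "(j' * m + i') mod m = i'"
    "(j * m + i) div m = j" "(j' * m + i') div m = j'" using assms by simp_all
  then show "i = i' \<and> j = j'" using eq by metis
qed simp

lemma position_less: "i < m \<Longrightarrow> j < n \<Longrightarrow> j * m + i < m * (n::nat)"
  using mult_le_mono1[of "Suc j" n m] by (simp add: mult.commute)

lemma position_bij: "bij_betw (position m) ({..<m} \<times> {..<n}) {..<m * n}"
proof (rule bij_betw_byWitness[where f' = "\<lambda>v. (v mod m, v div m)"])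
  show "position m ` ({..<m} \<times> {..<n}) \<subseteq> {..<m * n}"
    by (auto simp: position_def position_less)
  show "(\<lambda>v. (v mod m, v div m)) ` {..<m * n} \<subseteq> {..<m} \<times> {..<n}"
  proof clarsimp
    fix v assume v: "v < m * n"
    then have "0 < m" by (cases m) auto
    with v show "v mod m < m \<and> v div m < n" by (simp add: less_mult_imp_div_less mult.commute)
  qed
qed (auto simp: position_def)

lemma coeff_domination_poly:
  assumes "finite (verts G)"
  shows "coeff (domination_poly G) k = int (card {S. dominating_set G S \<and> card S = k})"
proof -
  have fin: "finite {S. dominating_set G S}"
    by (rule finite_subset[of _ "Pow (verts G)"]) (use assms in \<open>auto simp: dominating_set_def\<close>)
  have "coeff (domination_poly G) k = (\<Sum>S | dominating_set G S. if card S = k then 1 else 0)"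
    by (simp add: domination_poly_def coeff_sum)
  also have "\<dots> = int (card ({S. dominating_set G S} \<inter> {S. card S = k}))"
    using fin by (simp add: sum.If_cases)
  finally show ?thesis by (simp add: Int_def)
qed

text \<open>
  The numbering of the vertices is a bijection, so dominating sets may be counted by their images.
\<close>

lemma (in frontier) coeff_domination_poly_count:
  assumes N: "N = m * n" and V: "verts G = {..<m} \<times> {..<n}"
    and E: "\<And>u v. u \<in> verts G \<Longrightarrow> v \<in> verts G \<Longrightarrow>
      {u, v} \<in> edges G \<longleftrightarrow> adj (position m u) (position m v) \<or> adj (position m v) (position m u)"
  shows "coeff (domination_poly G) k = int (count (N + m + 1) 0 k)"
proof -
  let ?p = "position m"
  let ?D = "\<lambda>S. S \<subseteq> {..<N} \<and> (\<forall>v<N. v \<in> S \<or> (\<exists>u\<in>S. adj u v \<or> adj v u)) \<and> card S = k"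
  have bij: "bij_betw ?p (verts G) {..<N}" unfolding V N by (rule position_bij)
  then have inj: "inj_on ?p (verts G)" and img: "?p ` verts G = {..<N}"
    by (auto simp: bij_betw_def)
  have eq: "dominating_set G S \<and> card S = k \<longleftrightarrow> ?D (?p ` S)" if S: "S \<subseteq> verts G" for S
  proof -
    have "(\<forall>v\<in>verts G. v \<in> S \<or> (\<exists>u\<in>S. {u, v} \<in> edges G)) \<longleftrightarrow>
        (\<forall>v\<in>?p ` verts G. v \<in> ?p ` S \<or> (\<exists>u\<in>?p ` S. adj u v \<or> adj v u))"
    proof -
      have "v \<in> S \<longleftrightarrow> ?p v \<in> ?p ` S" if "v \<in> verts G" for v
        using inj S that by (auto dest: inj_onD)
      moreover have "(\<exists>u\<in>S. {u, v} \<in> edges G) \<longleftrightarrow> (\<exists>u\<in>?p ` S. adj u (?p v) \<or> adj (?p v) u)"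
        if "v \<in> verts G" for v
        unfolding bex_simps(7) by (intro bex_cong refl E) (use that S in auto)
      ultimately show ?thesis by auto
    qed
    moreover have "card (?p ` S) = card S" using inj S by (meson card_image inj_on_subset)
    moreover have "?p ` S \<subseteq> {..<N}" using S img by auto
    ultimately show ?thesis using S unfolding dominating_set_def img by auto
  qed
  have "bij_betw ((`) ?p) {S. dominating_set G S \<and> card S = k} {S. ?D S}"
  proof (rule bij_betw_imageI)
    have "inj_on ((`) ?p) (Pow (verts G))" using inj by (rule inj_on_image_Pow)
    then show "inj_on ((`) ?p) {S. dominating_set G S \<and> card S = k}"
      by (rule inj_on_subset) (auto simp: dominating_set_def)
    show "(`) ?p ` {S. dominating_set G S \<and> card S = k} = {S. ?D S}"
    proof (intro equalityI subsetI)
      fix T assume "T \<in> (`) ?p ` {S. dominating_set G S \<and> card S = k}"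
      then obtain S where S: "dominating_set G S \<and> card S = k" "T = ?p ` S" by auto
      then have "S \<subseteq> verts G" by (simp add: dominating_set_def)
      with S eq show "T \<in> {S. ?D S}" by simp
    next
      fix T assume T: "T \<in> {S. ?D S}"
      then have "T \<subseteq> ?p ` verts G" unfolding img by simp
      then obtain S where S: "S \<subseteq> verts G" "T = ?p ` S" by (meson subset_imageE)
      with T eq have "dominating_set G S \<and> card S = k" by simp
      with S show "T \<in> (`) ?p ` {S. dominating_set G S \<and> card S = k}" by blast
    qed
  qed
  then have "card {S. dominating_set G S \<and> card S = k} = card {S. ?D S}"
    by (rule bij_betw_same_card)
  moreover have "finite (verts G)" unfolding V by simp
  ultimately show ?thesis unfolding count_final by (simp add: coeff_domination_poly)
qed

definition weights_of :: "(nat \<Rightarrow> nat \<Rightarrow> nat) \<Rightarrow> (nat \<Rightarrow> nat \<Rightarrow> nat) \<Rightarrow> nat \<Rightarrow> nat \<Rightarrow> nat list" where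
  "weights_of a b m t = [if t mod m = 0 then 0 else 1, 3 ^ m div 3, a m t, b m t]"

text \<open>
  Adjacency as it is encoded by the weights of the later vertex, without the bound on the number of
  vertices.
\<close>

definition linked :: "(nat \<Rightarrow> nat \<Rightarrow> nat) \<Rightarrow> (nat \<Rightarrow> nat \<Rightarrow> nat) \<Rightarrow> nat \<Rightarrow> nat \<Rightarrow> nat \<Rightarrow> bool" where
  "linked a b m u v \<longleftrightarrow> u < v \<and> 3 ^ (v - 1 - u) \<in> set (weights_of a b m v)"

lemma div_three: "1 \<le> m \<Longrightarrow> (3::nat) ^ m div 3 = 3 ^ (m - 1)"
  by (cases m) auto

lemma div_nine: "(3::nat) ^ m div 9 = (if m < 2 then 0 else 3 ^ (m - 2))"
proof (cases "m < 2")
  case True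
  then have "m = 0 \<or> m = 1" by auto
  then show ?thesis by auto
next
  case False
  then obtain k where "m = k + 2" by (metis add.commute le_Suc_ex not_less)
  then show ?thesis by (simp add: power_add)
qed

lemma linked_iff:
  assumes "1 \<le> m"
  shows "linked a b m u v \<longleftrightarrow> u < v \<and> (v mod m \<noteq> 0 \<and> v = u + 1 \<or> v = u + m \<or>
    a m v = 3 ^ (v - 1 - u) \<or> b m v = 3 ^ (v - 1 - u))"
proof -
  have p: "3 ^ (v - 1 - u) = (if v mod m = 0 then 0 else (1::nat)) \<longleftrightarrow> v mod m \<noteq> 0 \<and> v = u + 1"
    if "u < v"
  proof -
    have "(3::nat) ^ (v - 1 - u) = 1 \<longleftrightarrow> v - 1 - u = 0" by simp
    then show ?thesis using that by auto
  qed
  have "(3::nat) ^ (v - 1 - u) = 3 ^ m div 3 \<longleftrightarrow> v = u + m" if "u < v"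
    unfolding div_three[OF assms] using that assms by auto
  with p show ?thesis unfolding linked_def weights_of_def by (auto simp del: power_eq_0_iff)
qed

lemma position_Suc_mod: "i < m \<Longrightarrow> Suc (j * m + i) mod m = 0 \<longleftrightarrow> Suc i = m"
  by (simp add: mod_Suc)

text \<open>
  Each kind of neighbour is a fixed distance in the numbering, provided that the vertex is not at
  the wrong end of its column.
\<close>

lemma position_steps:
  fixes i j i' j' m :: nat
  assumes "i < m" "i' < m"
  shows "i' \<noteq> 0 \<and> j' * m + i' = j * m + i + 1 \<longleftrightarrow> i' = Suc i \<and> j' = j"
    and "j' * m + i' = j * m + i + m \<longleftrightarrow> i' = i \<and> j' = Suc j"
    and "Suc i' = m \<and> j' * m + i' = j * m + i + (m - 1) \<longleftrightarrow> Suc i' = m \<and> i = 0 \<and> j' = j"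
    and "i' \<noteq> 0 \<and> j' * m + i' = j * m + i + (m + 1) \<longleftrightarrow> i' = Suc i \<and> j' = Suc j"
    and "Suc i' \<noteq> m \<and> j' * m + i' = j * m + i + (m - 1) \<longleftrightarrow> i = Suc i' \<and> j' = Suc j"
proof -
  show "i' \<noteq> 0 \<and> j' * m + i' = j * m + i + 1 \<longleftrightarrow> i' = Suc i \<and> j' = j"
  proof (cases i')
    case (Suc k)
    then show ?thesis using position_eq[of k m i j' j] assms by auto
  qed simp
  show "j' * m + i' = j * m + i + m \<longleftrightarrow> i' = i \<and> j' = Suc j"
    using position_eq[of i' m i j' "Suc j"] assms by (auto simp: algebra_simps)
  show "Suc i' = m \<and> j' * m + i' = j * m + i + (m - 1) \<longleftrightarrow> Suc i' = m \<and> i = 0 \<and> j' = j"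
    using position_eq[of 0 m i j' j] assms by auto
  show "i' \<noteq> 0 \<and> j' * m + i' = j * m + i + (m + 1) \<longleftrightarrow> i' = Suc i \<and> j' = Suc j"
  proof (cases i')
    case (Suc k)
    then show ?thesis using position_eq[of k m i j' "Suc j"] assms by (auto simp: algebra_simps)
  qed simp
  show "Suc i' \<noteq> m \<and> j' * m + i' = j * m + i + (m - 1) \<longleftrightarrow> i = Suc i' \<and> j' = Suc j"
  proof (cases "Suc i' = m")
    case False
    then show ?thesis using position_eq[of "Suc i'" m i j' "Suc j"] assms by (auto simp: algebra_simps)
  qed (use assms in auto)
qed

lemma position_less_iff:
  fixes i j i' j' m :: nat
  assumes "i < m" "i' < m"
  shows "j * m + i < j' * m + i' \<longleftrightarrow> j < j' \<or> j = j' \<and> i < i'"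
proof -
  consider "j < j'" | "j = j'" | "j' < j" by linarith
  then show ?thesis
  proof cases
    case 1
    then have "Suc j * m \<le> j' * m" by (intro mult_le_mono1) simp
    then show ?thesis using 1 assms by simp
  next
    case 3
    then have "Suc j' * m \<le> j * m" by (intro mult_le_mono1) simp
    then show ?thesis using 3 assms by simp
  qed simp
qed

lemma linked_grid:
  assumes "i < m" "i' < m"
  shows "linked (\<lambda>_ _. 0) (\<lambda>_ _. 0) m (j * m + i) (j' * m + i') \<longleftrightarrow>
    (i' = Suc i \<and> j' = j) \<or> (i' = i \<and> j' = Suc j)"
proof -
  have "linked (\<lambda>_ _. 0) (\<lambda>_ _. 0) m (j * m + i) (j' * m + i') \<longleftrightarrow>
      j * m + i < j' * m + i' \<and> (i' \<noteq> 0 \<and> j' * m + i' = j * m + i + 1 \<or> j' * m + i' = j * m + i + m)"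
    using assms by (subst linked_iff) auto
  then show ?thesis unfolding position_steps[OF assms] position_less_iff[OF assms] by auto
qed

text \<open>
  In a cylinder the last vertex of a column is adjacent to the first one, which is \<open>m - 1\<close> places
  before it. For \<open>m = 1\<close> this would be a loop, and the weight \<open>3 ^ m div 9\<close> is 0; for \<open>m = 2\<close> it is
  the edge that is there already.
\<close>

definition around :: "nat \<Rightarrow> nat \<Rightarrow> nat" where
  "around m t = (if Suc t mod m = 0 then 3 ^ m div 9 else 0)"

text \<open>
  The two diagonal neighbours of a vertex of the king graph in the previous column.
\<close>

definition diagonal_up :: "nat \<Rightarrow> nat \<Rightarrow> nat" where
  "diagonal_up m t = (if t mod m = 0 then 0 else 3 ^ m)"

definition diagonal_down :: "nat \<Rightarrow> nat \<Rightarrow> nat" where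
  "diagonal_down m t = (if Suc t mod m = 0 then 0 else 3 ^ m div 9)"

lemma nine_power_eq:
  assumes "u < v"
  shows "3 ^ m div 9 = (3::nat) ^ (v - 1 - u) \<longleftrightarrow> 2 \<le> m \<and> v = u + (m - 1)"
  using assms unfolding div_nine by auto

lemma linked_cylinder:
  assumes "i < m" "i' < m"
  shows "linked (\<lambda>_ _. 0) around m (j * m + i) (j' * m + i') \<longleftrightarrow>
    (i' = Suc i \<and> j' = j) \<or> (i' = i \<and> j' = Suc j) \<or> (2 \<le> m \<and> Suc i' = m \<and> i = 0 \<and> j' = j)"
proof -
  have "linked (\<lambda>_ _. 0) around m (j * m + i) (j' * m + i') \<longleftrightarrow>
      j * m + i < j' * m + i' \<and> (i' \<noteq> 0 \<and> j' * m + i' = j * m + i + 1 \<or> j' * m + i' = j * m + i + m \<or>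
        2 \<le> m \<and> (Suc i' = m \<and> j' * m + i' = j * m + i + (m - 1)))"
    using assms position_Suc_mod[OF assms(2), of j'] nine_power_eq[of "j * m + i" "j' * m + i'" m]
    by (subst linked_iff) (auto simp: around_def)
  then show ?thesis unfolding position_steps[OF assms] position_less_iff[OF assms] by auto
qed

lemma linked_king:
  assumes "i < m" "i' < m"
  shows "linked diagonal_up diagonal_down m (j * m + i) (j' * m + i') \<longleftrightarrow>
    (i' = Suc i \<and> j' = j) \<or> (i' = i \<and> j' = Suc j) \<or> (i' = Suc i \<and> j' = Suc j) \<or>
    (i = Suc i' \<and> j' = Suc j)"
proof -
  let ?u = "j * m + i" let ?v = "j' * m + i'"
  have up: "diagonal_up m ?v = 3 ^ (?v - 1 - ?u) \<longleftrightarrow> i' \<noteq> 0 \<and> ?v = ?u + (m + 1)" if "?u < ?v"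
    using that assms by (auto simp: diagonal_up_def)
  have down: "diagonal_down m ?v = 3 ^ (?v - 1 - ?u) \<longleftrightarrow> 2 \<le> m \<and> (Suc i' \<noteq> m \<and> ?v = ?u + (m - 1))" if "?u < ?v"
    using nine_power_eq[OF that, of m] position_Suc_mod[OF assms(2), of j']
    by (auto simp: diagonal_down_def)
  have "linked diagonal_up diagonal_down m ?u ?v \<longleftrightarrow>
      ?u < ?v \<and> (i' \<noteq> 0 \<and> ?v = ?u + 1 \<or> ?v = ?u + m \<or> i' \<noteq> 0 \<and> ?v = ?u + (m + 1) \<or>
        2 \<le> m \<and> (Suc i' \<noteq> m \<and> ?v = ?u + (m - 1)))"
    using assms up down by (subst linked_iff) auto
  then show ?thesis unfolding position_steps[OF assms] position_less_iff[OF assms]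
    using assms by auto
qed

lemma zero_or_power:
  assumes "1 \<le> m"
  shows "around m t = 0 \<or> (\<exists>d\<le>m. around m t = 3 ^ d)"
    and "diagonal_up m t = 0 \<or> (\<exists>d\<le>m. diagonal_up m t = 3 ^ d)"
    and "diagonal_down m t = 0 \<or> (\<exists>d\<le>m. diagonal_down m t = 3 ^ d)"
proof -
  have "m - 2 \<le> m" by simp
  then have "(3::nat) ^ m div 9 = 0 \<or> (\<exists>d\<le>m. (3::nat) ^ m div 9 = 3 ^ d)"
    unfolding div_nine by auto
  then show "around m t = 0 \<or> (\<exists>d\<le>m. around m t = 3 ^ d)"
    and "diagonal_down m t = 0 \<or> (\<exists>d\<le>m. diagonal_down m t = 3 ^ d)"
    unfolding around_def diagonal_down_def by auto
  show "diagonal_up m t = 0 \<or> (\<exists>d\<le>m. diagonal_up m t = 3 ^ d)"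
    unfolding diagonal_up_def by auto
qed

lemma weight_exprs:
  assumes m: "1 \<le> m" and room: "9 * 3 ^ m + t + m + 2 < word_bound M"
    and s: "reg s rM = m" "reg s rP = 3 ^ m" "reg s rT = t"
  shows "legal M s (((Reg rT \<^bold>+ Const 1) \<^bold>% Reg rM \<^bold>= Const 0) \<^bold>* (Reg rP \<^bold>/ Const 9))"
      "eval s (((Reg rT \<^bold>+ Const 1) \<^bold>% Reg rM \<^bold>= Const 0) \<^bold>* (Reg rP \<^bold>/ Const 9)) = around m t"
    and "legal M s ((Const 0 \<^bold>< Reg rT \<^bold>% Reg rM) \<^bold>* Reg rP)"
      "eval s ((Const 0 \<^bold>< Reg rT \<^bold>% Reg rM) \<^bold>* Reg rP) = diagonal_up m t"
    and "legal M s ((Const 0 \<^bold>< (Reg rT \<^bold>+ Const 1) \<^bold>% Reg rM) \<^bold>* (Reg rP \<^bold>/ Const 9))"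
      "eval s ((Const 0 \<^bold>< (Reg rT \<^bold>+ Const 1) \<^bold>% Reg rM) \<^bold>* (Reg rP \<^bold>/ Const 9)) = diagonal_down m t"
proof -
  have "(1::nat) \<le> 3 ^ m" by simp
  then have b: "(3::nat) ^ m < word_bound M" "Suc t < word_bound M" "m < word_bound M"
    "9 < word_bound M"
    using room by linarith+
  have c: "t mod m < word_bound M" "Suc t mod m < word_bound M" "(3::nat) ^ m div 9 < word_bound M"
    using le_less_trans[OF mod_less_eq_dividend b(2)] le_less_trans[OF mod_less_eq_dividend, of t]
      le_less_trans[OF div_le_dividend b(1)] b(2) by simp_all
  have "t < word_bound M" "1 < word_bound M" "0 < word_bound M" using b by simp_all
  note this b c
  then show "legal M s (((Reg rT \<^bold>+ Const 1) \<^bold>% Reg rM \<^bold>= Const 0) \<^bold>* (Reg rP \<^bold>/ Const 9))"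
    "legal M s ((Const 0 \<^bold>< Reg rT \<^bold>% Reg rM) \<^bold>* Reg rP)"
    "legal M s ((Const 0 \<^bold>< (Reg rT \<^bold>+ Const 1) \<^bold>% Reg rM) \<^bold>* (Reg rP \<^bold>/ Const 9))"
    using s by simp_all
qed (use s in \<open>simp_all add: around_def diagonal_up_def diagonal_down_def\<close>)

section \<open>Time and space bounds\<close>

text \<open>
  With \<open>X = 3 ^ m * (n + 1)\<close>, the left-hand side is at most a constant times \<open>X\<^sup>2\<close>, and \<open>X \<ge> 6\<close>.
\<close>

lemma nat_room:
  fixes m n K :: nat
  assumes m: "1 \<le> m" and n: "1 \<le> n" and K: "K \<le> 27 * 3 ^ m"
  shows "9 * 3 ^ m + 2 * (K * (m * n + 1)) + 2 * K + 2 * (m * n) + 2 * m + 12 < word_size 5 m n"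
proof -
  define X where "X = 3 ^ m * (n + 1)"
  have m3: "m \<le> 3 ^ m"
    using less_exp[of m] power_mono[of "2::nat" 3 m] by linarith
  have "(3::nat) ^ 1 \<le> 3 ^ m" using m by (intro power_increasing) auto
  then have X6: "3 * 2 \<le> X" unfolding X_def using n by (intro mult_le_mono) auto
  have X1: "3 ^ m \<le> X" by (simp add: X_def)
  have "m * n + 1 \<le> 3 ^ m * n + 3 ^ m" using m3 by (intro add_mono mult_le_mono1) auto
  then have Q: "m * n + 1 \<le> X" by (simp add: X_def)
  have "K * (m * n + 1) \<le> (27 * X) * X" using K X1 Q by (intro mult_le_mono) auto
  moreover have "6 * X \<le> X * X" using X6 by (intro mult_le_mono1) simp
  moreover have "216 \<le> X * X * X"
  proof -
    have "6 * 6 * 6 \<le> X * X * X" using X6 by (intro mult_le_mono) auto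
    then show ?thesis by simp
  qed
  then have "216 * (X * X) \<le> X * X * X * (X * X)" by (rule mult_le_mono1)
  moreover have "word_size 5 m n = X * X * X * (X * X)"
    by (simp add: word_size_def X_def eval_nat_numeral mult.assoc)
  ultimately show ?thesis using K X1 Q X6 m3 by linarith
qed

text \<open>
  Everything is bounded in terms of \<open>A = m * n\<close> and \<open>l ^ m\<close>: the number of rounds by \<open>3 * A\<close>,
  the lists by \<open>27 * l ^ m\<close> since \<open>l \<le> 3\<close>, and the number of coefficients as well as the cost of a
  container operation by a multiple of \<open>A\<close>. The constants are not optimized.
\<close>

lemma algorithm_of_weights:
  fixes G :: "nat \<Rightarrow> nat \<Rightarrow> (nat \<times> nat) graph"
  assumes l: "l = 1 + sqrt 2"
    and wa: "\<And>m t. 1 \<le> m \<Longrightarrow> a m t = 0 \<or> (\<exists>d\<le>m. a m t = 3 ^ d)"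
    and wb: "\<And>m t. 1 \<le> m \<Longrightarrow> b m t = 0 \<or> (\<exists>d\<le>m. b m t = 3 ^ d)"
    and expr: "\<And>M s m t. 1 \<le> m \<Longrightarrow> 9 * 3 ^ m + t + m + 2 < word_bound M \<Longrightarrow>
       reg s rM = m \<Longrightarrow> reg s rP = 3 ^ m \<Longrightarrow> reg s rT = t \<Longrightarrow>
       legal M s ea \<and> eval s ea = a m t \<and> legal M s eb \<and> eval s eb = b m t"
    and cost: "cost ea + cost eb \<le> 40"
    and V: "\<And>m n. verts (G m n) = {..<m} \<times> {..<n}"
    and E: "\<And>m n i j i' j'. i < m \<Longrightarrow> i' < m \<Longrightarrow> j < n \<Longrightarrow> j' < n \<Longrightarrow>
       {(i, j), (i', j')} \<in> edges (G m n) \<longleftrightarrow>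
       linked a b m (j * m + i) (j' * m + i') \<or> linked a b m (j' * m + i') (j * m + i)"
  shows "domination_poly_algorithm G
           (\<lambda>m n. real m ^ 3 * real n ^ 2 * l ^ m) (\<lambda>m n. real m * real n * l ^ m)"
  unfolding domination_poly_algorithm_def
proof (intro exI[of _ "program (load_weights ea eb)"] exI[of _ "5::nat"]
    exI[of _ "60000::real"] allI impI)
  fix m n :: nat and p :: int
  assume m: "1 \<le> m" and n: "1 \<le> n"
  define N where "N = m * n"
  define K where "K = nat \<lfloor>l ^ (m + 3)\<rfloor>"
  define M where "M = \<lparr>modulus = p, word_bound = word_size 5 m n, word_cap = 2 * K,
    coef_cap = 2 * (K * (N + 1)), entry_cap = K\<rparr>"
  let ?ws = "weights_of a b m"
  have "sqrt 2 \<le> sqrt 4" by (rule real_sqrt_le_mono) simp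
  then have l3: "1 \<le> l" "l \<le> 3" using l by simp_all
  have Kl: "real K \<le> l ^ (m + 3)" unfolding K_def using l3 by (intro of_nat_floor) simp
  have "l ^ 3 \<le> 3 ^ 3" using l3 by (intro power_mono) auto
  then have "l ^ m * l ^ 3 \<le> l ^ m * 27" using l3 by (intro mult_left_mono) auto
  then have K27: "real K \<le> 27 * l ^ m" using Kl by (simp add: power_add)
  also have "\<dots> \<le> 27 * 3 ^ m" using l3 by (intro mult_left_mono power_mono) auto
  finally have "real K \<le> real (27 * 3 ^ m)" by simp
  then have K3: "K \<le> 27 * 3 ^ m" by (simp only: of_nat_le_iff)
  have weights: "w = 0 \<or> (\<exists>d\<le>m. w = 3 ^ d)" if "w \<in> set (?ws t)" for t w
  proof -
    from that consider "w = 0" | "w = 3 ^ 0" | "w = 3 ^ (m - 1)" | "w = a m t" | "w = b m t"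
      unfolding weights_of_def div_three[OF m] by (auto split: if_splits)
    then show ?thesis using wa[OF m, of t] wb[OF m, of t] by cases (blast intro: diff_le_self le0)+
  qed
  have column: "1 \<in> set (?ws t)" if "t mod m \<noteq> 0" for t
    using that by (simp add: weights_of_def)
  interpret frontier m N ?ws
    by unfold_locales (use m weights column in blast)+
  have R: "card (reach t) \<le> K" for t
    unfolding K_def using card_reach(2)[of t] l by (intro le_nat_floor) simp
  interpret sweep m N ?ws M K "N + 1"
    by unfold_locales (use nat_room[OF m n K3] in \<open>simp_all add: M_def N_def\<close>)
  have W: "loads_weights (load_weights ea eb)"
    unfolding loads_weights_def
  proof (intro allI impI)
    fix s :: state and t :: nat
    assume t: "t \<le> N + m" and s: "reg s rM = m" "reg s rP = 3 ^ m" "reg s rT = t"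
    have room': "9 * 3 ^ m + t + m + 2 < word_bound M" using room t by linarith
    define w1 :: nat where "w1 = (if t mod m = 0 then 0 else 1)"
    define w2 :: nat where "w2 = 3 ^ m div 3"
    have e1: "legal M (s\<lparr>reg := (reg s)(rW1 := w1, rW2 := w2)\<rparr>) ea"
      "eval (s\<lparr>reg := (reg s)(rW1 := w1, rW2 := w2)\<rparr>) ea = a m t"
      using expr[OF m room', of "s\<lparr>reg := (reg s)(rW1 := w1, rW2 := w2)\<rparr>"] s by simp_all
    have e2: "legal M (s\<lparr>reg := (reg s)(rW1 := w1, rW2 := w2, rW3 := a m t)\<rparr>) eb"
      "eval (s\<lparr>reg := (reg s)(rW1 := w1, rW2 := w2, rW3 := a m t)\<rparr>) eb = b m t"
      using expr[OF m room', of "s\<lparr>reg := (reg s)(rW1 := w1, rW2 := w2, rW3 := a m t)\<rparr>"] s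
      by simp_all
    have "t mod m \<le> t" "w2 \<le> 3 ^ m" "(1::nat) \<le> 3 ^ m" by (simp_all add: w2_def)
    then have bounds: "t mod m < word_bound M" "w2 < word_bound M" "t < word_bound M"
      "m < word_bound M" "(3::nat) ^ m < word_bound M" "3 < word_bound M" "1 < word_bound M"
      using room' by linarith+
    have first: "legal M s (Const 0 \<^bold>< Reg rT \<^bold>% Reg rM)" "eval s (Const 0 \<^bold>< Reg rT \<^bold>% Reg rM) = w1"
      using s bounds by (simp_all add: w1_def)
    let ?s = "s\<lparr>reg := (reg s)(rW1 := w1)\<rparr>"
    have second: "legal M ?s (Reg rP \<^bold>/ Const 3)" "eval ?s (Reg rP \<^bold>/ Const 3) = w2"
      using s bounds by (simp_all add: w2_def)
    have "wp M (load_weights ea eb) s (\<lambda>\<tau> s'. \<tau> \<le> 60 \<and>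
        s' = s\<lparr>reg := (reg s)(rW1 := w1, rW2 := w2, rW3 := a m t, rW4 := b m t)\<rparr>)"
      unfolding load_weights_def using first second e1 e2 cost
      by (simp del: legal.simps eval.simps)
    moreover have "?ws t = [w1, w2, a m t, b m t]"
      by (simp add: weights_of_def w1_def w2_def)
    ultimately show "\<exists>w1 w2 w3 w4. ?ws t = [w1, w2, w3, w4] \<and> wp M (load_weights ea eb) s (\<lambda>\<tau> s'. \<tau> \<le> 60 \<and>
        s' = s\<lparr>reg := (reg s)(rW1 := w1, rW2 := w2, rW3 := w3, rW4 := w4)\<rparr>)"
      by (intro exI conjI)
  qed
  have poly: "coeff (domination_poly (G m n)) j = int (count (N + m + 1) 0 j)" for j
  proof (rule coeff_domination_poly_count[OF N_def V])
    fix u v assume uv: "u \<in> verts (G m n)" "v \<in> verts (G m n)"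
    obtain i j i' j' where [simp]: "u = (i, j)" "v = (i', j')" by (cases u, cases v)
    have b: "i < m" "i' < m" "j < n" "j' < n" using uv by (simp_all add: V)
    then have "j * m + i < N" "j' * m + i' < N" unfolding N_def by (simp_all add: position_less)
    then show "{u, v} \<in> edges (G m n) \<longleftrightarrow>
        adj (position m u) (position m v) \<or> adj (position m v) (position m u)"
      using E[OF b] by (simp add: position_def adj_def linked_def)
  qed
  obtain \<tau> s where run: "exec M (program (load_weights ea eb)) (init_state m n) \<tau> s"
    and \<tau>: "\<tau> \<le> total_time"
    and res: "\<forall>j\<le>N. coefs s j = int (count (N + m + 1) 0 j) mod modulus M"
    using program_correct[OF N_def n W R] unfolding wp_def by blast
  have computes: "computes_domination_poly (program (load_weights ea eb)) M G m n \<tau>"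
    unfolding computes_domination_poly_def
    using run res by (intro exI[of _ s]) (simp add: V poly N_def)
  define A where "A = real m * real n"
  have mA: "real m \<le> A" and A1: "1 \<le> A" and NA: "real N = A"
    using m n mult_mono[of 1 "real m" 1 "real n"] mult_left_mono[of 1 "real n" "real m"]
    by (simp_all add: A_def N_def)
  have lm: "1 \<le> l ^ m" using l3 by simp
  have lookup_cost: "lookup_cost \<le> 2 * m + 6"
  proof -
    have "2 ^ floor_log (1 + K) \<le> 1 + K" by (rule floor_log_exp2_le) simp
    also have "\<dots> \<le> 32 * 4 ^ m"
    proof -
      have "(3::nat) ^ m \<le> 4 ^ m" by (rule power_mono) auto
      moreover have "(1::nat) \<le> 4 ^ m" by simp
      ultimately show ?thesis using K3 by linarith
    qed
    also have "(32::nat) * 4 ^ m = 2 ^ (2 * m + 5)" by (simp add: power_add power_mult)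
    finally have "floor_log (1 + K) \<le> 2 * m + 5" by (simp only: power_increasing_iff one_less_numeral_iff semiring_norm)
    then show ?thesis by (simp add: lookup_cost_def)
  qed
  have K_le: "real K \<le> 27 * l ^ m" by (rule K27)
  have p: "1 \<le> l ^ m * A" using mult_mono[OF lm A1] lm by simp
  have round: "real round_time \<le> 18000 * (l ^ m * A)"
  proof -
    have "real lookup_cost \<le> 2 * real m + 6" using of_nat_mono[OF lookup_cost, where 'a = real] by simp
    then have *: "5 * real lookup_cost + 92 * (real N + 1) + 390 \<le> 614 * A"
      unfolding NA using mA A1 by argo
    have "real K * (5 * real lookup_cost + 92 * (real N + 1) + 390) \<le> (27 * l ^ m) * (614 * A)"
      by (rule mult_mono[OF K_le *]) (use lm in simp_all)
    moreover have "real round_time = real K * (5 * real lookup_cost + 92 * (real N + 1) + 390) + 200"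
      unfolding round_time_def by simp
    ultimately show ?thesis using p by argo
  qed
  have A2: "A * (l ^ m * A) \<le> real m ^ 3 * real n ^ 2 * l ^ m"
  proof -
    have "A * (l ^ m * A) = 1 * (real m ^ 2 * real n ^ 2 * l ^ m)"
      by (simp add: A_def power2_eq_square)
    also have "\<dots> \<le> real m * (real m ^ 2 * real n ^ 2 * l ^ m)"
      using m l3 by (intro mult_right_mono) auto
    finally show ?thesis by (simp add: power3_eq_cube power2_eq_square mult.assoc)
  qed
  have "real \<tau> \<le> 60000 * (real m ^ 3 * real n ^ 2 * l ^ m)"
  proof -
    have q: "A \<le> A * (l ^ m * A)" using mult_left_mono[OF p, of A] A1 by simp
    have 1: "real N + real m + 1 \<le> 3 * A" using mA NA A1 by argo
    have 2: "real round_time + 10 \<le> 18010 * (l ^ m * A)" using round p by argo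
    define R where "R = (real N + real m + 1) * (real round_time + 10)"
    define B where "B = A * (l ^ m * A)"
    have "R \<le> (3 * A) * (18010 * (l ^ m * A))"
      unfolding R_def by (rule mult_mono[OF 1 2]) (use A1 in simp_all)
    then have R: "R \<le> 54030 * B" by (simp add: B_def mult.assoc)
    have "real total_time = R + 20 * real m + 20 * (real N + 1) + 100"
      unfolding total_time_def R_def by (simp add: algebra_simps)
    then have "real total_time \<le> 60000 * B"
      using R mA NA q A1 unfolding B_def[symmetric] by argo
    moreover have "real \<tau> \<le> real total_time" using \<tau> by simp
    ultimately show ?thesis using A2 unfolding B_def by argo
  qed
  moreover have "real (space M) \<le> 60000 * (real m * real n * l ^ m)"
  proof -
    have 1: "4 + 2 * (A + 1) \<le> 8 * A" using A1 by argo
    have "real K * (4 + 2 * (A + 1)) \<le> (27 * l ^ m) * (8 * A)"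
      by (rule mult_mono[OF K_le 1]) (use lm A1 in simp_all)
    moreover have "real (space M) = real K * (4 + 2 * (A + 1))"
      by (simp add: space_def M_def NA[symmetric] algebra_simps)
    moreover have "real m * real n * l ^ m = l ^ m * A" by (simp add: A_def)
    ultimately show ?thesis using p by argo
  qed
  ultimately show "\<exists>M t. modulus M = p \<and> word_bound M = word_size 5 m n \<and>
      computes_domination_poly (program (load_weights ea eb)) M G m n t \<and>
      real t \<le> 60000 * (real m ^ 3 * real n ^ 2 * l ^ m) \<and>
      real (space M) \<le> 60000 * (real m * real n * l ^ m)"
    using computes by (intro exI[of _ M] exI[of _ \<tau>]) (simp add: M_def)
qed

lemma grid_algorithm:
  assumes "l = 1 + sqrt 2"
  shows "domination_poly_algorithm grid_graph
    (\<lambda>m n. real m ^ 3 * real n ^ 2 * l ^ m) (\<lambda>m n. real m * real n * l ^ m)"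
proof (rule algorithm_of_weights[OF assms, where a = "\<lambda>_ _. 0" and b = "\<lambda>_ _. 0" and
      ea = "Const 0" and eb = "Const 0"], goal_cases)
  case (6 m n i j i' j')
  have v: "i \<in> verts (path_graph m)" "j \<in> verts (path_graph n)"
    using 6 by (simp_all add: path_graph_def)
  show ?case
    unfolding grid_graph_def cartesian_edge path_edge linked_grid[OF 6(1,2)] linked_grid[OF 6(2,1)]
    using v 6 by (intro iffI; elim disjE conjE; simp)
qed (simp_all add: verts_graphs)

lemma cylinder_algorithm:
  assumes "l = 1 + sqrt 2"
  shows "domination_poly_algorithm cylinder_graph
    (\<lambda>m n. real m ^ 3 * real n ^ 2 * l ^ m) (\<lambda>m n. real m * real n * l ^ m)"
proof (rule algorithm_of_weights[OF assms, where a = "\<lambda>_ _. 0" and b = around and ea = "Const 0" and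
      eb = "((Reg rT \<^bold>+ Const 1) \<^bold>% Reg rM \<^bold>= Const 0) \<^bold>* (Reg rP \<^bold>/ Const 9)"], goal_cases)
  case (6 m n i j i' j')
  have v: "i \<in> verts (cycle_graph m)" "j \<in> verts (path_graph n)"
    using 6 by (simp_all add: path_graph_def cycle_graph_def)
  have Suc_mod: "Suc x mod m = (if Suc x = m then 0 else Suc x)" if "x < m" for x
    using that by (simp add: mod_Suc)
  have c: "{i, i'} \<in> edges (cycle_graph m) \<longleftrightarrow> i' = Suc i \<or> i = Suc i' \<or>
      2 \<le> m \<and> Suc i = m \<and> i' = 0 \<or> 2 \<le> m \<and> Suc i' = m \<and> i = 0"
    unfolding cycle_edge Suc_mod[OF 6(1)] Suc_mod[OF 6(2)] using 6(1,2)
    by (cases "Suc i = m"; cases "Suc i' = m") auto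
  show ?case
    unfolding cylinder_graph_def cartesian_edge path_edge c
      linked_cylinder[OF 6(1,2)] linked_cylinder[OF 6(2,1)]
    using v 6 by (intro iffI; elim disjE conjE; simp)
next
  case (3 M s m t)
  then show ?case using weight_exprs(1,2)[OF 3] by simp
qed (use zero_or_power in \<open>simp_all add: verts_graphs\<close>)

lemma king_algorithm:
  assumes "l = 1 + sqrt 2"
  shows "domination_poly_algorithm king_graph
    (\<lambda>m n. real m ^ 3 * real n ^ 2 * l ^ m) (\<lambda>m n. real m * real n * l ^ m)"
proof (rule algorithm_of_weights[OF assms, where a = diagonal_up and b = diagonal_down and
      ea = "(Const 0 \<^bold>< Reg rT \<^bold>% Reg rM) \<^bold>* Reg rP" and
      eb = "(Const 0 \<^bold>< (Reg rT \<^bold>+ Const 1) \<^bold>% Reg rM) \<^bold>* (Reg rP \<^bold>/ Const 9)"], goal_cases)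
  case (6 m n i j i' j')
  have v: "i \<in> verts (path_graph m)" "j \<in> verts (path_graph n)"
    using 6 by (simp_all add: path_graph_def)
  show ?case
    unfolding king_graph_def strong_edge cartesian_edge path_edge
      linked_king[OF 6(1,2)] linked_king[OF 6(2,1)]
    using v 6 by (intro iffI; elim disjE conjE; simp)
next
  case (3 M s m t)
  then show ?case using weight_exprs(3-6)[OF 3] by blast
qed (use zero_or_power in \<open>simp_all add: verts_graphs\<close>)

theorem mainTheorem3:
  fixes l :: real
  assumes "l = 1 + sqrt 2"
  shows "\<forall>G \<in> {grid_graph, cylinder_graph, king_graph}.
           domination_poly_algorithm G
             (\<lambda>m n. real m ^ 3 * real n ^ 2 * l ^ m)
             (\<lambda>m n. real m * real n * l ^ m)"
  using grid_algorithm[OF assms] cylinder_algorithm[OF assms] king_algorithm[OF assms] by simp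

end
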